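(* Let $\rho_1,\rho_2$ be two boundary-preserving isomorphic Fuchsian representations of $G=\pi_1S$ satisfying the extended Schottky condition, with associated countable Markov shift $(\Sigma^+,\sigma)$ and geometric potentials $\tau,\kappa$. Let $(a,b)\in D$ and let $t_{a,b}$ be the solution of $P_\sigma(-t_{a,b}(a\tau+b\kappa))=0$. Then, for all $x,y\in\mathbb{H}\times\mathbb{H}$, $$t_{a,b}=\delta^{a,b}=\lim_{s\to\infty}\frac1s\log\overline{G}^{a,b}_{x,y}(s),\qquad\text{where } \overline{G}^{a,b}_{x,y}(s)=\#\{\gamma\in G:\ d^{a,b}(x,\gamma y)\le s\}.$$
   Context: $D=\{(x,y)\in\mathbb{R}^2:x\ge0,y\ge0\}\setminus\{(0,0)\}$. $\mathbb{H}$ is the hyperbolic plane (Poincaré disk model), $\partial_\infty\mathbb{H}=S^1$ its boundary, $d$ its distance; $\mathrm{PSL}(2,\mathbb{R})$ acts by isometries. $S$ is a surface with negative Euler characteristic and $G=\pi_1S$. A Fuchsian representation is a discrete faithful representation $\rho:G\to\mathrm{PSL}(2,\mathbb{R})$. Extended Schottky condition: $\rho(G)$ is generated by hyperbolic isometries $h_1,\dots,h_{N_1}$ and parabolic isometries $p_1,\dots,p_{N_2}$ with $N_2\ge1$, $N_1+N_2\ge3$, such that: (C1) for each $i$ there are compact neighborhoods $C_{h_i}$, $C_{h_i^{-1}}$ in $S^1$ of the attracting and repelling fixed points of $h_i$ with $h_i(S^1\setminus C_{h_i^{-1}})\subset C_{h_i}$; (C2) for each $i$ there is a compact neighborhood $C_{p_i}$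 in $S^1$ of the fixed point of $p_i$ with $p_i^n(S^1\setminus C_{p_i})\subset C_{p_i}$ for all $n\in\mathbb{Z}\setminus\{0\}$; (C3) these $2N_1+N_2$ neighborhoods are pairwise disjoint. Such a group is free on these generators. Boundary-preserving isomorphic: the isomorphism $\iota=\rho_2\circ\rho_1^{-1}:\rho_1(G)\to\rho_2(G)$ sends hyperbolic elements to hyperbolic elements and parabolic elements to parabolic elements, and $\gamma\in\rho_1(G)$ corresponds to a geodesic boundary of $S_1=\rho_1(G)\backslash\mathbb{H}$ iff $\iota(\gamma)$ corresponds to a geodesic boundary of $S_2=\rho_2(G)\backslash\mathbb{H}$. Generators $\mathcal{A}=\{h_1,\dots,h_{N_1},p_1,\dots,p_{N_2}\}$ of $G$ are fixed so that for $i=1,2$ the elements $\rho_i(h_j)$ are hyperbolic, $\rho_i(p_k)$ are parabolic, and they are extended Schottky generators of $\rho_i(G)$. Markov shift: $\Sigma^+=\{(a_i^{n_i})_{i\ge1}:a_i\in\mathcal{A},\ n_i\in\mathbb{Z}\setminus\{0\},\ a_i\ne a_{i+1}\}$ with alphabet $\{a^n:a\in\mathcal{A},n\in\mathbb{Z}\setminus\{0\}\}$, and $\sigma$ the left shift. Geometric potentials: let $\Lambda_i^0$ be the limit set of $\rho_i(G)$ minus the $\rho_i(G)$-orbits of fixed points of $\rho_i(\alpha)$, $\alpha\in\mathcal{A}$. There is a bijection $\omega_i:\Lambda_i^0\to\Sigma^+$ with $\omega_i^{-1}(x)=\lim_k\rho_i(a_1^{n_1}\cdots a_k^{n_k})o$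 for $x=a_1^{n_1}a_2^{n_2}\cdots$ ($o$ the origin of the disk). With the Busemann function $B_\xi(x,y)=\lim_{z\to\xi}\big(d(x,z)-d(y,z)\big)$, put $\tau(x)=B_{\omega_1^{-1}(x)}(o,\rho_1(a_1^{n_1})o)$ and $\kappa(x)=B_{\omega_2^{-1}(x)}(o,\rho_2(a_1^{n_1})o)$. (The paper also writes $\tau,\kappa$ for cohomologous locally Hölder functions bounded away from $0$; this does not change pressures.) Gurevich pressure: $P_\sigma(g)=\lim_{n\to\infty}\frac1n\log\sum_{x:\sigma^nx=x}e^{S_ng(x)}\chi_{[s]}(x)$ with $S_ng=\sum_{i=0}^{n-1}g\circ\sigma^i$ and $[s]$ the set of sequences whose first symbol is $s$; it is independent of the symbol $s$. For each $(a,b)\in D$ the equation $P_\sigma(-t(a\tau+b\kappa))=0$ has exactly one solution $t=t_{a,b}$, and it lies in $(\frac{1}{2(a+b)},\infty)$. Weighted Manhattan metric: for $x=(x_1,x_2),y=(y_1,y_2)\in\mathbb{H}\times\mathbb{H}$ and $\gamma\in G$, $d^{a,b}(x,\gamma y)=a\,d(x_1,\rho_1(\gamma)y_1)+b\,d(x_2,\rho_2(\gamma)y_2)$. $\delta^{a,b}$ is the critical exponent of $Q^{a,b}(s)=\sum_{\gamma\in G}e^{-s\,d^{a,b}(o,\gamma o)}$, $o\in\mathbb{H}\times\mathbb{H}$: the series diverges for $s<\delta^{a,b}$ and converges for $s>\delta^{a,b}$ (independent of $o$). *)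

theory Defs
  imports "HOL-Analysis.Analysis" "HOL-Homology.Homology"
begin

section \<open>The hyperbolic plane and PSL(2,R)\<close>

text \<open>The hyperbolic plane is the open unit disk, its boundary at infinity the unit circle;
  the metric has curvature \<open>-1\<close>.\<close>

abbreviation hyp_plane :: "complex set" where
  "hyp_plane \<equiv> ball 0 1"

abbreviation hyp_boundary :: "complex set" where
  "hyp_boundary \<equiv> sphere 0 1"

definition hdist :: "complex \<Rightarrow> complex \<Rightarrow> real" where
  "hdist z w = arcosh (1 + 2 * (cmod (z - w))\<^sup>2 / ((1 - (cmod z)\<^sup>2) * (1 - (cmod w)\<^sup>2)))"

definition SL2R :: "(real^2^2) monoid" where
  "SL2R = \<lparr>carrier = {A. det A = 1}, monoid.mult = (**), one = mat 1\<rparr>"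

definition PSL2R :: "(real^2^2) set monoid" where
  "PSL2R = SL2R Mod {mat 1, - mat 1}"

text \<open>The action of a matrix on the closed disk is the fractional linear action on the upper
  half plane, conjugated by the Cayley transform; see \<open>disk_act_cayley\<close> below.\<close>

definition disk_act :: "real^2^2 \<Rightarrow> complex \<Rightarrow> complex" where
  "disk_act A =
     (let \<alpha> = Complex ((A$1$1 + A$2$2) / 2) ((A$1$2 - A$2$1) / 2);
          \<beta> = Complex ((A$1$1 - A$2$2) / 2) (- (A$1$2 + A$2$1) / 2)
      in moebius \<alpha> \<beta> (cnj \<beta>) (cnj \<alpha>))"

definition cayley :: "complex \<Rightarrow> complex" where
  "cayley z = (z - \<i>) / (z + \<i>)"

text \<open>Elements of \<open>PSL2R\<close> are cosets \<open>{A, -A}\<close>, whose two members act identically.\<close>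

definition psl_act :: "(real^2^2) set \<Rightarrow> complex \<Rightarrow> complex" where
  "psl_act g z = the_elem ((\<lambda>A. disk_act A z) ` g)"

definition boundary_fixpoints :: "(real^2^2) set \<Rightarrow> complex set" where
  "boundary_fixpoints g = {\<xi> \<in> hyp_boundary. psl_act g \<xi> = \<xi>}"

definition hyperbolic :: "(real^2^2) set \<Rightarrow> bool" where
  "hyperbolic g \<longleftrightarrow> g \<in> carrier PSL2R \<and> card (boundary_fixpoints g) = 2"

definition parabolic :: "(real^2^2) set \<Rightarrow> bool" where
  "parabolic g \<longleftrightarrow> g \<in> carrier PSL2R \<and> card (boundary_fixpoints g) = 1"

definition attracting_point :: "(real^2^2) set \<Rightarrow> complex" where
  "attracting_point g = (THE \<xi>. \<xi> \<in> boundary_fixpoints g \<and>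
     (\<forall>z\<in>hyp_plane. (\<lambda>n::nat. psl_act (g [^]\<^bsub>PSL2R\<^esub> n) z) \<longlonglongrightarrow> \<xi>))"

definition repelling_point :: "(real^2^2) set \<Rightarrow> complex" where
  "repelling_point g = attracting_point (inv\<^bsub>PSL2R\<^esub> g)"

definition parabolic_point :: "(real^2^2) set \<Rightarrow> complex" where
  "parabolic_point g = the_elem (boundary_fixpoints g)"

definition busemann :: "complex \<Rightarrow> complex \<Rightarrow> complex \<Rightarrow> real" where
  "busemann \<xi> x y = Lim (at \<xi> within hyp_plane) (\<lambda>z. hdist x z - hdist y z)"


section \<open>Surfaces and their fundamental groups\<close>

definition fundamental_group :: "'a::topological_space set \<Rightarrow> 'a \<Rightarrow> (real \<Rightarrow> 'a) set monoid" where
  "fundamental_group S p =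
     \<lparr>carrier = {Collect (homotopic_paths S g) | g.
                   path g \<and> path_image g \<subseteq> S \<and> pathstart g = p \<and> pathfinish g = p},
      monoid.mult = (\<lambda>X Y. {h. \<exists>f\<in>X. \<exists>g\<in>Y. homotopic_paths S (f +++ g) h}),
      one = Collect (homotopic_paths S (\<lambda>_. p))\<rparr>"

text \<open>A connected 2-manifold, possibly with boundary (the model space is the closed half plane).\<close>

definition surface :: "'a::topological_space set \<Rightarrow> bool" where
  "surface S \<longleftrightarrow> S \<noteq> {} \<and> connected S \<and>
     Hausdorff_space (top_of_set S) \<and> second_countable (top_of_set S) \<and>
     (\<forall>x\<in>S. \<exists>U (V::complex set). openin (top_of_set S) U \<and> x \<in> U \<and>
        openin (top_of_set {z. Im z \<ge> 0}) V \<and> U homeomorphic V)"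

definition int_independent :: "('g, 'm) monoid_scheme \<Rightarrow> 'g set \<Rightarrow> bool" where
  "int_independent A B \<longleftrightarrow> finite B \<and> B \<subseteq> carrier A \<and>
     (\<forall>c::'g \<Rightarrow> int. finprod A (\<lambda>x. x [^]\<^bsub>A\<^esub> c x) B = \<one>\<^bsub>A\<^esub> \<longrightarrow> (\<forall>x\<in>B. c x = 0))"

definition betti_number :: "nat \<Rightarrow> 'a topology \<Rightarrow> nat" where
  "betti_number n X = Sup (card ` {B. int_independent (homology_group (int n) X) B})"

text \<open>Meaningful for spaces whose total homology has finite rank, as is the case for surfaces
  with finitely generated fundamental group.\<close>

definition euler_characteristic :: "'a topology \<Rightarrow> int" where
  "euler_characteristic X = (\<Sum>n | betti_number n X \<noteq> 0. (- 1) ^ n * int (betti_number n X))"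


section \<open>Fuchsian representations and the extended Schottky condition\<close>

text \<open>\<open>PSL2R\<close> carries the quotient topology of \<open>SL2R\<close>; cosets are themselves sets of matrices.\<close>

definition PSL2R_topology :: "(real^2^2) set topology" where
  "PSL2R_topology = topology (\<lambda>U. U \<subseteq> carrier PSL2R \<and> openin (top_of_set (carrier SL2R)) (\<Union>U))"

definition fuchsian :: "('g, 'm) monoid_scheme \<Rightarrow> ('g \<Rightarrow> (real^2^2) set) \<Rightarrow> bool" where
  "fuchsian G \<rho> \<longleftrightarrow> \<rho> \<in> mon G PSL2R \<and>
     subtopology PSL2R_topology (\<rho> ` carrier G) = discrete_topology (\<rho> ` carrier G)"

definition compact_boundary_nbhd :: "complex \<Rightarrow> complex set \<Rightarrow> bool" where
  "compact_boundary_nbhd \<xi> C \<longleftrightarrow>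
     compact C \<and> C \<subseteq> hyp_boundary \<and> \<xi> \<in> top_of_set hyp_boundary interior_of C"

text \<open>For \<open>h \<in> Hs\<close> the neighbourhoods of the attracting and of the repelling fixed point are
  \<open>C h\<close> and \<open>C' h\<close>, and for \<open>p \<in> Ps\<close> that of the parabolic fixed point is \<open>E p\<close>.\<close>

definition extended_schottky ::
    "(real^2^2) set set \<Rightarrow> (real^2^2) set set \<Rightarrow> (real^2^2) set set \<Rightarrow> bool" where
  "extended_schottky \<Gamma> Hs Ps \<longleftrightarrow>
     finite Hs \<and> finite Ps \<and> (\<forall>h\<in>Hs. hyperbolic h) \<and> (\<forall>p\<in>Ps. parabolic p) \<and>
     card Ps \<ge> 1 \<and> card Hs + card Ps \<ge> 3 \<and>
     generate PSL2R (Hs \<union> Ps) = \<Gamma> \<and>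
     (\<exists>C C' E.
        (\<forall>h\<in>Hs. compact_boundary_nbhd (attracting_point h) (C h) \<and>
                compact_boundary_nbhd (repelling_point h) (C' h) \<and>
                psl_act h ` (hyp_boundary - C' h) \<subseteq> C h) \<and>
        (\<forall>p\<in>Ps. compact_boundary_nbhd (parabolic_point p) (E p) \<and>
                (\<forall>n::int. n \<noteq> 0 \<longrightarrow>
                   psl_act (p [^]\<^bsub>PSL2R\<^esub> n) ` (hyp_boundary - E p) \<subseteq> E p)) \<and>
        disjoint_family_on (case_sum C (case_sum C' E)) (Sum_Type.Plus Hs (Sum_Type.Plus Hs Ps)))"


section \<open>Boundary geodesics and boundary-preserving isomorphisms\<close>

definition limit_set :: "(real^2^2) set set \<Rightarrow> complex set" where
  "limit_set \<Gamma> = {\<xi> \<in> hyp_boundary. \<xi> islimpt ((\<lambda>g. psl_act g 0) ` \<Gamma>)}"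

definition geodesic_line :: "(real \<Rightarrow> complex) \<Rightarrow> complex \<Rightarrow> complex \<Rightarrow> bool" where
  "geodesic_line c \<xi> \<eta> \<longleftrightarrow> range c \<subseteq> hyp_plane \<and> (\<forall>s t. hdist (c s) (c t) = \<bar>s - t\<bar>) \<and>
     filterlim c (nhds \<xi>) at_bot \<and> filterlim c (nhds \<eta>) at_top"

definition hyp_convex :: "complex set \<Rightarrow> bool" where
  "hyp_convex K \<longleftrightarrow> K \<subseteq> hyp_plane \<and>
     (\<forall>x\<in>K. \<forall>y\<in>K. \<forall>z\<in>hyp_plane. hdist x z + hdist z y = hdist x y \<longrightarrow> z \<in> K)"

definition hull_of_limit_set :: "(real^2^2) set set \<Rightarrow> complex set" where
  "hull_of_limit_set \<Gamma> = \<Inter>{K. hyp_convex K \<and> closedin (top_of_set hyp_plane) K \<and>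
     (\<forall>c. \<forall>\<xi>\<in>limit_set \<Gamma>. \<forall>\<eta>\<in>limit_set \<Gamma>. geodesic_line c \<xi> \<eta> \<longrightarrow> range c \<subseteq> K)}"

text \<open>The geodesic boundary of the quotient by \<open>\<Gamma>\<close> is the boundary of its convex core, the image
  of the frontier of the convex hull of the limit set. So \<open>\<gamma>\<close> corresponds to a geodesic boundary
  if it is hyperbolic and its axis lies in that frontier.\<close>

definition geodesic_boundary_elem :: "(real^2^2) set set \<Rightarrow> (real^2^2) set \<Rightarrow> bool" where
  "geodesic_boundary_elem \<Gamma> \<gamma> \<longleftrightarrow> \<gamma> \<in> \<Gamma> \<and> hyperbolic \<gamma> \<and>
     (\<exists>c. geodesic_line c (repelling_point \<gamma>) (attracting_point \<gamma>) \<and>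
          range c \<subseteq> top_of_set hyp_plane frontier_of hull_of_limit_set \<Gamma>)"

definition boundary_preserving_iso ::
    "(real^2^2) set set \<Rightarrow> (real^2^2) set set \<Rightarrow> ((real^2^2) set \<Rightarrow> (real^2^2) set) \<Rightarrow> bool" where
  "boundary_preserving_iso \<Gamma>1 \<Gamma>2 \<iota> \<longleftrightarrow>
     \<iota> \<in> iso (PSL2R\<lparr>carrier := \<Gamma>1\<rparr>) (PSL2R\<lparr>carrier := \<Gamma>2\<rparr>) \<and>
     (\<forall>\<gamma>\<in>\<Gamma>1. (hyperbolic \<gamma> \<longrightarrow> hyperbolic (\<iota> \<gamma>)) \<and> (parabolic \<gamma> \<longrightarrow> parabolic (\<iota> \<gamma>)) \<and>
        (geodesic_boundary_elem \<Gamma>1 \<gamma> \<longleftrightarrow> geodesic_boundary_elem \<Gamma>2 (\<iota> \<gamma>)))"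


section \<open>The Markov shift, pressure and the geometric potentials\<close>

text \<open>The symbol \<open>a\<^sup>n\<close> is represented by the pair \<open>(a, n)\<close>, and sequences are indexed from \<open>0\<close>.\<close>

definition alphabet :: "'g set \<Rightarrow> ('g \<times> int) set" where
  "alphabet A = A \<times> (UNIV - {0})"

definition markov_space :: "'g set \<Rightarrow> (nat \<Rightarrow> 'g \<times> int) set" where
  "markov_space A = {w. (\<forall>i. w i \<in> alphabet A) \<and> (\<forall>i. fst (w i) \<noteq> fst (w (Suc i)))}"

definition shift :: "(nat \<Rightarrow> 's) \<Rightarrow> nat \<Rightarrow> 's" where
  "shift w = (\<lambda>i. w (Suc i))"

definition birkhoff_sum :: "((nat \<Rightarrow> 's) \<Rightarrow> real) \<Rightarrow> nat \<Rightarrow> (nat \<Rightarrow> 's) \<Rightarrow> real" where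
  "birkhoff_sum f n w = (\<Sum>i<n. f ((shift ^^ i) w))"

definition periodic_sum ::
    "'g set \<Rightarrow> ((nat \<Rightarrow> 'g \<times> int) \<Rightarrow> real) \<Rightarrow> 'g \<times> int \<Rightarrow> nat \<Rightarrow> ennreal" where
  "periodic_sum A f s n =
     (\<Sum>\<^sub>\<infinity>w\<in>{w \<in> markov_space A. (shift ^^ n) w = w \<and> w 0 = s}. ennreal (exp (birkhoff_sum f n w)))"

definition ennreal_ln :: "ennreal \<Rightarrow> ereal" where
  "ennreal_ln x = (if x = 0 then - \<infinity> else if x = \<infinity> then \<infinity> else ereal (ln (enn2real x)))"

text \<open>\<open>P\<close> is the Gurevich pressure of \<open>f\<close>; it may be infinite, and does not depend on the
  initial symbol.\<close>

definition has_gurevich_pressure ::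
    "'g set \<Rightarrow> ((nat \<Rightarrow> 'g \<times> int) \<Rightarrow> real) \<Rightarrow> ereal \<Rightarrow> bool" where
  "has_gurevich_pressure A f P \<longleftrightarrow>
     (\<forall>s\<in>alphabet A. (\<lambda>n. ennreal_ln (periodic_sum A f s n) / ereal (real n)) \<longlonglongrightarrow> P)"

primrec prefix_prod :: "('g, 'm) monoid_scheme \<Rightarrow> (nat \<Rightarrow> 'g \<times> int) \<Rightarrow> nat \<Rightarrow> 'g" where
  "prefix_prod G w 0 = \<one>\<^bsub>G\<^esub>"
| "prefix_prod G w (Suc k) = prefix_prod G w k \<otimes>\<^bsub>G\<^esub> (fst (w k) [^]\<^bsub>G\<^esub> snd (w k))"

text \<open>The limit point coded by a sequence.\<close>

definition coded_point ::
    "('g, 'm) monoid_scheme \<Rightarrow> ('g \<Rightarrow> (real^2^2) set) \<Rightarrow> (nat \<Rightarrow> 'g \<times> int) \<Rightarrow> complex" where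
  "coded_point G \<rho> w = lim (\<lambda>k. psl_act (\<rho> (prefix_prod G w k)) 0)"

definition geometric_potential ::
    "('g, 'm) monoid_scheme \<Rightarrow> ('g \<Rightarrow> (real^2^2) set) \<Rightarrow> (nat \<Rightarrow> 'g \<times> int) \<Rightarrow> real" where
  "geometric_potential G \<rho> w =
     busemann (coded_point G \<rho> w) 0 (psl_act (\<rho> (fst (w 0) [^]\<^bsub>G\<^esub> snd (w 0))) 0)"


section \<open>The weighted Manhattan metric\<close>

definition weighted_dist ::
    "real \<Rightarrow> real \<Rightarrow> complex \<times> complex \<Rightarrow> complex \<times> complex \<Rightarrow> real" where
  "weighted_dist a b x y = a * hdist (fst x) (fst y) + b * hdist (snd x) (snd y)"

definition diag_act ::
    "('g \<Rightarrow> (real^2^2) set) \<Rightarrow> ('g \<Rightarrow> (real^2^2) set) \<Rightarrow> 'g \<Rightarrow> complex \<times> complex \<Rightarrow> complex \<times> complex"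
  where
  "diag_act \<rho>1 \<rho>2 \<gamma> y = (psl_act (\<rho>1 \<gamma>) (fst y), psl_act (\<rho>2 \<gamma>) (snd y))"

text \<open>The exponent of convergence of the Poincare series; see \<open>critical_exponent_converges\<close> and
  \<open>critical_exponent_diverges\<close> below.\<close>

definition critical_exponent ::
    "('g, 'm) monoid_scheme \<Rightarrow> ('g \<Rightarrow> (real^2^2) set) \<Rightarrow> ('g \<Rightarrow> (real^2^2) set) \<Rightarrow>
     real \<Rightarrow> real \<Rightarrow> complex \<times> complex \<Rightarrow> ereal" where
  "critical_exponent G \<rho>1 \<rho>2 a b q =
     (INF s\<in>{s::real. (\<lambda>\<gamma>. exp (- s * weighted_dist a b q (diag_act \<rho>1 \<rho>2 \<gamma> q))) summable_on carrier G}.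
        ereal s)"

definition orbit_count ::
    "('g, 'm) monoid_scheme \<Rightarrow> ('g \<Rightarrow> (real^2^2) set) \<Rightarrow> ('g \<Rightarrow> (real^2^2) set) \<Rightarrow>
     real \<Rightarrow> real \<Rightarrow> complex \<times> complex \<Rightarrow> complex \<times> complex \<Rightarrow> real \<Rightarrow> nat" where
  "orbit_count G \<rho>1 \<rho>2 a b x y s =
     card {\<gamma> \<in> carrier G. weighted_dist a b x (diag_act \<rho>1 \<rho>2 \<gamma> y) \<le> s}"


section \<open>Basic facts\<close>

lemma carrier_SL2R [simp]: "carrier SL2R = {A. det A = 1}"
  and mult_SL2R [simp]: "A \<otimes>\<^bsub>SL2R\<^esub> B = A ** B"
  and one_SL2R [simp]: "\<one>\<^bsub>SL2R\<^esub> = mat 1"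
  by (simp_all add: SL2R_def)

lemma group_SL2R: "group SL2R"
proof (rule groupI)
  fix A assume "A \<in> carrier SL2R"
  then have A: "det A = 1" by simp
  then have "invertible A" by (simp add: invertible_det_nz)
  then obtain B where B: "A ** B = mat 1" "B ** A = mat 1"
    by (auto simp: invertible_def)
  have "det B = 1" using A det_mul[of B A] B by simp
  then show "\<exists>B\<in>carrier SL2R. B \<otimes>\<^bsub>SL2R\<^esub> A = \<one>\<^bsub>SL2R\<^esub>" using B by auto
qed (auto simp: det_mul matrix_mul_assoc)

lemma uminus_matrix_mul: "(- A) ** B = - (A ** (B::real^2^2))"
  and matrix_mul_uminus: "A ** (- B) = - (A ** (B::real^2^2))"
  by (simp_all add: matrix_matrix_mult_def vec_eq_iff sum_negf)

lemma det_uminus_2: "det (- A :: real^2^2) = det A"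
  by (simp add: det_2)

lemma normal_pm_one: "{mat 1, - mat 1} \<lhd> SL2R"
proof -
  interpret group SL2R by (rule group_SL2R)
  have inv_minus: "inv\<^bsub>SL2R\<^esub> (- mat 1) = - mat 1"
    by (rule inv_equality) (auto simp: det_uminus_2 uminus_matrix_mul)
  have inv_one': "inv\<^bsub>SL2R\<^esub> (mat 1) = mat 1" using inv_one by simp
  show ?thesis
  proof (rule normal_invI)
    show "subgroup {mat 1, - mat 1} SL2R"
      by (rule subgroupI) (auto simp: inv_minus inv_one' uminus_matrix_mul matrix_mul_uminus det_uminus_2)
  next
    fix A H :: "real^2^2" assume A: "A \<in> carrier SL2R" and H: "H \<in> {mat 1, - mat 1}"
    have "A ** inv\<^bsub>SL2R\<^esub> A = mat 1" using r_inv[OF A] by simp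
    then show "A \<otimes>\<^bsub>SL2R\<^esub> H \<otimes>\<^bsub>SL2R\<^esub> inv\<^bsub>SL2R\<^esub> A \<in> {mat 1, - mat 1}"
      using H by (auto simp: uminus_matrix_mul matrix_mul_uminus)
  qed
qed

lemma group_PSL2R: "group PSL2R"
  unfolding PSL2R_def by (rule normal.factorgroup_is_group[OF normal_pm_one])

lemma carrier_PSL2R: "carrier PSL2R = {{A, - A} | A. det A = 1}"
  unfolding PSL2R_def carrier_FactGroup r_coset_def
  by (auto simp: image_iff uminus_matrix_mul)

lemma minus_div_minus: "(- (x::complex)) / (- y) = x / y"
  by simp

lemma disk_act_uminus: "disk_act (- A) z = disk_act A z"
proof -
  define \<alpha> where "\<alpha> = Complex ((A$1$1 + A$2$2) / 2) ((A$1$2 - A$2$1) / 2)"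
  define \<beta> where "\<beta> = Complex ((A$1$1 - A$2$2) / 2) (- (A$1$2 + A$2$1) / 2)"
  have neg: "Complex (((- A)$1$1 + (- A)$2$2) / 2) (((- A)$1$2 - (- A)$2$1) / 2) = - \<alpha>"
    "Complex (((- A)$1$1 - (- A)$2$2) / 2) (- ((- A)$1$2 + (- A)$2$1) / 2) = - \<beta>"
    by (simp_all add: \<alpha>_def \<beta>_def complex_eq_iff field_simps)
  have "((- \<alpha>) * z + - \<beta>) / (cnj (- \<beta>) * z + cnj (- \<alpha>))
      = (- (\<alpha> * z + \<beta>)) / (- (cnj \<beta> * z + cnj \<alpha>))"
    by simp
  also have "\<dots> = (\<alpha> * z + \<beta>) / (cnj \<beta> * z + cnj \<alpha>)"
    by (rule minus_div_minus)
  finally show ?thesis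
    unfolding disk_act_def Let_def moebius_def neg \<alpha>_def[symmetric] \<beta>_def[symmetric] .
qed

lemma psl_act_coset: "psl_act {A, - A} z = disk_act A z"
  by (simp add: psl_act_def disk_act_uminus)

lemma istopology_PSL2R:
  "istopology (\<lambda>U. U \<subseteq> carrier PSL2R \<and> openin (top_of_set (carrier SL2R)) (\<Union>U))"
proof -
  have disj: "X = Y" if "X \<in> carrier PSL2R" "Y \<in> carrier PSL2R" "A \<in> X" "A \<in> Y" for X Y A
    using that by (auto simp: carrier_PSL2R)
  have "\<Union>(U \<inter> V) = \<Union>U \<inter> \<Union>V" if "U \<subseteq> carrier PSL2R" "V \<subseteq> carrier PSL2R" for U V
    using that disj by blast
  moreover have "openin (top_of_set (carrier SL2R)) (\<Union>(\<Union>K))"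
    if "\<forall>U\<in>K. openin (top_of_set (carrier SL2R)) (\<Union>U)" for K :: "(real^2^2) set set set"
  proof -
    have "\<Union>(\<Union>K) = \<Union>(Union ` K)" by auto
    then show ?thesis using that openin_Union[of "Union ` K"] by auto
  qed
  ultimately show ?thesis
    unfolding istopology_def by (auto simp del: carrier_SL2R)
qed

lemma openin_PSL2R_topology:
  "openin PSL2R_topology U \<longleftrightarrow>
     U \<subseteq> carrier PSL2R \<and> openin (top_of_set (carrier SL2R)) (\<Union>U)"
  unfolding PSL2R_topology_def by (simp add: topology_inverse'[OF istopology_PSL2R] del: carrier_SL2R)

lemma disk_act_cayley:
  assumes "det A = 1" and z: "Im z > 0"
  shows "disk_act A (cayley z) =
           cayley (moebius (of_real (A$1$1)) (of_real (A$1$2)) (of_real (A$2$1)) (of_real (A$2$2)) z)"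
proof -
  define a b c d where "a = complex_of_real (A$1$1)" and "b = complex_of_real (A$1$2)"
    and "c = complex_of_real (A$2$1)" and "d = complex_of_real (A$2$2)"
  note abcd = a_def b_def c_def d_def
  have det: "A$1$1 * A$2$2 - A$1$2 * A$2$1 = 1" using assms by (simp add: det_2)
  have zi: "z + \<i> \<noteq> 0" using z by (auto simp: complex_eq_iff)
  have nz: "c * z + d \<noteq> 0"
  proof
    assume eq: "c * z + d = 0"
    then have "A$2$1 * Im z = 0" by (auto simp: abcd complex_eq_iff)
    then have "A$2$1 = 0" using z by simp
    moreover from this eq have "A$2$2 = 0" by (auto simp: abcd complex_eq_iff)
    ultimately show False using det by simp
  qed
  have al: "Complex ((A$1$1 + A$2$2) / 2) ((A$1$2 - A$2$1) / 2) = (a + d + \<i> * (b - c)) / 2"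
    and be: "Complex ((A$1$1 - A$2$2) / 2) (- (A$1$2 + A$2$1) / 2) = (a - d - \<i> * (b + c)) / 2"
    and al': "cnj (Complex ((A$1$1 + A$2$2) / 2) ((A$1$2 - A$2$1) / 2)) = (a + d - \<i> * (b - c)) / 2"
    and be': "cnj (Complex ((A$1$1 - A$2$2) / 2) (- (A$1$2 + A$2$1) / 2)) = (a - d + \<i> * (b + c)) / 2"
    by (simp_all add: abcd complex_eq_iff field_simps)
  have combine: "x / 2 * ((z - \<i>) / (z + \<i>)) + y / 2 = (x * (z - \<i>) + y * (z + \<i>)) / (2 * (z + \<i>))" for x y
  proof -
    have "x / 2 * (u / w) + y / 2 = (x * u + y * w) / (2 * w)" if "w \<noteq> 0" for u w
      using that by (simp add: divide_simps)
    then show ?thesis using zi .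
  qed
  have num: "(a + d + \<i> * (b - c)) * (z - \<i>) + (a - d - \<i> * (b + c)) * (z + \<i>)
      = 2 * ((a * z + b) - \<i> * (c * z + d))"
    and den: "(a - d + \<i> * (b + c)) * (z - \<i>) + (a + d - \<i> * (b - c)) * (z + \<i>)
      = 2 * ((a * z + b) + \<i> * (c * z + d))"
    by (simp_all add: algebra_simps)
  have cancel: "(2 * u / (2 * (z + \<i>))) / (2 * v / (2 * (z + \<i>))) = u / v" for u v
    using zi by (simp only: mult_divide_mult_cancel_left[OF zero_neq_numeral[symmetric]]) simp
  have "disk_act A (cayley z) = ((a * z + b) - \<i> * (c * z + d)) / ((a * z + b) + \<i> * (c * z + d))"
    unfolding disk_act_def Let_def moebius_def cayley_def al' be'
    unfolding al be combine num den by (rule cancel)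
  also have "\<dots> = cayley (moebius a b c d z)"
  proof -
    have "u / v - \<i> = (u - \<i> * v) / v" "u / v + \<i> = (u + \<i> * v) / v" if "v \<noteq> 0" for u v
      using that by (simp_all add: divide_simps)
    then show ?thesis using nz by (simp add: cayley_def moebius_def)
  qed
  finally show ?thesis by (simp add: abcd)
qed

lemma hdist_nonneg:
  assumes "z \<in> hyp_plane" "w \<in> hyp_plane"
  shows "hdist z w \<ge> 0"
proof -
  have "(cmod z)\<^sup>2 < 1" "(cmod w)\<^sup>2 < 1"
    using assms by (auto simp: power_less_one_iff)
  then show ?thesis
    unfolding hdist_def by (intro arcosh_nonneg_real) auto
qed

lemma disk_act_in_hyp_plane:
  assumes A: "det A = 1" and z: "z \<in> hyp_plane"
  shows "disk_act A z \<in> hyp_plane"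
proof -
  define \<alpha> where "\<alpha> = Complex ((A$1$1 + A$2$2) / 2) ((A$1$2 - A$2$1) / 2)"
  define \<beta> where "\<beta> = Complex ((A$1$1 - A$2$2) / 2) (- (A$1$2 + A$2$1) / 2)"
  have act: "disk_act A z = (\<alpha> * z + \<beta>) / (cnj \<beta> * z + cnj \<alpha>)"
    by (simp add: disk_act_def moebius_def Let_def \<alpha>_def \<beta>_def)
  have det: "(cmod \<alpha>)\<^sup>2 - (cmod \<beta>)\<^sup>2 = 1"
    using A unfolding \<alpha>_def \<beta>_def cmod_power2 det_2 by (simp add: power2_eq_square field_simps)
  have id: "(cmod (cnj \<beta> * z + cnj \<alpha>))\<^sup>2 - (cmod (\<alpha> * z + \<beta>))\<^sup>2
          = ((cmod \<alpha>)\<^sup>2 - (cmod \<beta>)\<^sup>2) * (1 - (cmod z)\<^sup>2)"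
    unfolding cmod_power2 by (simp add: power2_eq_square algebra_simps)
  have "(cmod z)\<^sup>2 < 1" using z by (auto simp: power_less_one_iff)
  then have lt: "(cmod (\<alpha> * z + \<beta>))\<^sup>2 < (cmod (cnj \<beta> * z + cnj \<alpha>))\<^sup>2"
    using id det by simp
  then have "cmod (\<alpha> * z + \<beta>) < cmod (cnj \<beta> * z + cnj \<alpha>)"
    using power2_less_imp_less norm_ge_zero by blast
  then show ?thesis
    unfolding act by (simp add: norm_divide divide_less_eq_1)
qed

lemma psl_act_in_hyp_plane:
  assumes "g \<in> carrier PSL2R" and "z \<in> hyp_plane"
  shows "psl_act g z \<in> hyp_plane"
  using assms disk_act_in_hyp_plane by (auto simp: carrier_PSL2R psl_act_coset simp del: mem_ball)

lemma weighted_dist_orbit_nonneg: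
  assumes "fuchsian G \<rho>1" "fuchsian G \<rho>2" "a \<ge> 0" "b \<ge> 0" "\<gamma> \<in> carrier G"
    and "q \<in> hyp_plane \<times> hyp_plane"
  shows "weighted_dist a b q (diag_act \<rho>1 \<rho>2 \<gamma> q) \<ge> 0"
proof -
  have "\<rho>1 \<gamma> \<in> carrier PSL2R" "\<rho>2 \<gamma> \<in> carrier PSL2R"
    using assms by (auto simp: fuchsian_def mon_def hom_def)
  then show ?thesis
    using assms by (auto simp: weighted_dist_def diag_act_def simp del: mem_ball
        intro!: add_nonneg_nonneg mult_nonneg_nonneg hdist_nonneg psl_act_in_hyp_plane)
qed

lemma critical_exponent_diverges:
  assumes "ereal s < critical_exponent G \<rho>1 \<rho>2 a b q"
  shows "\<not> (\<lambda>\<gamma>. exp (- s * weighted_dist a b q (diag_act \<rho>1 \<rho>2 \<gamma> q))) summable_on carrier G"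
proof
  assume "(\<lambda>\<gamma>. exp (- s * weighted_dist a b q (diag_act \<rho>1 \<rho>2 \<gamma> q))) summable_on carrier G"
  then have "critical_exponent G \<rho>1 \<rho>2 a b q \<le> ereal s"
    unfolding critical_exponent_def by (intro INF_lower) simp
  with assms show False by simp
qed

lemma critical_exponent_converges:
  assumes fuchs: "fuchsian G \<rho>1" "fuchsian G \<rho>2" and ab: "a \<ge> 0" "b \<ge> 0"
    and q: "q \<in> hyp_plane \<times> hyp_plane"
    and s: "critical_exponent G \<rho>1 \<rho>2 a b q < ereal s"
  shows "(\<lambda>\<gamma>. exp (- s * weighted_dist a b q (diag_act \<rho>1 \<rho>2 \<gamma> q))) summable_on carrier G"
proof -
  let ?d = "\<lambda>\<gamma>. weighted_dist a b q (diag_act \<rho>1 \<rho>2 \<gamma> q)"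
  obtain r where r: "(\<lambda>\<gamma>. exp (- r * ?d \<gamma>)) summable_on carrier G" and "r < s"
    using s unfolding critical_exponent_def INF_less_iff by auto
  show ?thesis
  proof (rule summable_on_comparison_test[OF r])
    fix \<gamma> assume "\<gamma> \<in> carrier G"
    then have "?d \<gamma> \<ge> 0" using weighted_dist_orbit_nonneg[OF fuchs ab _ q] by simp
    then show "exp (- s * ?d \<gamma>) \<le> exp (- r * ?d \<gamma>)"
      using \<open>r < s\<close> by (simp add: mult_right_mono)
  qed simp
qed

text \<open>The unit and inverse laws are obtained by pushing forward homotopies of paths in the
  interval.\<close>

lemma loop_laws:
  assumes g: "path g" "path_image g \<subseteq> S" "pathstart g = p" "pathfinish g = p"
  shows loop_left_unit: "homotopic_paths S ((\<lambda>_. p) +++ g) g"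
    and loop_left_inverse: "homotopic_paths S (reversepath g +++ g) (\<lambda>_. p)"
proof -
  let ?I = "{0..1::real}" and ?l = "linepath 0 (1::real)"
  have l: "path ?l" "path_image ?l \<subseteq> ?I" by (auto simp: closed_segment_eq_real_ivl)
  have cont: "continuous_on ?I g" and im: "g \<in> ?I \<rightarrow> S"
    using g by (auto simp: path_def path_image_def)
  note push = homotopic_paths_continuous_image[OF _ cont im]
  have gl: "g \<circ> ?l = g" by (auto simp: linepath_def)
  have gc: "g \<circ> linepath 0 0 = (\<lambda>_. p)" "g \<circ> linepath 1 1 = (\<lambda>_. p)"
    using g by (auto simp: pathstart_def pathfinish_def linepath_def fun_eq_iff)
  have "homotopic_paths S (g \<circ> (linepath 0 0 +++ ?l)) (g \<circ> ?l)"
    by (rule push) (use homotopic_paths_lid[OF l] in simp)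
  then show "homotopic_paths S ((\<lambda>_. p) +++ g) g"
    by (simp add: path_compose_join gc gl)
  have "homotopic_paths S (g \<circ> (reversepath ?l +++ ?l)) (g \<circ> linepath 1 1)"
    by (rule push) (use homotopic_paths_linv[OF l] in simp)
  then show "homotopic_paths S (reversepath g +++ g) (\<lambda>_. p)"
    by (simp only: path_compose_join path_compose_reversepath gc gl)
qed

lemma group_fundamental_group:
  assumes p: "p \<in> S"
  shows "group (fundamental_group S p)"
proof -
  let ?L = "{g. path g \<and> path_image g \<subseteq> S \<and> pathstart g = p \<and> pathfinish g = p}"
  let ?c = "\<lambda>g. Collect (homotopic_paths S g)"
  let ?G = "fundamental_group S p"
  have car: "carrier ?G = ?c ` ?L" and one: "\<one>\<^bsub>?G\<^esub> = ?c (\<lambda>_. p)"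
    by (auto simp: fundamental_group_def)
  have eqI: "?c f = ?c g" if "homotopic_paths S f g" for f g
    using homotopic_paths_trans[OF that] homotopic_paths_trans[OF homotopic_paths_sym[OF that]]
    by auto
  have mult: "?c f \<otimes>\<^bsub>?G\<^esub> ?c g = ?c (f +++ g)" if f: "f \<in> ?L" and g: "g \<in> ?L" for f g
  proof -
    have eq: "?c f \<otimes>\<^bsub>?G\<^esub> ?c g = {h. \<exists>f'\<in>?c f. \<exists>g'\<in>?c g. homotopic_paths S (f' +++ g') h}"
      by (simp add: fundamental_group_def)
    have "homotopic_paths S (f +++ g) h"
      if "homotopic_paths S f f'" "homotopic_paths S g g'" "homotopic_paths S (f' +++ g') h" for f' g' h
    proof -
      have "pathfinish f = pathstart g" using f g by simp
      from homotopic_paths_join[OF that(1,2) this] that(3) show ?thesis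
        by (rule homotopic_paths_trans)
    qed
    moreover have "f \<in> ?c f" "g \<in> ?c g" using f g by auto
    ultimately show ?thesis unfolding eq by blast
  qed
  have join: "f +++ g \<in> ?L" if "f \<in> ?L" "g \<in> ?L" for f g
    using that by (auto simp: path_image_join)
  have const: "(\<lambda>_. p) \<in> ?L"
    using p by (auto simp: path_def path_image_def pathstart_def pathfinish_def)
  show ?thesis
  proof (rule groupI)
    fix X Y assume "X \<in> carrier ?G" "Y \<in> carrier ?G"
    then show "X \<otimes>\<^bsub>?G\<^esub> Y \<in> carrier ?G" unfolding car using mult join by blast
  next
    show "\<one>\<^bsub>?G\<^esub> \<in> carrier ?G" unfolding car one using const by blast
  next
    fix X Y Z assume "X \<in> carrier ?G" "Y \<in> carrier ?G" "Z \<in> carrier ?G"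
    then obtain f g h where fgh: "f \<in> ?L" "g \<in> ?L" "h \<in> ?L" and "X = ?c f" "Y = ?c g" "Z = ?c h"
      unfolding car by blast
    moreover have "homotopic_paths S (f +++ (g +++ h)) ((f +++ g) +++ h)"
      using fgh by (intro homotopic_paths_assoc) auto
    ultimately show "X \<otimes>\<^bsub>?G\<^esub> Y \<otimes>\<^bsub>?G\<^esub> Z = X \<otimes>\<^bsub>?G\<^esub> (Y \<otimes>\<^bsub>?G\<^esub> Z)"
      using eqI[of "f +++ (g +++ h)" "(f +++ g) +++ h"]
      by (simp only: mult join fgh)
  next
    fix X assume "X \<in> carrier ?G"
    then obtain g where g: "g \<in> ?L" and X: "X = ?c g" unfolding car by blast
    have "homotopic_paths S ((\<lambda>_. p) +++ g) g" using g by (intro loop_left_unit) auto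
    then show "\<one>\<^bsub>?G\<^esub> \<otimes>\<^bsub>?G\<^esub> X = X" unfolding X one mult[OF const g] by (rule eqI)
    have rev: "reversepath g \<in> ?L" using g by auto
    have "homotopic_paths S (reversepath g +++ g) (\<lambda>_. p)" using g by (intro loop_left_inverse) auto
    then have "?c (reversepath g) \<otimes>\<^bsub>?G\<^esub> X = \<one>\<^bsub>?G\<^esub>" unfolding X one mult[OF rev g] by (rule eqI)
    then show "\<exists>Y\<in>carrier ?G. Y \<otimes>\<^bsub>?G\<^esub> X = \<one>\<^bsub>?G\<^esub>" unfolding car using rev by blast
  qed
qed

end

theory Submission
  imports Defs
begin

text \<open>By the ping-pong condition the group is the free product of the cyclic groups generated by
  the letters, and along reduced words \<open>d(o, \<gamma> o)\<close> is additive up to a bounded error and grows at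
  least linearly in the word length. Busemann functions at coded points are limits of differences
  of such displacements, so the Birkhoff sums of \<open>a \<tau> + b \<kappa>\<close> differ from \<open>d\<^sup>a\<^sup>,\<^sup>b(o, \<gamma> o)\<close> by a
  bounded amount, where \<open>\<gamma>\<close> is the word of the first \<open>n\<close> symbols. Vanishing pressure thus says that
  the sums of \<open>exp (- t d\<^sup>a\<^sup>,\<^sup>b(o, \<gamma> o))\<close> over words of length \<open>n\<close> have subexponential growth and decay;
  with the linear growth of \<open>d\<^sup>a\<^sup>,\<^sup>b\<close> this gives convergence of the Poincare series for \<open>s > t\<close> and
  divergence for \<open>s < t\<close>. For \<open>0 \<le> s < t\<close> there even is a finite set \<open>F\<close> of words of equal length,
  freely generating a semigroup, with \<open>exp (- s d\<^sup>a\<^sup>,\<^sup>b(o, \<gamma> o))\<close> summing to at least a prescribed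
  constant over \<open>F\<close>; counting in this semigroup shows that the limit inferior of the growth rate
  is at least \<open>s\<close>.\<close>

section \<open>Moebius maps of the disk\<close>

text \<open>Distances are handled through \<open>ln (psl_size g)\<close>: for fixed \<open>x\<close>
  and \<open>y\<close> it is within a bounded amount of \<open>hdist x (psl_act g y)\<close>, and it
  obeys the exact product rule \<open>psl_size_mult\<close>, whose only defect from multiplicativity
  is the squared modulus of 1 - cnj w * v, with w = g^-1 0 and v = h 0. Additivity along words
  amounts to keeping this factor away from 0. The ping-pong conditions concern the circle, whereas w
  and v lie inside the disk; points of the circle outside all ping-pong sets, whose images are
  known, bridge the gap.

  Unbounded exponents make the alphabet infinite, so each positive length carries infinitely many
  words. That long words are large therefore rests on the finiteness of the set of elements of
  bounded size. Pressure, moreover, sees only words that begin with one symbol and close up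
  cyclically, and only for large length; \<open>pad\<close> embeds arbitrary words into these.

  The two representations meet in one function \<open>D\<close> on words, a weighted sum of two
  logarithmic sizes. The locale \<open>zero_pressure\<close> knows \<open>D\<close> only through
  quasi-additivity, linear growth and the pressure bounds.\<close>

lemma psl_act_coeffs:
  assumes "g \<in> carrier PSL2R"
  obtains \<alpha> \<beta> where "(cmod \<alpha>)\<^sup>2 = 1 + (cmod \<beta>)\<^sup>2"
    and "\<And>z. psl_act g z = (\<alpha> * z + \<beta>) / (cnj \<beta> * z + cnj \<alpha>)"
proof -
  obtain A where A: "g = {A, - A}" "det A = 1" using assms by (auto simp: carrier_PSL2R)
  define \<alpha> where "\<alpha> = Complex ((A$1$1 + A$2$2) / 2) ((A$1$2 - A$2$1) / 2)"
  define \<beta> where "\<beta> = Complex ((A$1$1 - A$2$2) / 2) (- (A$1$2 + A$2$1) / 2)"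
  have "(cmod \<alpha>)\<^sup>2 = 1 + (cmod \<beta>)\<^sup>2"
    using A(2) unfolding \<alpha>_def \<beta>_def cmod_power2 det_2 by (simp add: power2_eq_square field_simps)
  moreover have "psl_act g z = (\<alpha> * z + \<beta>) / (cnj \<beta> * z + cnj \<alpha>)" for z
    by (simp add: A psl_act_coset disk_act_def moebius_def Let_def \<alpha>_def \<beta>_def)
  ultimately show thesis by (rule that)
qed

text \<open>A pole would have modulus |\<alpha>| / |\<beta>| > 1, hence lie outside the closed
  disk.\<close>

lemma moebius_denom_nonzero:
  assumes "(cmod \<alpha>)\<^sup>2 = 1 + (cmod \<beta>)\<^sup>2" and z: "z \<in> cball 0 1"
  shows "cnj \<beta> * z + cnj \<alpha> \<noteq> 0"
proof
  assume "cnj \<beta> * z + cnj \<alpha> = 0"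
  then have "cnj \<alpha> = - (cnj \<beta> * z)" by (simp add: add_eq_0_iff)
  then have "cmod \<alpha> = cmod \<beta> * cmod z"
    by (metis complex_mod_cnj norm_minus_cancel norm_mult)
  also have "\<dots> \<le> cmod \<beta>" using z by (simp add: mult_left_le)
  finally have "(cmod \<alpha>)\<^sup>2 \<le> (cmod \<beta>)\<^sup>2" by (simp add: power_mono)
  with assms show False by simp
qed

text \<open>Division by zero yields 0, so the composition law could fail at a pole of the inner map;
  the closed disk contains none.\<close>

lemma disk_act_mult:
  assumes A: "det A = 1" and B: "det B = 1" and z: "z \<in> cball 0 1"
  shows "disk_act (A ** B) z = disk_act A (disk_act B z)"
proof -
  define a where "a = (\<lambda>A::real^2^2. Complex ((A$1$1 + A$2$2) / 2) ((A$1$2 - A$2$1) / 2))"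
  define b where "b = (\<lambda>A::real^2^2. Complex ((A$1$1 - A$2$2) / 2) (- (A$1$2 + A$2$1) / 2))"
  have act: "disk_act M w = (a M * w + b M) / (cnj (b M) * w + cnj (a M))" for M w
    by (simp add: disk_act_def moebius_def Let_def a_def b_def)
  have ab: "a (A ** B) = a A * a B + b A * cnj (b B)" "b (A ** B) = a A * b B + b A * cnj (a B)"
    unfolding a_def b_def
    by (simp_all add: complex_eq_iff matrix_matrix_mult_def UNIV_2 field_simps)
  have "(cmod (a B))\<^sup>2 = 1 + (cmod (b B))\<^sup>2"
    using B unfolding a_def b_def cmod_power2 det_2 by (simp add: power2_eq_square field_simps)
  then have nz: "cnj (b B) * z + cnj (a B) \<noteq> 0" by (rule moebius_denom_nonzero) (rule z)
  have "(p * (u / v) + q) / (r * (u / v) + s) = (p * u + q * v) / (r * u + s * v)"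
    if "v \<noteq> 0" for p q r s u v :: complex
  proof -
    have "p * (u / v) + q = (p * u + q * v) / v" "r * (u / v) + s = (r * u + s * v) / v"
      using that by (simp_all add: field_simps)
    then show ?thesis using that by simp
  qed
  note this[OF nz, of "a A" "a B * z + b B" "b A" "cnj (b A)" "cnj (a A)"]
  moreover have "a (A ** B) * z + b (A ** B) = a A * (a B * z + b B) + b A * (cnj (b B) * z + cnj (a B))"
    "cnj (b (A ** B)) * z + cnj (a (A ** B))
      = cnj (b A) * (a B * z + b B) + cnj (a A) * (cnj (b B) * z + cnj (a B))"
    unfolding ab by (simp_all add: algebra_simps)
  ultimately show ?thesis unfolding act by simp
qed

lemma psl_act_mult:
  assumes "g \<in> carrier PSL2R" "h \<in> carrier PSL2R" and z: "z \<in> cball 0 1"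
  shows "psl_act (g \<otimes>\<^bsub>PSL2R\<^esub> h) z = psl_act g (psl_act h z)"
proof -
  obtain A B where A: "g = {A, - A}" "det A = 1" and B: "h = {B, - B}" "det B = 1"
    using assms by (auto simp: carrier_PSL2R)
  have "g \<otimes>\<^bsub>PSL2R\<^esub> h = {A ** B, - (A ** B)}"
    by (auto simp: PSL2R_def FactGroup_def set_mult_def A B uminus_matrix_mul matrix_mul_uminus)
  then show ?thesis using disk_act_mult[OF A(2) B(2) z] by (simp add: A B psl_act_coset)
qed

lemma psl_act_one: "psl_act \<one>\<^bsub>PSL2R\<^esub> z = z"
proof -
  have "\<one>\<^bsub>PSL2R\<^esub> = {mat 1, - mat 1}" by (simp add: PSL2R_def FactGroup_def)
  then show ?thesis
    by (simp add: psl_act_coset disk_act_def moebius_def Let_def mat_def Complex_eq)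
qed

lemma psl_inv_closed: "g \<in> carrier PSL2R \<Longrightarrow> inv\<^bsub>PSL2R\<^esub> g \<in> carrier PSL2R"
  by (rule group.inv_closed[OF group_PSL2R])

lemma psl_act_inv:
  assumes g: "g \<in> carrier PSL2R" and z: "z \<in> cball 0 1"
  shows "psl_act g (psl_act (inv\<^bsub>PSL2R\<^esub> g) z) = z"
    and "psl_act (inv\<^bsub>PSL2R\<^esub> g) (psl_act g z) = z"
proof -
  interpret group PSL2R by (rule group_PSL2R)
  show "psl_act g (psl_act (inv\<^bsub>PSL2R\<^esub> g) z) = z" "psl_act (inv\<^bsub>PSL2R\<^esub> g) (psl_act g z) = z"
    using psl_act_mult[OF g _ z, of "inv\<^bsub>PSL2R\<^esub> g"] psl_act_mult[OF _ g z, of "inv\<^bsub>PSL2R\<^esub> g"] g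
    by (simp_all add: psl_act_one)
qed

section \<open>Isometries as rotated Blaschke factors\<close>

lemma one_minus_cnj_mult_nonzero:
  assumes "w \<in> ball 0 1" "z \<in> cball 0 1"
  shows "1 - cnj w * z \<noteq> 0"
proof
  assume "1 - cnj w * z = 0"
  then have "1 = cmod w * cmod z" by (metis complex_mod_cnj eq_iff_diff_eq_0 norm_mult norm_one)
  also have "\<dots> \<le> cmod w" using assms by (simp add: mult_left_le)
  finally show False using assms by simp
qed

text \<open>Expressing the denominator through \<open>w\<close>, the preimage of the origin, instead
  of matrix entries ties the distortion of \<open>g\<close> to an orbit point of the origin, which
  ping-pong can locate.\<close>

lemma psl_act_form:
  assumes g: "g \<in> carrier PSL2R"
  defines "w \<equiv> psl_act (inv\<^bsub>PSL2R\<^esub> g) 0"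
  obtains e where "cmod e = 1" and "w \<in> ball 0 1"
    and "\<And>z. z \<in> cball 0 1 \<Longrightarrow> psl_act g z = e * (z - w) / (1 - cnj w * z)"
proof -
  obtain \<alpha> \<beta> where ab: "(cmod \<alpha>)\<^sup>2 = 1 + (cmod \<beta>)\<^sup>2"
    and act: "\<And>z. psl_act g z = (\<alpha> * z + \<beta>) / (cnj \<beta> * z + cnj \<alpha>)"
    using psl_act_coeffs[OF g] by blast
  have w: "w \<in> ball 0 1"
    unfolding w_def by (rule psl_act_in_hyp_plane) (use g in \<open>auto intro: psl_inv_closed\<close>)
  have "psl_act g w = 0" unfolding w_def by (rule psl_act_inv[OF g]) simp
  then have "\<alpha> * w + \<beta> = 0"
    using moebius_denom_nonzero[OF ab, of w] w by (simp add: act)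
  then have \<beta>: "\<beta> = - (\<alpha> * w)" by (simp add: add_eq_0_iff)
  have \<alpha>0: "\<alpha> \<noteq> 0" using ab by (auto simp: add_nonneg_eq_0_iff)
  have "psl_act g z = (\<alpha> / cnj \<alpha>) * (z - w) / (1 - cnj w * z)" for z
  proof -
    have "psl_act g z = (\<alpha> * (z - w)) / (cnj \<alpha> * (1 - cnj w * z))"
      unfolding act \<beta> by (simp add: algebra_simps)
    then show ?thesis by simp
  qed
  moreover have "cmod (\<alpha> / cnj \<alpha>) = 1" using \<alpha>0 by (simp add: norm_divide)
  ultimately show thesis using that w by blast
qed

text \<open>This is \<open>\<bar>\<alpha>\<bar>\<^sup>2\<close> for the matrix \<open>(\<alpha>, \<beta>; cnj \<beta>, cnj \<alpha>)\<close> of \<open>g\<close> in SU(1,1), and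
  \<open>cosh\<^sup>2 (d(0, g 0) / 2)\<close>.\<close>

definition psl_size :: "(real^2^2) set \<Rightarrow> real" where
  "psl_size g = 1 / (1 - (cmod (psl_act g 0))\<^sup>2)"

definition cosh_half_sq :: "complex \<Rightarrow> complex \<Rightarrow> real" where
  "cosh_half_sq x y = (cmod (1 - cnj x * y))\<^sup>2 / ((1 - (cmod x)\<^sup>2) * (1 - (cmod y)\<^sup>2))"

lemma
  assumes g: "g \<in> carrier PSL2R"
  shows psl_size_inv: "psl_size (inv\<^bsub>PSL2R\<^esub> g) = psl_size g"
    and psl_size_ge_1: "psl_size g \<ge> 1"
proof -
  obtain e where e: "cmod e = 1" and w: "psl_act (inv\<^bsub>PSL2R\<^esub> g) 0 \<in> ball 0 1"
    and act: "\<And>z. z \<in> cball 0 1 \<Longrightarrow> psl_act g z =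
      e * (z - psl_act (inv\<^bsub>PSL2R\<^esub> g) 0) / (1 - cnj (psl_act (inv\<^bsub>PSL2R\<^esub> g) 0) * z)"
    using psl_act_form[OF g] by metis
  have g0: "cmod (psl_act g 0) = cmod (psl_act (inv\<^bsub>PSL2R\<^esub> g) 0)"
    using act[of 0] e by (simp add: norm_mult)
  show "psl_size (inv\<^bsub>PSL2R\<^esub> g) = psl_size g" by (simp add: psl_size_def g0)
  show "psl_size g \<ge> 1" using w by (simp add: psl_size_def g0 power_less_one_iff)
qed

text \<open>Two polynomial identities for Blaschke factors, in each of which 1 - w * cnj w splits
  off and becomes \<open>psl_size g\<close>. The first, partly with \<open>z = v\<close>, yields
  invariance of the distance and the product rule for \<open>psl_size\<close>; the second measures
  how strongly \<open>g\<close> contracts points away from its pole.\<close>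

lemma
  assumes "g \<in> carrier PSL2R" "z \<in> cball 0 1"
  shows psl_act_cnj_mult: "\<And>v. v \<in> cball 0 1 \<Longrightarrow>
      1 - cnj (psl_act g z) * psl_act g v = (1 - cnj z * v) / (psl_size g *
        (1 - psl_act (inv\<^bsub>PSL2R\<^esub> g) 0 * cnj z) * (1 - cnj (psl_act (inv\<^bsub>PSL2R\<^esub> g) 0) * v))"
    and cmod_psl_act_diff: "\<And>v. v \<in> cball 0 1 \<Longrightarrow>
      cmod (psl_act g z - psl_act g v) = cmod (z - v) / (psl_size g *
        cmod (1 - cnj (psl_act (inv\<^bsub>PSL2R\<^esub> g) 0) * z) * cmod (1 - cnj (psl_act (inv\<^bsub>PSL2R\<^esub> g) 0) * v))"
proof -
  define w where "w = psl_act (inv\<^bsub>PSL2R\<^esub> g) 0"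
  obtain e where e: "cmod e = 1" and w: "w \<in> ball 0 1"
    and act: "\<And>z. z \<in> cball 0 1 \<Longrightarrow> psl_act g z = e * (z - w) / (1 - cnj w * z)"
    using psl_act_form[OF assms(1)] unfolding w_def by metis
  have ee: "e * cnj e = 1" using e by (simp add: complex_norm_square[symmetric])
  have g0: "cmod (psl_act g 0) = cmod w" using act[of 0] e by (simp add: norm_mult)
  have N: "psl_size g = 1 / (1 - (cmod w)\<^sup>2)" by (simp add: psl_size_def g0)
  have w1: "(cmod w)\<^sup>2 < 1" using w by (simp add: power_less_one_iff)
  have Nc: "complex_of_real (psl_size g) = 1 / (1 - w * cnj w)"
    by (simp only: N of_real_divide of_real_1 of_real_diff complex_norm_square)
  have ww: "1 - w * cnj w \<noteq> 0"
    using one_minus_cnj_mult_nonzero[of w w] w by (simp add: mult.commute)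
  note nz = one_minus_cnj_mult_nonzero[OF w assms(2)]
  have nz': "1 - w * cnj z \<noteq> 0"
    using nz by (metis complex_cnj_cnj complex_cnj_diff complex_cnj_mult complex_cnj_one complex_cnj_zero_iff)
  fix v :: complex assume v: "v \<in> cball 0 1"
  note nv = one_minus_cnj_mult_nonzero[OF w v]
  have "1 - cnj (psl_act g z) * psl_act g v
      = 1 - (e * cnj e) * (cnj z - cnj w) * (v - w) / ((1 - w * cnj z) * (1 - cnj w * v))"
  proof -
    have "psl_act g z = e * (z - w) / (1 - cnj w * z)" "psl_act g v = e * (v - w) / (1 - cnj w * v)"
      using act assms v by blast+
    then show ?thesis by (simp add: ac_simps)
  qed
  also have "\<dots> = ((1 - w * cnj z) * (1 - cnj w * v) - (cnj z - cnj w) * (v - w))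
      / ((1 - w * cnj z) * (1 - cnj w * v))"
    unfolding ee using nv nz' by (simp add: diff_divide_distrib)
  also have "(1 - w * cnj z) * (1 - cnj w * v) - (cnj z - cnj w) * (v - w)
      = (1 - w * cnj w) * (1 - cnj z * v)" by (simp add: algebra_simps)
  finally show "1 - cnj (psl_act g z) * psl_act g v = (1 - cnj z * v) / (psl_size g *
        (1 - psl_act (inv\<^bsub>PSL2R\<^esub> g) 0 * cnj z) * (1 - cnj (psl_act (inv\<^bsub>PSL2R\<^esub> g) 0) * v))"
    unfolding Nc w_def[symmetric] using ww by simp
  have "psl_act g z - psl_act g v = e * ((z - w) / (1 - cnj w * z) - (v - w) / (1 - cnj w * v))"
  proof -
    have "psl_act g z = e * ((z - w) / (1 - cnj w * z))" "psl_act g v = e * ((v - w) / (1 - cnj w * v))"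
      using act assms v by simp_all
    then show ?thesis by (simp only: right_diff_distrib)
  qed
  also have "\<dots> = e * (((z - w) * (1 - cnj w * v) - (v - w) * (1 - cnj w * z))
      / ((1 - cnj w * z) * (1 - cnj w * v)))"
    using nz nv by (simp add: diff_frac_eq)
  also have "(z - w) * (1 - cnj w * v) - (v - w) * (1 - cnj w * z) = (1 - w * cnj w) * (z - v)"
    by (simp add: algebra_simps)
  also have "e * ((1 - w * cnj w) * (z - v) / ((1 - cnj w * z) * (1 - cnj w * v)))
     = e * ((z - v) / (complex_of_real (psl_size g) * (1 - cnj w * z) * (1 - cnj w * v)))"
    unfolding Nc using ww by simp
  finally have "cmod (psl_act g z - psl_act g v) = cmod (z - v) /
      (\<bar>psl_size g\<bar> * cmod (1 - cnj w * z) * cmod (1 - cnj w * v))"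
    by (simp add: norm_mult norm_divide e)
  moreover have "psl_size g > 0" using w1 by (simp add: N)
  ultimately show "cmod (psl_act g z - psl_act g v) = cmod (z - v) / (psl_size g *
        cmod (1 - cnj (psl_act (inv\<^bsub>PSL2R\<^esub> g) 0) * z) * cmod (1 - cnj (psl_act (inv\<^bsub>PSL2R\<^esub> g) 0) * v))"
    unfolding w_def by simp
qed

lemma cnj_mult_self: "cnj z * z = of_real ((cmod z)\<^sup>2)"
  unfolding complex_norm_square by (rule mult.commute)

lemma one_minus_cmod_psl_act:
  assumes g: "g \<in> carrier PSL2R" and z: "z \<in> cball 0 1"
  shows "1 - (cmod (psl_act g z))\<^sup>2 =
    (1 - (cmod z)\<^sup>2) / (psl_size g * (cmod (1 - cnj (psl_act (inv\<^bsub>PSL2R\<^esub> g) 0) * z))\<^sup>2)"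
proof -
  define w where "w = psl_act (inv\<^bsub>PSL2R\<^esub> g) 0"
  have c: "cnj (1 - cnj w * z) * (1 - cnj w * z) = of_real ((cmod (1 - cnj w * z))\<^sup>2)"
    by (rule cnj_mult_self)
  have c': "(1 - w * cnj z) * (1 - cnj w * z) = of_real ((cmod (1 - cnj w * z))\<^sup>2)"
    using c by simp
  have "complex_of_real (1 - (cmod (psl_act g z))\<^sup>2)
      = complex_of_real ((1 - (cmod z)\<^sup>2) / (psl_size g * (cmod (1 - cnj w * z))\<^sup>2))"
    using psl_act_cnj_mult[OF g z z]
    unfolding w_def[symmetric] cnj_mult_self mult.assoc c' by simp
  then show ?thesis unfolding w_def by (simp only: of_real_eq_iff)
qed

lemma psl_act_sphere:
  assumes "g \<in> carrier PSL2R" "z \<in> sphere 0 1"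
  shows "psl_act g z \<in> sphere 0 1"
  using one_minus_cmod_psl_act[OF assms(1), of z] assms(2) by (auto simp: power2_eq_1_iff) (smt (verit) norm_ge_zero)

lemma psl_act_cball_closed:
  assumes "g \<in> carrier PSL2R" "z \<in> cball 0 1"
  shows "psl_act g z \<in> cball 0 1"
  using psl_act_sphere[OF assms(1), of z] psl_act_in_hyp_plane[OF assms(1), of z] assms(2)
  by (cases "cmod z = 1") auto

lemma cosh_half_sq_psl_act:
  assumes g: "g \<in> carrier PSL2R" and "x \<in> ball 0 1" "y \<in> ball 0 1"
  shows "cosh_half_sq (psl_act g x) (psl_act g y) = cosh_half_sq x y"
proof -
  define w where "w = psl_act (inv\<^bsub>PSL2R\<^esub> g) 0"
  have w: "w \<in> ball 0 1"
    unfolding w_def by (rule psl_act_in_hyp_plane) (use g in \<open>auto intro: psl_inv_closed\<close>)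
  have xy: "x \<in> cball 0 1" "y \<in> cball 0 1" using assms by auto
  have nz: "cmod (1 - cnj w * x) \<noteq> 0" "cmod (1 - cnj w * y) \<noteq> 0" "psl_size g \<noteq> 0"
    using one_minus_cnj_mult_nonzero[OF w] xy psl_size_ge_1[OF g] by auto
  have "cmod (1 - w * cnj x) = cmod (1 - cnj w * x)"
    by (metis complex_cnj_cnj complex_cnj_diff complex_cnj_mult complex_cnj_one complex_mod_cnj)
  then have c: "cmod (1 - cnj (psl_act g x) * psl_act g y) =
      cmod (1 - cnj x * y) / (psl_size g * cmod (1 - cnj w * x) * cmod (1 - cnj w * y))"
    using psl_act_cnj_mult[OF g xy] psl_size_ge_1[OF g]
    unfolding w_def by (simp add: norm_divide norm_mult)
  have "(P / (n * u * v))\<^sup>2 / ((X / (n * u\<^sup>2)) * (Y / (n * v\<^sup>2))) = P\<^sup>2 / (X * Y)"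
    if "n \<noteq> 0" "u \<noteq> 0" "v \<noteq> 0" for P X Y n u v :: real
    using that by (simp add: power_mult_distrib power_divide power2_eq_square)
  from this[OF nz(3) nz(1,2)] show ?thesis
    unfolding cosh_half_sq_def c one_minus_cmod_psl_act[OF g xy(1)] one_minus_cmod_psl_act[OF g xy(2)]
      w_def[symmetric] .
qed

lemma cmod_one_minus_cnj_mult:
  "(cmod (1 - cnj x * y))\<^sup>2 = (cmod (x - y))\<^sup>2 + (1 - (cmod x)\<^sup>2) * (1 - (cmod y)\<^sup>2)"
  unfolding cmod_power2 by (simp add: power2_eq_square algebra_simps)

lemma cosh_half_sq_ge_1:
  assumes "x \<in> ball 0 1" "y \<in> ball 0 1"
  shows "cosh_half_sq x y \<ge> 1"
proof -
  have "(1 - (cmod x)\<^sup>2) * (1 - (cmod y)\<^sup>2) > 0"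
    using assms by (intro mult_pos_pos) (auto simp: power_less_one_iff)
  then show ?thesis by (simp add: cosh_half_sq_def cmod_one_minus_cnj_mult)
qed

lemma hdist_cosh_half_sq:
  assumes "x \<in> ball 0 1" "y \<in> ball 0 1"
  shows "hdist x y = arcosh (2 * cosh_half_sq x y - 1)"
proof -
  have "(1 - (cmod x)\<^sup>2) * (1 - (cmod y)\<^sup>2) > 0"
    using assms by (intro mult_pos_pos) (auto simp: power_less_one_iff)
  then have "(1 - (cmod x)\<^sup>2) * (1 - (cmod y)\<^sup>2) \<noteq> 0" by linarith
  then have "2 * cosh_half_sq x y - 1 = 1 + 2 * (cmod (x - y))\<^sup>2 / ((1 - (cmod x)\<^sup>2) * (1 - (cmod y)\<^sup>2))"
    unfolding cosh_half_sq_def cmod_one_minus_cnj_mult by (simp only: add_divide_distrib) simp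
  then show ?thesis by (simp add: hdist_def)
qed

section \<open>Distances and Busemann functions in terms of the size\<close>

lemma arcosh_bounds:
  fixes y :: real assumes "y \<ge> 1"
  shows "ln y \<le> arcosh (2 * y - 1)" "arcosh (2 * y - 1) \<le> ln y + ln 4"
proof -
  have y: "2 * y - 1 \<ge> 1" "y > 0" using assms by auto
  have s: "sqrt ((2 * y - 1)\<^sup>2 - 1) \<le> 2 * y - 1"
    using y by (intro real_le_lsqrt) auto
  have s0: "sqrt ((2 * y - 1)\<^sup>2 - 1) \<ge> 0" using y by (simp add: power2_eq_square) (simp add: algebra_simps)
  show "ln y \<le> arcosh (2 * y - 1)"
    using assms y s0 by (subst arcosh_real_def) (auto intro!: ln_mono add_increasing2)
  have "arcosh (2 * y - 1) \<le> ln (4 * y)"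
    using assms y s s0 by (subst arcosh_real_def) (auto intro!: ln_mono add_pos_nonneg)
  then show "arcosh (2 * y - 1) \<le> ln y + ln 4" using y by (simp add: ln_mult)
qed

lemma hdist_bounds:
  assumes "x \<in> ball 0 1" "y \<in> ball 0 1"
  shows "ln (cosh_half_sq x y) \<le> hdist x y" "hdist x y \<le> ln (cosh_half_sq x y) + ln 4"
  using arcosh_bounds[OF cosh_half_sq_ge_1[OF assms]] by (simp_all add: hdist_cosh_half_sq[OF assms])

lemma hdist_psl_act:
  assumes "g \<in> carrier PSL2R" "x \<in> ball 0 1" "y \<in> ball 0 1"
  shows "hdist (psl_act g x) (psl_act g y) = hdist x y"
  using assms psl_act_in_hyp_plane[OF assms(1)]
  by (simp add: hdist_cosh_half_sq cosh_half_sq_psl_act del: mem_ball)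

text \<open>The equality is exact, so any failure of \<open>ln (psl_size g)\<close> to be additive
  is the logarithm of the last factor. It is small only if g^-1 0 and h 0 approach the same boundary
  point.\<close>

lemma psl_size_mult:
  assumes g: "g \<in> carrier PSL2R" and h: "h \<in> carrier PSL2R"
  shows "psl_size (g \<otimes>\<^bsub>PSL2R\<^esub> h) =
    psl_size g * psl_size h * (cmod (1 - cnj (psl_act (inv\<^bsub>PSL2R\<^esub> g) 0) * psl_act h 0))\<^sup>2"
proof -
  have "psl_act h 0 \<in> ball 0 1" by (rule psl_act_in_hyp_plane[OF h]) simp
  then have "psl_act h 0 \<in> cball 0 1" by auto
  from one_minus_cmod_psl_act[OF g this] show ?thesis
    using g h by (simp add: psl_size_def psl_act_mult)
qed

text \<open>\<open>busemann\<close> is defined by \<open>Lim\<close>, so existence of the limit is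
  the point. Up to \<open>r\<close>, each distance is the logarithm of \<open>cosh_half_sq\<close>,
  which splits into a term continuous up to the boundary and
  \<open>ln (1 - (cmod z)\<^sup>2)\<close>; the latter is the same for \<open>x\<close> and
  \<open>y\<close> and cancels.\<close>

lemma busemann_tendsto:
  assumes \<xi>: "\<xi> \<in> sphere 0 1" and x: "x \<in> ball 0 1" and y: "y \<in> ball 0 1"
  shows "((\<lambda>z. hdist x z - hdist y z) \<longlongrightarrow> busemann \<xi> x y) (at \<xi> within ball 0 1)"
proof -
  let ?F = "at \<xi> within ball 0 1"
  have nt: "\<not> trivial_limit ?F" using \<xi> by (simp add: trivial_limit_within islimpt_ball)
  have ev: "\<forall>\<^sub>F z in ?F. z \<in> ball 0 1" by (simp add: eventually_at_filter)
  \<comment> \<open>The deviation of the distance from the logarithm of \<open>cosh_half_sq\<close>,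
    as a function of the latter. It tends to ln 4 at infinity, so its two occurrences cancel at the
    boundary.\<close>
  define r where "r = (\<lambda>Y::real. arcosh (2 * Y - 1) - ln Y)"
  have r: "(r \<longlongrightarrow> ln 4) at_top"
  proof -
    have eq: "\<forall>\<^sub>F Y in at_top. ln ((2 * Y - 1) / Y + sqrt (((2 * Y - 1) / Y)\<^sup>2 - (1 / Y)\<^sup>2)) = r Y"
    proof (rule eventually_mono[OF eventually_ge_at_top[of 1]])
      fix Y :: real assume Y: "1 \<le> Y"
      have "0 \<le> (2 * Y - 1)\<^sup>2 - 1" using Y by (simp add: power2_eq_square algebra_simps)
      then have "2 * Y - 1 + sqrt ((2 * Y - 1)\<^sup>2 - 1) > 0" using Y by (intro add_pos_nonneg) auto
      then have "r Y = ln ((2 * Y - 1 + sqrt ((2 * Y - 1)\<^sup>2 - 1)) / Y)"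
        using Y by (simp add: r_def arcosh_real_def ln_div)
      also have "sqrt ((2 * Y - 1)\<^sup>2 - 1) / Y = sqrt (((2 * Y - 1) / Y)\<^sup>2 - (1 / Y)\<^sup>2)"
        using Y by (simp add: real_sqrt_divide power_divide diff_divide_distrib[symmetric])
      then have "(2 * Y - 1 + sqrt ((2 * Y - 1)\<^sup>2 - 1)) / Y
          = (2 * Y - 1) / Y + sqrt (((2 * Y - 1) / Y)\<^sup>2 - (1 / Y)\<^sup>2)"
        by (simp add: add_divide_distrib)
      finally show "ln ((2 * Y - 1) / Y + sqrt (((2 * Y - 1) / Y)\<^sup>2 - (1 / Y)\<^sup>2)) = r Y" by simp
    qed
    have i: "((\<lambda>Y::real. 1 / Y) \<longlongrightarrow> 0) at_top"
      by (rule tendsto_divide_0[OF tendsto_const filterlim_ident[THEN filterlim_at_top_imp_at_infinity]])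
    have "((\<lambda>Y::real. 2 - 1 / Y) \<longlongrightarrow> 2) at_top"
      using tendsto_diff[OF tendsto_const[of 2] i] by simp
    moreover have "\<forall>\<^sub>F Y in at_top. 2 - 1 / Y = (2 * Y - 1) / (Y::real)"
      by (rule eventually_mono[OF eventually_gt_at_top[of 0]]) (simp add: field_simps)
    ultimately have j: "((\<lambda>Y::real. (2 * Y - 1) / Y) \<longlongrightarrow> 2) at_top"
      by (rule Lim_transform_eventually)
    have "((\<lambda>Y::real. ln ((2 * Y - 1) / Y + sqrt (((2 * Y - 1) / Y)\<^sup>2 - (1 / Y)\<^sup>2)))
        \<longlongrightarrow> ln (2 + sqrt (2\<^sup>2 - 0\<^sup>2))) at_top"
      by (intro tendsto_intros i j) auto
    then show ?thesis using eq by (auto intro: Lim_transform_eventually)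
  qed
  have top: "filterlim (\<lambda>z. cosh_half_sq u z) at_top ?F" if u: "u \<in> ball 0 1" for u
  proof -
    have u1: "1 - (cmod u)\<^sup>2 > 0" using u by (simp add: power_less_one_iff)
    have "((\<lambda>z. (1 - (cmod u)\<^sup>2) * (1 - (cmod z)\<^sup>2)) \<longlongrightarrow> (1 - (cmod u)\<^sup>2) * (1 - (cmod \<xi>)\<^sup>2)) ?F"
      by (intro tendsto_intros)
    then have "((\<lambda>z. (1 - (cmod u)\<^sup>2) * (1 - (cmod z)\<^sup>2)) \<longlongrightarrow> 0) ?F" using \<xi> by simp
    moreover have "\<forall>\<^sub>F z in ?F. 0 < (1 - (cmod u)\<^sup>2) * (1 - (cmod z)\<^sup>2)"
      using ev by eventually_elim (use u1 in \<open>simp add: power_less_one_iff\<close>)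
    moreover have "((\<lambda>z. (cmod (1 - cnj u * z))\<^sup>2) \<longlongrightarrow> (cmod (1 - cnj u * \<xi>))\<^sup>2) ?F"
      by (intro tendsto_intros)
    moreover have "(cmod (1 - cnj u * \<xi>))\<^sup>2 > 0"
      using one_minus_cnj_mult_nonzero[OF u, of \<xi>] \<xi> by auto
    ultimately show ?thesis unfolding cosh_half_sq_def by (intro LIM_at_top_divide)
  qed
  \<comment> \<open>A difference of logarithms of reciprocal Poisson kernels, the explicit value of
    the Busemann function.\<close>
  define L where "L = ln ((cmod (1 - cnj x * \<xi>))\<^sup>2 / (1 - (cmod x)\<^sup>2)) - ln ((cmod (1 - cnj y * \<xi>))\<^sup>2 / (1 - (cmod y)\<^sup>2))"
  have lim0: "((\<lambda>z. ln ((cmod (1 - cnj u * z))\<^sup>2 / (1 - (cmod u)\<^sup>2)))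
      \<longlongrightarrow> ln ((cmod (1 - cnj u * \<xi>))\<^sup>2 / (1 - (cmod u)\<^sup>2))) ?F" if u: "u \<in> ball 0 1" for u
  proof -
    have "(cmod u)\<^sup>2 < 1" using u by (simp add: power_less_one_iff)
    then show ?thesis
      using one_minus_cnj_mult_nonzero[OF u, of \<xi>] \<xi> by (intro tendsto_intros) auto
  qed
  have "((\<lambda>z. (r (cosh_half_sq x z) - r (cosh_half_sq y z)) +
      (ln ((cmod (1 - cnj x * z))\<^sup>2 / (1 - (cmod x)\<^sup>2)) - ln ((cmod (1 - cnj y * z))\<^sup>2 / (1 - (cmod y)\<^sup>2))))
      \<longlongrightarrow> (ln 4 - ln 4) + L) ?F"
    unfolding L_def
    by (intro tendsto_intros lim0 x y filterlim_compose[OF r] top)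
  moreover have "\<forall>\<^sub>F z in ?F. (r (cosh_half_sq x z) - r (cosh_half_sq y z)) +
      (ln ((cmod (1 - cnj x * z))\<^sup>2 / (1 - (cmod x)\<^sup>2)) - ln ((cmod (1 - cnj y * z))\<^sup>2 / (1 - (cmod y)\<^sup>2)))
      = hdist x z - hdist y z"
    using ev
  proof eventually_elim
    case (elim z)
    have z1: "1 - (cmod z)\<^sup>2 > 0" using elim by (simp add: power_less_one_iff)
    have "ln (cosh_half_sq u z) = ln ((cmod (1 - cnj u * z))\<^sup>2 / (1 - (cmod u)\<^sup>2)) - ln (1 - (cmod z)\<^sup>2)"
      if u: "u \<in> ball 0 1" for u
    proof -
      have "cosh_half_sq u z = (cmod (1 - cnj u * z))\<^sup>2 / (1 - (cmod u)\<^sup>2) / (1 - (cmod z)\<^sup>2)"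
        by (simp add: cosh_half_sq_def)
      moreover have "(cmod (1 - cnj u * z))\<^sup>2 / (1 - (cmod u)\<^sup>2) > 0"
        using one_minus_cnj_mult_nonzero[OF u, of z] elim u by (simp add: power_less_one_iff)
      ultimately show ?thesis using z1 by (simp only: ln_divide_pos)
    qed
    from this[OF x] this[OF y] show ?case
      using x y elim by (simp add: r_def hdist_cosh_half_sq del: mem_ball)
  qed
  ultimately have *: "((\<lambda>z. hdist x z - hdist y z) \<longlongrightarrow> (ln 4 - ln 4) + L) ?F"
    by (rule Lim_transform_eventually)
  show ?thesis unfolding busemann_def tendsto_Lim[OF nt *] by (rule *)
qed

text \<open>Turns Euclidean separation of two points into a lower bound for the factor in
  \<open>psl_size_mult\<close>.\<close>

lemma cmod_diff_le_one_minus_cnj_mult: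
  assumes "x \<in> cball 0 1" "y \<in> cball 0 1"
  shows "cmod (x - y) \<le> cmod (1 - cnj x * y)"
proof -
  have "(1 - (cmod x)\<^sup>2) * (1 - (cmod y)\<^sup>2) \<ge> 0"
    using assms by (intro mult_nonneg_nonneg) (auto simp: power_le_one_iff)
  then have "(cmod (x - y))\<^sup>2 \<le> (cmod (1 - cnj x * y))\<^sup>2" by (simp add: cmod_one_minus_cnj_mult)
  then show ?thesis by (rule power2_le_imp_le) simp
qed

lemma one_minus_cnj_mult_bounds:
  assumes "x \<in> cball 0 1" "y \<in> cball 0 1"
  shows "1 - cmod x \<le> cmod (1 - cnj x * y)" "1 - cmod y \<le> cmod (1 - cnj x * y)"
    and "cmod (1 - cnj x * y) \<le> 2"
proof -
  have "cmod (cnj x * y) \<le> cmod x" "cmod (cnj x * y) \<le> cmod y"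
    using assms by (simp_all add: norm_mult mult_left_le mult_right_le_one_le mult_left_le_one_le)
  then show "1 - cmod x \<le> cmod (1 - cnj x * y)" "1 - cmod y \<le> cmod (1 - cnj x * y)"
    using norm_triangle_ineq2[of 1 "cnj x * y"] by auto
  show "cmod (1 - cnj x * y) \<le> 2"
    using norm_triangle_ineq4[of 1 "cnj x * y"] \<open>cmod (cnj x * y) \<le> cmod x\<close> assms by auto
qed

text \<open>With p = |g 0| the reciprocal of the size is (1 - p) (1 + p), and 1 + p is at most 2.
  This serves for elements too small for \<open>act_0_near_K\<close> to be informative.\<close>

lemma one_minus_cmod_psl_act_0:
  assumes g: "g \<in> carrier PSL2R"
  shows "1 - cmod (psl_act g 0) \<ge> 1 / (2 * psl_size g)"
proof -
  define p where "p = cmod (psl_act g 0)"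
  have p: "0 \<le> p" "p < 1" using psl_act_in_hyp_plane[OF g, of 0] by (auto simp: p_def)
  have "1 / (2 * psl_size g) = (1 - p\<^sup>2) / 2" unfolding psl_size_def p_def by simp
  also have "\<dots> = (1 - p) * ((1 + p) / 2)" by (simp add: power2_eq_square algebra_simps)
  also have "\<dots> \<le> 1 - p" using p by (intro mult_left_le) auto
  finally show ?thesis by (simp add: p_def)
qed

lemma hdist_0_psl_act:
  assumes g: "g \<in> carrier PSL2R"
  shows "ln (psl_size g) \<le> hdist 0 (psl_act g 0)" "hdist 0 (psl_act g 0) \<le> ln (psl_size g) + ln 4"
  using hdist_bounds[of 0 "psl_act g 0"] psl_act_in_hyp_plane[OF g, of 0]
  by (simp_all add: cosh_half_sq_def psl_size_def)

text \<open>\<open>cosh_half_sq x (psl_act g y)\<close> is \<open>psl_size g\<close> times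
  \<open>q / X\<close>, where \<open>X\<close> depends on \<open>x\<close> and \<open>y\<close> only
  and \<open>q\<close> stays between two positive bounds independent of \<open>g\<close>.\<close>

lemma hdist_psl_act_approx:
  assumes x: "x \<in> ball 0 1" and y: "y \<in> ball 0 1"
  obtains C where "\<And>g. g \<in> carrier PSL2R \<Longrightarrow> \<bar>hdist x (psl_act g y) - ln (psl_size g)\<bar> \<le> C"
proof -
  define X where "X = (1 - (cmod x)\<^sup>2) * (1 - (cmod y)\<^sup>2)"
  define m where "m = ((1 - cmod x) * (1 - cmod y))\<^sup>2 / X"
  have X: "X > 0" unfolding X_def using x y by (intro mult_pos_pos) (auto simp: power_less_one_iff)
  have m: "m > 0" using X x y by (auto simp: m_def)
  have "\<bar>hdist x (psl_act g y) - ln (psl_size g)\<bar> \<le> \<bar>ln m\<bar> + \<bar>ln (16 / X)\<bar> + ln 4"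
    if g: "g \<in> carrier PSL2R" for g
  proof -
    let ?w = "psl_act (inv\<^bsub>PSL2R\<^esub> g) 0" and ?z = "psl_act g y"
    have z: "?z \<in> ball 0 1" and w: "?w \<in> ball 0 1"
      using psl_act_in_hyp_plane g y psl_inv_closed by (auto simp del: mem_ball)
    have c: "x \<in> cball 0 1" "y \<in> cball 0 1" "?z \<in> cball 0 1" "?w \<in> cball 0 1"
      using x y z w by auto
    have N: "psl_size g \<ge> 1" by (rule psl_size_ge_1[OF g])
    define q where "q = (cmod (1 - cnj x * ?z) * cmod (1 - cnj ?w * y))\<^sup>2"
    have Q: "cosh_half_sq x ?z = psl_size g * (q / X)"
      unfolding cosh_half_sq_def one_minus_cmod_psl_act[OF g c(2)] X_def q_def
      by (simp add: power_mult_distrib mult.assoc)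
    have "((1 - cmod x) * (1 - cmod y))\<^sup>2 \<le> q"
      unfolding q_def using x y
      by (intro power_mono mult_mono one_minus_cnj_mult_bounds c) auto
    then have q1: "m \<le> q / X" using X by (simp add: m_def divide_right_mono)
    have "q \<le> (2 * 2)\<^sup>2"
      unfolding q_def by (intro power_mono mult_mono one_minus_cnj_mult_bounds c) auto
    then have q2: "q / X \<le> 16 / X" using X by (simp add: divide_right_mono)
    have l: "ln m \<le> ln (q / X)" "ln (q / X) \<le> ln (16 / X)"
      using q1 q2 m by (auto intro!: ln_mono)
    have "ln (cosh_half_sq x ?z) = ln (psl_size g) + ln (q / X)"
      unfolding Q using N m q1 by (intro ln_mult_pos) auto
    with hdist_bounds[OF x z] l show ?thesis by linarith
  qed
  then show thesis by (rule that)
qed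

section \<open>Ping-pong\<close>

text \<open>Normal forms in a free product of cyclic groups. An entry is a whole syllable, a nonzero
  power of one letter, so that entries match the symbols of the Markov shift and length means
  syllable length.\<close>

definition reduced :: "'g set \<Rightarrow> ('g \<times> int) list \<Rightarrow> bool" where
  "reduced A l \<longleftrightarrow> set l \<subseteq> alphabet A \<and> successively (\<lambda>x y. fst x \<noteq> fst y) l"

primrec word_val :: "('g, 'm) monoid_scheme \<Rightarrow> ('g \<times> int) list \<Rightarrow> 'g" where
  "word_val G [] = \<one>\<^bsub>G\<^esub>"
| "word_val G (x # l) = (fst x [^]\<^bsub>G\<^esub> snd x) \<otimes>\<^bsub>G\<^esub> word_val G l"

definition inv_word :: "('g \<times> int) list \<Rightarrow> ('g \<times> int) list" where
  "inv_word l = rev (map (\<lambda>x. (fst x, - snd x)) l)"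

lemma reduced_Nil [simp]: "reduced A []"
  by (simp add: reduced_def)

lemma reduced_append:
  "reduced A (l @ l') \<longleftrightarrow> reduced A l \<and> reduced A l' \<and>
     (l = [] \<or> l' = [] \<or> fst (last l) \<noteq> fst (hd l'))"
  by (auto simp: reduced_def successively_append_iff)

lemma reduced_Cons:
  "reduced A (x # l) \<longleftrightarrow> x \<in> alphabet A \<and> reduced A l \<and> (l = [] \<or> fst x \<noteq> fst (hd l))"
  by (auto simp: reduced_def successively_Cons)

lemma reduced_inv_word: "reduced A l \<Longrightarrow> reduced A (inv_word l)"
  by (auto simp: reduced_def inv_word_def successively_rev successively_map alphabet_def eq_commute)

lemma hd_inv_word: "l \<noteq> [] \<Longrightarrow> fst (hd (inv_word l)) = fst (last l)"
  by (simp add: inv_word_def hd_rev last_map)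

lemma inv_word_eq_Nil [simp]: "inv_word l = [] \<longleftrightarrow> l = []"
  by (simp add: inv_word_def)

section \<open>Reduced words in a group\<close>

context group
begin

lemma letter_pow_closed: "A \<subseteq> carrier G \<Longrightarrow> x \<in> alphabet A \<Longrightarrow> fst x [^] snd x \<in> carrier G"
  by (auto simp: alphabet_def)

lemma word_val_closed: "A \<subseteq> carrier G \<Longrightarrow> reduced A l \<Longrightarrow> word_val G l \<in> carrier G"
  by (induction l) (auto simp: reduced_Cons letter_pow_closed)

lemma word_val_append:
  "A \<subseteq> carrier G \<Longrightarrow> reduced A l \<Longrightarrow> reduced A l' \<Longrightarrow> word_val G (l @ l') = word_val G l \<otimes> word_val G l'"
  by (induction l) (auto simp: reduced_Cons letter_pow_closed word_val_closed m_assoc)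

lemma word_val_inv_word:
  assumes A: "A \<subseteq> carrier G"
  shows "reduced A l \<Longrightarrow> word_val G (inv_word l) = inv (word_val G l)"
proof (induction l)
  case (Cons x l)
  have l: "reduced A l" "x \<in> alphabet A" using Cons.prems by (auto simp: reduced_Cons)
  have r: "reduced A [(fst x, - snd x)]" "reduced A (inv_word l)"
    using l reduced_inv_word by (auto simp: reduced_Cons alphabet_def)
  have fx: "fst x \<in> carrier G" using l A by (auto simp: alphabet_def)
  have "inv_word (x # l) = inv_word l @ [(fst x, - snd x)]" by (simp add: inv_word_def)
  then have "word_val G (inv_word (x # l)) = word_val G (inv_word l) \<otimes> fst x [^] (- snd x)"
    using word_val_append[OF A r(2,1)] fx by simp
  also have "\<dots> = inv (word_val G (x # l))"
    using Cons.IH l fx word_val_closed[OF A] by (simp add: inv_mult_group int_pow_neg)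
  finally show ?case .
qed (simp add: inv_word_def)

text \<open>If \<open>l\<close> begins with the same letter, the exponents merge; if they cancel,
  the tail is reduced already.\<close>

lemma letter_mult_word:
  assumes A: "A \<subseteq> carrier G" and x: "x \<in> alphabet A" and l: "reduced A l"
  shows "\<exists>k. reduced A k \<and> word_val G k = fst x [^] snd x \<otimes> word_val G l"
proof (cases "l \<noteq> [] \<and> fst (hd l) = fst x")
  case False
  then have "reduced A (x # l)" using x l by (auto simp: reduced_Cons)
  then show ?thesis by (intro exI[of _ "x # l"]) simp
next
  case True
  then obtain y k where yk: "l = y # k" "fst y = fst x" by (cases l) auto
  have y: "y \<in> alphabet A" "reduced A k" "k = [] \<or> fst x \<noteq> fst (hd k)"
    using l yk by (auto simp: reduced_Cons)
  have fx: "fst x \<in> carrier G" using x A by (auto simp: alphabet_def)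
  have eq: "fst x [^] snd x \<otimes> word_val G l = fst x [^] (snd x + snd y) \<otimes> word_val G k"
    using fx y word_val_closed[OF A y(2)] by (simp add: yk m_assoc[symmetric] int_pow_mult)
  show ?thesis
  proof (cases "snd x + snd y = 0")
    case True
    then show ?thesis unfolding eq using y word_val_closed[OF A y(2)] by (intro exI[of _ k]) simp
  next
    case False
    then have "reduced A ((fst x, snd x + snd y) # k)" using x y by (auto simp: reduced_Cons alphabet_def)
    then show ?thesis unfolding eq by (intro exI[of _ "(fst x, snd x + snd y) # k"]) simp
  qed
qed

lemma word_mult_word:
  assumes A: "A \<subseteq> carrier G" and l': "reduced A l'"
  shows "reduced A l \<Longrightarrow> \<exists>k. reduced A k \<and> word_val G k = word_val G l \<otimes> word_val G l'"
proof (induction l)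
  case Nil
  then show ?case using l' word_val_closed[OF A l'] by (intro exI[of _ l']) simp
next
  case (Cons x l)
  have x: "x \<in> alphabet A" "reduced A l" using Cons.prems by (auto simp: reduced_Cons)
  obtain k where k: "reduced A k" "word_val G k = word_val G l \<otimes> word_val G l'" using Cons.IH x by blast
  obtain k' where "reduced A k'" "word_val G k' = fst x [^] snd x \<otimes> word_val G k"
    using letter_mult_word[OF A x(1) k(1)] by blast
  then show ?case
    using k(2) letter_pow_closed[OF A x(1)] word_val_closed[OF A x(2)] word_val_closed[OF A l']
    by (intro exI[of _ k']) (simp add: m_assoc)
qed

end

text \<open>For a hyperbolic generator \<open>K a\<close> will be the union of the neighbourhoods of
  both fixed points. Hyperbolic and parabolic generators then satisfy one common condition
  \<open>play\<close>, for all nonzero powers.\<close>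

locale ping_pong = group G for G :: "('g, 'm) monoid_scheme" (structure) +
  fixes \<rho> :: "'g \<Rightarrow> (real^2^2) set" and A :: "'g set" and K :: "'g \<Rightarrow> complex set"
  assumes rho_hom: "\<rho> \<in> hom G PSL2R"
    and letters: "A \<subseteq> carrier G" "finite A" "card A \<ge> 2"
    and K_compact: "\<And>a. a \<in> A \<Longrightarrow> compact (K a)"
    and K_sphere: "\<And>a. a \<in> A \<Longrightarrow> K a \<subseteq> sphere 0 1"
    and K_nonempty: "\<And>a. a \<in> A \<Longrightarrow> K a \<noteq> {}"
    and K_disjoint: "\<And>a b. a \<in> A \<Longrightarrow> b \<in> A \<Longrightarrow> a \<noteq> b \<Longrightarrow> K a \<inter> K b = {}"
    and play: "\<And>a n. a \<in> A \<Longrightarrow> n \<noteq> 0 \<Longrightarrow> psl_act (\<rho> (a [^] (n::int))) ` (sphere 0 1 - K a) \<subseteq> K a"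
    and generated: "\<And>\<gamma>. \<gamma> \<in> carrier G \<Longrightarrow> \<exists>l. reduced A l \<and> word_val G l = \<gamma>"
begin

abbreviation act :: "'g \<Rightarrow> complex \<Rightarrow> complex" where
  "act \<gamma> \<equiv> psl_act (\<rho> \<gamma>)"

abbreviation sz :: "'g \<Rightarrow> real" where
  "sz \<gamma> \<equiv> psl_size (\<rho> \<gamma>)"

abbreviation val :: "('g \<times> int) list \<Rightarrow> 'g" where
  "val \<equiv> word_val G"

definition U :: "complex set" where
  "U = sphere 0 1 - (\<Union>a\<in>A. K a)"

lemma rho_closed [simp]: "\<gamma> \<in> carrier G \<Longrightarrow> \<rho> \<gamma> \<in> carrier PSL2R"
  using rho_hom by (auto simp: hom_def)

lemma rho_mult: "\<gamma> \<in> carrier G \<Longrightarrow> \<eta> \<in> carrier G \<Longrightarrow> \<rho> (\<gamma> \<otimes> \<eta>) = \<rho> \<gamma> \<otimes>\<^bsub>PSL2R\<^esub> \<rho> \<eta>"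
  using rho_hom by (auto simp: hom_def)

lemma rho_inv: "\<gamma> \<in> carrier G \<Longrightarrow> \<rho> (inv \<gamma>) = inv\<^bsub>PSL2R\<^esub> (\<rho> \<gamma>)"
  using group_hom.hom_inv[of G PSL2R \<rho> \<gamma>] rho_hom group_PSL2R
  by (simp add: group_hom_def group_hom_axioms_def)

lemma rho_one: "\<rho> \<one> = \<one>\<^bsub>PSL2R\<^esub>"
  using group_hom.hom_one[of G PSL2R \<rho>] rho_hom group_PSL2R
  by (simp add: group_hom_def group_hom_axioms_def)

lemma act_mult:
  "\<gamma> \<in> carrier G \<Longrightarrow> \<eta> \<in> carrier G \<Longrightarrow> z \<in> cball 0 1 \<Longrightarrow> act (\<gamma> \<otimes> \<eta>) z = act \<gamma> (act \<eta> z)"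
  by (simp only: rho_mult psl_act_mult rho_closed)

lemma act_one: "act \<one> z = z"
  by (simp add: rho_one psl_act_one)

lemma act_0: "\<gamma> \<in> carrier G \<Longrightarrow> act \<gamma> 0 \<in> ball 0 1"
  by (rule psl_act_in_hyp_plane) auto

lemma sz_ge_1: "\<gamma> \<in> carrier G \<Longrightarrow> sz \<gamma> \<ge> 1"
  by (simp add: psl_size_ge_1)

lemma sz_inv: "\<gamma> \<in> carrier G \<Longrightarrow> sz (inv \<gamma>) = sz \<gamma>"
  by (simp add: rho_inv psl_size_inv)

lemmas val_closed [simp] = word_val_closed[OF letters(1)]
lemmas val_append = word_val_append[OF letters(1)]

text \<open>Both claims need a joint induction: the second, avoidance of the sets of all other
  letters, is what allows the next syllable to be played.\<close>

lemma
  assumes "reduced A l" "\<zeta> \<in> U"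
  shows act_word: "l \<noteq> [] \<Longrightarrow> act (val l) \<zeta> \<in> K (fst (hd l))"
    and act_word_notin: "a \<in> A \<Longrightarrow> l = [] \<or> fst (hd l) \<noteq> a \<Longrightarrow> act (val l) \<zeta> \<in> sphere 0 1 - K a"
proof -
  have "(l \<noteq> [] \<longrightarrow> act (val l) \<zeta> \<in> K (fst (hd l))) \<and>
      (\<forall>a\<in>A. l = [] \<or> fst (hd l) \<noteq> a \<longrightarrow> act (val l) \<zeta> \<in> sphere 0 1 - K a)"
    using assms(1)
  proof (induction l)
    case Nil
    then show ?case using assms(2) by (auto simp: act_one U_def)
  next
    case (Cons x l)
    have x: "fst x \<in> A" "snd x \<noteq> 0" "reduced A l" "l = [] \<or> fst (hd l) \<noteq> fst x"
      using Cons.prems by (auto simp: reduced_Cons alphabet_def)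
    have "act (val l) \<zeta> \<in> sphere 0 1 - K (fst x)" using Cons.IH x by blast
    then have "act (fst x [^] snd x) (act (val l) \<zeta>) \<in> K (fst x)" using play[OF x(1,2)] by blast
    moreover have "fst x [^] snd x \<in> carrier G" "\<zeta> \<in> cball 0 1"
      using x letters assms(2) by (auto simp: U_def)
    ultimately have "act (val (x # l)) \<zeta> \<in> K (fst x)" using x by (simp add: act_mult)
    then show ?case using K_disjoint[OF x(1)] K_sphere[OF x(1)] by auto
  qed
  then show "l \<noteq> [] \<Longrightarrow> act (val l) \<zeta> \<in> K (fst (hd l))"
    "a \<in> A \<Longrightarrow> l = [] \<or> fst (hd l) \<noteq> a \<Longrightarrow> act (val l) \<zeta> \<in> sphere 0 1 - K a" by blast+
qed

lemma hd_letter: "reduced A l \<Longrightarrow> l \<noteq> [] \<Longrightarrow> fst (hd l) \<in> A"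
  by (cases l) (auto simp: reduced_Cons alphabet_def)

text \<open>Two points are wanted so that one of them is far from any given pole. \<open>U\<close>
  is open in the connected circle. If it were empty, \<open>K a\<close> would be clopen, being the
  complement of the other sets; if it were a single point, it would be clopen itself.\<close>

lemma U_two_points: obtains \<zeta> \<zeta>' where "\<zeta> \<in> U" "\<zeta>' \<in> U" "\<zeta> \<noteq> \<zeta>'"
proof -
  let ?S = "sphere (0::complex) 1"
  have conn: "connected ?S" by (rule connected_sphere) simp
  obtain a b where ab: "a \<in> A" "b \<in> A" "a \<noteq> b"
    using letters(2,3) by (metis One_nat_def Suc_1 card_le_Suc0_iff_eq not_less_eq_eq)
  have clU: "closed (\<Union>a\<in>B. K a)" if "B \<subseteq> A" for B
    using that letters(2) K_compact by (intro closed_UN) (auto intro: finite_subset compact_imp_closed)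
  have opn: "openin (top_of_set ?S) (?S - (\<Union>a\<in>B. K a))" if "B \<subseteq> A" for B
    using clU[OF that] by (metis Diff_eq open_Compl openin_open_Int)
  have opU: "openin (top_of_set ?S) U" unfolding U_def by (rule opn) simp
  have "U \<noteq> {}"
  proof
    assume "U = {}"
    then have "?S - (\<Union>c\<in>A - {a}. K c) = K a"
      using K_disjoint ab(1) K_sphere by (fastforce simp: U_def)
    then have "openin (top_of_set ?S) (K a)" using opn[of "A - {a}"] by auto
    moreover have "closedin (top_of_set ?S) (K a)"
      using K_sphere[OF ab(1)] K_compact[OF ab(1)] by (simp add: closed_subset compact_imp_closed)
    ultimately have "K a = ?S"
      using conn K_nonempty[OF ab(1)] unfolding connected_clopen by blast
    then show False using K_disjoint[OF ab] K_sphere[OF ab(2)] K_nonempty[OF ab(2)] by blast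
  qed
  then obtain \<zeta> where z: "\<zeta> \<in> U" by blast
  have "U \<noteq> {\<zeta>}"
  proof
    assume U: "U = {\<zeta>}"
    have "\<zeta> \<in> ?S" using z by (simp add: U_def)
    then have "closedin (top_of_set ?S) U" unfolding U by (intro closed_subset) auto
    then have "U = ?S" using opU conn z unfolding connected_clopen by blast
    then have "K a = {}" using K_sphere[OF ab(1)] ab(1) by (auto simp: U_def)
    then show False using K_nonempty ab by blast
  qed
  then show thesis using z that by blast
qed

section \<open>Orbit points of the origin and additivity of the size\<close>

lemma K_separated:
  obtains \<delta> where "\<delta> > 0" and "\<And>a b x y. a \<in> A \<Longrightarrow> b \<in> A \<Longrightarrow> a \<noteq> b \<Longrightarrow> x \<in> K a \<Longrightarrow> y \<in> K b \<Longrightarrow> \<delta> \<le> dist x y"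
proof -
  define P where "P = {p \<in> A \<times> A. fst p \<noteq> snd p}"
  have "\<forall>p\<in>P. \<exists>d>0. \<forall>x\<in>K (fst p). \<forall>y\<in>K (snd p). d \<le> dist x y"
  proof
    fix p assume "p \<in> P"
    then have p: "fst p \<in> A" "snd p \<in> A" "fst p \<noteq> snd p" by (auto simp: P_def)
    show "\<exists>d>0. \<forall>x\<in>K (fst p). \<forall>y\<in>K (snd p). d \<le> dist x y"
      using K_compact[OF p(1)] compact_imp_closed[OF K_compact[OF p(2)]] K_disjoint[OF p]
      by (rule separate_compact_closed)
  qed
  then obtain d where d: "\<And>p. p \<in> P \<Longrightarrow> d p > 0"
    "\<And>p x y. p \<in> P \<Longrightarrow> x \<in> K (fst p) \<Longrightarrow> y \<in> K (snd p) \<Longrightarrow> d p \<le> dist x y"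
    by metis
  have fin: "finite P" using letters(2) by (simp add: P_def)
  have "Min (insert 1 (d ` P)) > 0" using fin d(1) by simp
  moreover have "Min (insert 1 (d ` P)) \<le> dist x y"
    if "a \<in> A" "b \<in> A" "a \<noteq> b" "x \<in> K a" "y \<in> K b" for a b x y
  proof -
    have "(a, b) \<in> P" using that by (simp add: P_def)
    then have "Min (insert 1 (d ` P)) \<le> d (a, b)" using fin by (intro Min_le) auto
    also have "\<dots> \<le> dist x y" using d(2)[OF \<open>(a, b) \<in> P\<close>] that by simp
    finally show ?thesis .
  qed
  ultimately show thesis by (rule that)
qed

text \<open>One of two chosen points of \<open>U\<close> is far from the pole of \<open>val l\<close>, so its image, which lies in
  \<open>K (fst (hd l))\<close>, is within \<open>O(1 / sz (val l))\<close> of the image of the origin.\<close>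

lemma act_0_near_K:
  obtains r where "r > 0" and "\<And>l. reduced A l \<Longrightarrow> l \<noteq> [] \<Longrightarrow>
    \<exists>y\<in>K (fst (hd l)). dist (act (val l) 0) y \<le> 1 / (sz (val l) * r)"
proof -
  obtain \<zeta>1 \<zeta>2 where z: "\<zeta>1 \<in> U" "\<zeta>2 \<in> U" "\<zeta>1 \<noteq> \<zeta>2" using U_two_points .
  define r where "r = dist \<zeta>1 \<zeta>2 / 2"
  have r: "r > 0" using z by (simp add: r_def)
  have "\<exists>y\<in>K (fst (hd l)). dist (act (val l) 0) y \<le> 1 / (sz (val l) * r)"
    if l: "reduced A l" "l \<noteq> []" for l
  proof -
    define w where "w = psl_act (inv\<^bsub>PSL2R\<^esub> (\<rho> (val l))) 0"
    have g: "\<rho> (val l) \<in> carrier PSL2R" using l by simp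
    have w: "w \<in> cball 0 1"
      unfolding w_def using psl_act_cball_closed[OF psl_inv_closed[OF g], of 0] by simp
    have "dist \<zeta>1 \<zeta>2 \<le> dist w \<zeta>1 + dist w \<zeta>2" by (metis dist_commute dist_triangle)
    then obtain \<zeta> where \<zeta>: "\<zeta> \<in> U" "r \<le> dist w \<zeta>"
      using z unfolding r_def by (smt (verit) field_sum_of_halves)
    then have zc: "\<zeta> \<in> cball 0 1" "cmod \<zeta> = 1" by (auto simp: U_def)
    have "r \<le> cmod (1 - cnj w * \<zeta>)"
      using cmod_diff_le_one_minus_cnj_mult[OF w zc(1)] \<zeta> by (simp add: dist_norm)
    then have "1 / (sz (val l) * cmod (1 - cnj w * \<zeta>)) \<le> 1 / (sz (val l) * r)"
      using r sz_ge_1[of "val l"] l by (intro divide_left_mono mult_left_mono mult_pos_pos) auto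
    then have "dist (act (val l) 0) (act (val l) \<zeta>) \<le> 1 / (sz (val l) * r)"
      using cmod_psl_act_diff[OF g, of 0 \<zeta>] zc unfolding w_def by (simp add: dist_norm)
    then show ?thesis using act_word[OF l(1) \<zeta>(1) l(2)] by blast
  qed
  with r show thesis by (rule that)
qed

text \<open>The inverse of \<open>val l\<close> is spelled by \<open>inv_word l\<close>, which
  begins with the last letter of \<open>l\<close>, and this differs from the first letter of
  \<open>l'\<close>. If both elements are large, their orbit points are close to two different,
  hence separated, sets \<open>K a\<close>; if one is small, its orbit point stays away from the
  circle.\<close>

lemma act_0_separated:
  obtains \<epsilon> where "\<epsilon> > 0" and "\<And>l l'. reduced A (l @ l') \<Longrightarrow>
    \<epsilon> \<le> cmod (1 - cnj (act (inv (val l)) 0) * act (val l') 0)"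
proof -
  obtain r where r: "r > 0" and near: "\<And>l. reduced A l \<Longrightarrow> l \<noteq> [] \<Longrightarrow>
    \<exists>y\<in>K (fst (hd l)). dist (act (val l) 0) y \<le> 1 / (sz (val l) * r)" using act_0_near_K by blast
  obtain \<delta> where \<delta>: "\<delta> > 0" and sep: "\<And>a b x y. a \<in> A \<Longrightarrow> b \<in> A \<Longrightarrow> a \<noteq> b \<Longrightarrow> x \<in> K a \<Longrightarrow> y \<in> K b \<Longrightarrow> \<delta> \<le> dist x y"
    using K_separated by blast
  \<comment> \<open>The size beyond which the bound of \<open>act_0_near_K\<close> is below \<delta>
    / 4; two such errors leave \<delta> / 2 of the separation \<delta>.\<close>
  define T where "T = 4 / (\<delta> * r)"
  have T: "T > 0" using r \<delta> by (simp add: T_def)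
  \<comment> \<open>The entry 1 covers empty words, where the factor equals 1.\<close>
  define \<epsilon> where "\<epsilon> = min 1 (min (1 / (2 * T)) (\<delta> / 2))"
  have \<epsilon>: "\<epsilon> > 0" using T \<delta> by (simp add: \<epsilon>_def)
  have "\<epsilon> \<le> cmod (1 - cnj (act (inv (val l)) 0) * act (val l') 0)"
    if ll: "reduced A (l @ l')" for l l'
  proof (cases "l = [] \<or> l' = []")
    case True
    then show ?thesis by (auto simp: \<epsilon>_def act_one)
  next
    case False
    define k where "k = inv_word l"
    have k: "reduced A k" "k \<noteq> []" "reduced A l'" "l' \<noteq> []" "fst (hd k) \<noteq> fst (hd l')"
      using ll False by (auto simp: reduced_append k_def hd_inv_word reduced_inv_word)
    have vk: "inv (val l) = val k" using ll by (simp add: k_def word_val_inv_word[OF letters(1)] reduced_append)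
    let ?x = "act (val k) 0" and ?y = "act (val l') 0"
    have xy: "?x \<in> cball 0 1" "?y \<in> cball 0 1" using act_0[of "val k"] act_0[of "val l'"] k by auto
    have small: "1 / (2 * T) \<le> 1 - cmod (act (val m) 0)" if m: "reduced A m" "sz (val m) \<le> T" for m
    proof -
      have "1 / (2 * T) \<le> 1 / (2 * sz (val m))"
        using m sz_ge_1[of "val m"] T by (intro divide_left_mono) auto
      also have "\<dots> \<le> 1 - cmod (act (val m) 0)" by (rule one_minus_cmod_psl_act_0) (use m in simp)
      finally show ?thesis .
    qed
    have large: "\<exists>y\<in>K (fst (hd m)). dist (act (val m) 0) y \<le> \<delta> / 4"
      if m: "reduced A m" "m \<noteq> []" "sz (val m) > T" for m
    proof -
      have "1 / (sz (val m) * r) \<le> 1 / (T * r)"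
        using m r T sz_ge_1[of "val m"] by (intro divide_left_mono mult_right_mono mult_pos_pos) auto
      also have "\<dots> = \<delta> / 4" using r \<delta> by (simp add: T_def)
      finally show ?thesis using near[OF m(1,2)] by force
    qed
    consider "sz (val k) \<le> T" | "sz (val l') \<le> T" | "sz (val k) > T" "sz (val l') > T" by linarith
    then have "min (1 / (2 * T)) (\<delta> / 2) \<le> cmod (1 - cnj ?x * ?y)"
    proof cases
      case 1
      show ?thesis using small[OF k(1) 1] one_minus_cnj_mult_bounds(1)[OF xy] by linarith
    next
      case 2
      show ?thesis using small[OF k(3) 2] one_minus_cnj_mult_bounds(2)[OF xy] by linarith
    next
      case 3
      obtain p q where p: "p \<in> K (fst (hd k))" "dist ?x p \<le> \<delta> / 4"
        and q: "q \<in> K (fst (hd l'))" "dist ?y q \<le> \<delta> / 4"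
        using large[OF k(1,2) 3(1)] large[OF k(3,4) 3(2)] by blast
      have "\<delta> \<le> dist p q" using sep hd_letter k p q by blast
      also have "\<dots> \<le> dist ?x p + dist ?x ?y + dist ?y q"
        using dist_triangle[of p q ?x] dist_triangle[of ?x q ?y] dist_commute[of p ?x] by linarith
      finally have "\<delta> / 2 \<le> dist ?x ?y" using p q by simp
      then show ?thesis using cmod_diff_le_one_minus_cnj_mult[OF xy] by (simp add: dist_norm)
    qed
    then show ?thesis unfolding vk by (simp add: \<epsilon>_def)
  qed
  with \<epsilon> show thesis by (rule that)
qed

text \<open>The logarithm of \<open>psl_size_mult\<close>, whose last factor lies between the square
  of the constant of \<open>act_0_separated\<close> and 4.\<close>

lemma ln_sz_append:
  obtains E where "\<And>l l'. reduced A (l @ l') \<Longrightarrow>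
    \<bar>ln (sz (val (l @ l'))) - (ln (sz (val l)) + ln (sz (val l')))\<bar> \<le> E"
proof -
  obtain \<epsilon> where e: "\<epsilon> > 0" "\<And>l l'. reduced A (l @ l') \<Longrightarrow>
    \<epsilon> \<le> cmod (1 - cnj (act (inv (val l)) 0) * act (val l') 0)" using act_0_separated by blast
  have "\<bar>ln (sz (val (l @ l'))) - (ln (sz (val l)) + ln (sz (val l')))\<bar> \<le> \<bar>ln (\<epsilon>\<^sup>2)\<bar> + \<bar>ln (2\<^sup>2)\<bar>"
    if ll: "reduced A (l @ l')" for l l'
  proof -
    define q where "q = cmod (1 - cnj (act (inv (val l)) 0) * act (val l') 0)"
    have r: "reduced A l" "reduced A l'" using ll by (auto simp: reduced_append)
    then have g: "val l \<in> carrier G" "val l' \<in> carrier G" by simp_all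
    have "act (inv (val l)) 0 \<in> cball 0 1" "act (val l') 0 \<in> cball 0 1"
      using act_0[OF inv_closed[OF g(1)]] act_0[OF g(2)] by auto
    then have q: "\<epsilon> \<le> q" "q \<le> 2" unfolding q_def using e(2)[OF ll] by (auto intro: one_minus_cnj_mult_bounds)
    have "\<epsilon>\<^sup>2 \<le> q\<^sup>2" by (rule power_mono[OF q(1) less_imp_le[OF e(1)]])
    moreover have "q\<^sup>2 \<le> 2\<^sup>2" by (rule power_mono[OF q(2)]) (use e q in linarith)
    ultimately have "ln (\<epsilon>\<^sup>2) \<le> ln (q\<^sup>2)" "ln (q\<^sup>2) \<le> ln (2\<^sup>2)" using e(1) q by (auto intro!: ln_mono)
    moreover have "sz (val (l @ l')) = sz (val l) * sz (val l') * q\<^sup>2"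
      using r by (simp add: val_append rho_mult psl_size_mult rho_inv q_def)
    then have "ln (sz (val (l @ l'))) = ln (sz (val l)) + ln (sz (val l')) + ln (q\<^sup>2)"
      using sz_ge_1[OF g(1)] sz_ge_1[OF g(2)] e(1) q by (simp add: ln_mult_pos)
    ultimately show ?thesis by linarith
  qed
  then show thesis by (rule that)
qed

text \<open>The image of a point of \<open>U\<close> reveals the first letter of a word. If two
  words with equal value had different first exponents, cancelling one power would make
  \<open>l\<close> equal in value to a word beginning with \<open>fst x\<close>, although
  \<open>l\<close> itself begins with another letter or is empty.\<close>

lemma val_inj: "inj_on val {l. reduced A l}"
proof -
  obtain \<zeta> where \<zeta>: "\<zeta> \<in> U" using U_two_points by blast
  have \<zeta>c: "\<zeta> \<in> cball 0 1" using \<zeta> by (auto simp: U_def)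
  have hd_eq: "fst (hd l) = fst (hd l')"
    if "reduced A l" "reduced A l'" "l \<noteq> []" "l' \<noteq> []" "val l = val l'" for l l'
    using act_word[OF that(1) \<zeta> that(3)] act_word[OF that(2) \<zeta> that(4)] that(5)
      K_disjoint[OF hd_letter[OF that(1,3)] hd_letter[OF that(2,4)]] by auto
  have ne: "val l \<noteq> \<one>" if "reduced A l" "l \<noteq> []" for l
    using act_word[OF that(1) \<zeta> that(2)] \<zeta> hd_letter[OF that] by (auto simp: act_one U_def)
  have "l = l'" if "reduced A l" "reduced A l'" "val l = val l'" for l l'
    using that
  proof (induction l arbitrary: l')
    case Nil
    then show ?case using ne[of l'] by (cases "l' = []") auto
  next
    case (Cons x l)
    have "l' \<noteq> []" using Cons.prems ne[of "x # l"] by auto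
    then obtain y k where l': "l' = y # k" by (cases l') auto
    have x: "x \<in> alphabet A" "reduced A l" "l = [] \<or> fst (hd l) \<noteq> fst x" "fst x \<in> carrier G" "fst x \<in> A"
      using Cons.prems(1) letters by (auto simp: reduced_Cons alphabet_def)
    have y: "y \<in> alphabet A" "reduced A k" "k = [] \<or> fst (hd k) \<noteq> fst y"
      using Cons.prems(2) unfolding l' by (auto simp: reduced_Cons)
    have fst_eq: "fst x = fst y" using hd_eq[OF Cons.prems(1,2)] Cons.prems(3) by (simp add: l')
    have vl: "val l = fst x [^] (snd y - snd x) \<otimes> val k"
    proof -
      have "val l = inv (fst x [^] snd x) \<otimes> (fst x [^] snd x \<otimes> val l)"
        using x by (simp add: m_assoc[symmetric])
      also have "fst x [^] snd x \<otimes> val l = fst x [^] snd y \<otimes> val k"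
        using Cons.prems(3) by (simp add: l' fst_eq)
      also have "inv (fst x [^] snd x) \<otimes> (fst x [^] snd y \<otimes> val k) = fst x [^] (snd y - snd x) \<otimes> val k"
        using x y by (simp add: m_assoc[symmetric] int_pow_neg[symmetric] int_pow_mult[symmetric])
      finally show ?thesis .
    qed
    show ?case
    proof (cases "snd x = snd y")
      case True
      then have "val l = val k" using vl y by simp
      then have "l = k" using Cons.IH x y by simp
      then show ?thesis using True fst_eq by (simp add: l' prod_eq_iff)
    next
      case False
      have r: "reduced A ((fst x, snd y - snd x) # k)"
        using False x y fst_eq by (auto simp: reduced_Cons alphabet_def)
      have "act (val l) \<zeta> \<in> K (fst x)" using act_word[OF r \<zeta>] vl by simp
      moreover have "act (val l) \<zeta> \<notin> K (fst x)" using act_word_notin[OF x(2) \<zeta> x(5,3)] by simp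
      ultimately show ?thesis by simp
    qed
  qed
  then show ?thesis by (auto intro: inj_onI)
qed

text \<open>The images of a point \<open>\<zeta>\<close> of \<open>U\<close> under elements of bounded size are uniformly separated,
  because an element \<open>\<noteq> \<one>\<close> moves \<open>\<zeta>\<close> into the sets \<open>K a\<close>.\<close>

lemma finite_sz_le: "finite {\<gamma> \<in> carrier G. sz \<gamma> \<le> R}"
proof -
  obtain \<zeta> where \<zeta>: "\<zeta> \<in> U" using U_two_points by blast
  have \<zeta>c: "\<zeta> \<in> cball 0 1" using \<zeta> by (auto simp: U_def)
  have "closed (\<Union>a\<in>A. K a)"
    using letters(2) K_compact by (intro closed_UN) (auto intro: compact_imp_closed)
  moreover have "\<zeta> \<notin> (\<Union>a\<in>A. K a)" using \<zeta> by (simp add: U_def)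
  ultimately have "\<exists>d>0. \<forall>x\<in>(\<Union>a\<in>A. K a). d \<le> dist \<zeta> x"
    by (rule separate_point_closed)
  then obtain \<delta> where \<delta>: "\<delta> > 0" "\<And>x. x \<in> (\<Union>a\<in>A. K a) \<Longrightarrow> \<delta> \<le> dist \<zeta> x"
    by (elim exE conjE) (rule that, assumption, erule (1) bspec)
  define M where "M = max R 1"
  have M: "M \<ge> 1" by (simp add: M_def)
  have far: "\<delta> / (4 * M) \<le> dist (act \<gamma> \<zeta>) (act \<eta> \<zeta>)"
    if "\<gamma> \<in> carrier G" "\<eta> \<in> carrier G" "sz \<eta> \<le> R" "\<gamma> \<noteq> \<eta>" for \<gamma> \<eta>
  proof -
    define x where "x = act \<gamma> \<zeta>"
    define y where "y = act \<eta> \<zeta>"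
    have xy: "x \<in> cball 0 1" "y \<in> cball 0 1"
      unfolding x_def y_def by (intro psl_act_cball_closed rho_closed that \<zeta>c)+
    have g: "\<rho> (inv \<eta>) \<in> carrier PSL2R" using that by simp
    have mem: "inv \<eta> \<otimes> \<gamma> \<in> carrier G" using that by simp
    have "inv \<eta> \<otimes> \<gamma> \<noteq> \<one>" using that by (metis inv_closed inv_equality inv_inv)
    moreover obtain l where l: "reduced A l" "val l = inv \<eta> \<otimes> \<gamma>"
      using generated[OF mem] by blast
    ultimately have "l \<noteq> []" by auto
    then have "act (inv \<eta> \<otimes> \<gamma>) \<zeta> \<in> (\<Union>a\<in>A. K a)"
      using act_word[OF l(1) \<zeta>] hd_letter[OF l(1)] l(2) by auto
    then have "\<delta> \<le> dist \<zeta> (act (inv \<eta> \<otimes> \<gamma>) \<zeta>)" by (rule \<delta>(2))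
    also have "act (inv \<eta> \<otimes> \<gamma>) \<zeta> = act (inv \<eta>) x"
      unfolding x_def by (rule act_mult) (use that \<zeta>c in auto)
    also have "\<zeta> = act (inv \<eta>) y"
      using act_mult[of "inv \<eta>" \<eta> \<zeta>] that \<zeta>c by (simp add: y_def act_one)
    finally have le: "\<delta> \<le> cmod (act (inv \<eta>) x - act (inv \<eta>) y)"
      by (simp add: dist_commute dist_norm)
    define s where "s = sz \<eta>"
    have s: "s \<ge> 1" "s \<le> M" using sz_ge_1 that by (auto simp: s_def M_def)
    define w where "w = act \<eta> 0"
    have w: "psl_act (inv\<^bsub>PSL2R\<^esub> (\<rho> (inv \<eta>))) 0 = w"
      using that by (simp add: w_def rho_inv[symmetric])
    have wc: "w \<in> cball 0 1" using act_0[of \<eta>] that by (auto simp: w_def)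
    have s1: "1 / (2 * s) \<le> 1 - cmod w"
      unfolding s_def w_def by (rule one_minus_cmod_psl_act_0) (use that in simp)
    have b: "1 / (2 * s) \<le> cmod (1 - cnj w * x)" "1 / (2 * s) \<le> cmod (1 - cnj w * y)"
      using one_minus_cnj_mult_bounds(1)[OF wc] xy s1 by (blast intro: order_trans)+
    have sp: "1 / (2 * s) > 0" using s by simp
    \<comment> \<open>The element \<open>inv \<eta>\<close> expands distances at most by the factor
      \<open>4 * s\<close>: its own size is \<open>s\<close>, and both remaining factors in the
      denominator are at least \<open>1 / (2 * s)\<close>.\<close>
    have "cmod (act (inv \<eta>) x - act (inv \<eta>) y) = cmod (x - y) / (s * cmod (1 - cnj w * x) * cmod (1 - cnj w * y))"
      using cmod_psl_act_diff[OF g xy] sz_inv[of \<eta>] that unfolding w by (simp add: s_def)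
    also have "\<dots> \<le> cmod (x - y) / (s * (1 / (2 * s)) * (1 / (2 * s)))"
      using s b sp less_le_trans[OF sp b(1)] less_le_trans[OF sp b(2)]
      by (intro divide_left_mono mult_mono mult_pos_pos) (auto simp del: norm_le_zero_iff)
    also have "\<dots> = 4 * s * cmod (x - y)" using s by simp
    also have "\<dots> \<le> 4 * M * cmod (x - y)" using s by (simp add: mult_right_mono)
    finally show ?thesis using le M by (simp add: x_def y_def dist_norm field_simps)
  qed
  let ?F = "{\<gamma> \<in> carrier G. sz \<gamma> \<le> R}"
  have pos: "\<delta> / (4 * M) > 0" using \<delta> M by simp
  have inj: "inj_on (\<lambda>\<gamma>. act \<gamma> \<zeta>) ?F"
  proof (rule inj_onI)
    fix \<gamma> \<eta> assume "\<gamma> \<in> ?F" "\<eta> \<in> ?F" "act \<gamma> \<zeta> = act \<eta> \<zeta>"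
    then show "\<gamma> = \<eta>" using far[of \<gamma> \<eta>] pos by fastforce
  qed
  have "uniform_discrete ((\<lambda>\<gamma>. act \<gamma> \<zeta>) ` ?F)"
    unfolding uniform_discrete_def
  proof (intro exI[of _ "\<delta> / (4 * M)"] conjI pos ballI impI)
    fix x y assume "x \<in> (\<lambda>\<gamma>. act \<gamma> \<zeta>) ` ?F" "y \<in> (\<lambda>\<gamma>. act \<gamma> \<zeta>) ` ?F" "dist x y < \<delta> / (4 * M)"
    then show "x = y" using far by (smt (verit) imageE mem_Collect_eq)
  qed
  moreover have "(\<lambda>\<gamma>. act \<gamma> \<zeta>) ` ?F \<subseteq> cball 0 1"
    using psl_act_cball_closed \<zeta>c by auto
  then have "bounded ((\<lambda>\<gamma>. act \<gamma> \<zeta>) ` ?F)" by (rule bounded_subset[OF bounded_cball])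
  ultimately have "finite ((\<lambda>\<gamma>. act \<gamma> \<zeta>) ` ?F)" by (simp add: uniform_discrete_finite_iff[symmetric])
  then show ?thesis using inj by (rule finite_imageD)
qed

text \<open>By \<open>finite_sz_le\<close> and \<open>val_inj\<close> only finitely many reduced
  words have logarithmic size at most |E| + 1. Every block of some length \<open>N\<close> thus
  contributes at least |E| + 1, of which |E| pays for the error of concatenation and 1 is
  gained.\<close>

lemma ln_sz_linear_growth:
  obtains c C where "c > 0" and "\<And>l. reduced A l \<Longrightarrow> c * real (length l) - C \<le> ln (sz (val l))"
proof -
  obtain E where E: "\<And>l l'. reduced A (l @ l') \<Longrightarrow>
      \<bar>ln (sz (val (l @ l'))) - (ln (sz (val l)) + ln (sz (val l')))\<bar> \<le> E"
    using ln_sz_append by blast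
  have app: "ln (sz (val l)) + ln (sz (val l')) - E \<le> ln (sz (val (l @ l')))" if "reduced A (l @ l')" for l l'
    using E[OF that] by linarith
  have nn: "0 \<le> ln (sz (val l))" if "reduced A l" for l using sz_ge_1[of "val l"] that by simp
  define B where "B = {l. reduced A l \<and> ln (sz (val l)) \<le> \<bar>E\<bar> + 1}"
  have "val ` B \<subseteq> {\<gamma> \<in> carrier G. sz \<gamma> \<le> exp (\<bar>E\<bar> + 1)}"
  proof -
    have "sz (val l) \<le> exp (\<bar>E\<bar> + 1)" if "l \<in> B" for l
      using that sz_ge_1[of "val l"] by (subst ln_le_cancel_iff[symmetric]) (auto simp: B_def)
    then show ?thesis by (auto simp: B_def)
  qed
  then have "finite (val ` B)" using finite_sz_le finite_subset by blast
  moreover have "inj_on val B" by (rule inj_on_subset[OF val_inj]) (auto simp: B_def)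
  ultimately have "finite B" by (rule finite_imageD)
  then obtain n where n: "\<And>l. l \<in> B \<Longrightarrow> length l < n"
    using finite_nat_set_iff_bounded[of "length ` B"] by auto
  define N where "N = Suc n"
  \<comment> \<open>The extra |E| in the claim is the reserve that the single block of the base case
    provides and each further block preserves.\<close>
  have step: "real k + \<bar>E\<bar> \<le> ln (sz (val l))" if "reduced A l" "k * N \<le> length l" "k \<ge> 1" for k l
    using that(3,1,2)
  proof (induction k arbitrary: l rule: dec_induct)
    case base
    then have "l \<notin> B" using n[of l] by (auto simp: N_def)
    then show ?case using base by (auto simp: B_def)
  next
    case (step k)
    have r: "reduced A (take N l @ drop N l)" using step.prems by simp
    then have r': "reduced A (take N l)" "reduced A (drop N l)" by (simp_all only: reduced_append)
    have "k * N \<le> length (drop N l)" using step.prems by simp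
    then have "real k + \<bar>E\<bar> \<le> ln (sz (val (drop N l)))" using step.IH r' by blast
    moreover have "take N l \<notin> B" using n[of "take N l"] step.prems by (auto simp: N_def)
    then have "\<bar>E\<bar> + 1 \<le> ln (sz (val (take N l)))" using r' by (auto simp: B_def)
    ultimately show ?case using app[OF r] by simp
  qed
  have "(1 / real N) * real (length l) - 1 \<le> ln (sz (val l))" if l: "reduced A l" for l
  proof -
    define k where "k = length l div N"
    have "real k \<le> ln (sz (val l))"
      using step[OF l, of k] nn[OF l] by (cases "k = 0") (auto simp: k_def)
    moreover have "length l \<le> (k + 1) * N"
      using dividend_less_times_div[of N "length l"] by (simp add: k_def N_def mult.commute)
    then have "real (length l) \<le> (real k + 1) * real N" by (metis of_nat_1 of_nat_add of_nat_le_iff of_nat_mult)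
    then have "real (length l) / real N \<le> real k + 1" by (simp add: N_def divide_le_eq)
    ultimately show ?thesis by simp
  qed
  moreover have "1 / real N > 0" by (simp add: N_def)
  ultimately show thesis using that by blast
qed

end

section \<open>Coded points and Birkhoff sums\<close>

lemma funpow_shift: "(shift ^^ n) w = (\<lambda>i. w (i + n))"
  by (induction n arbitrary: w) (auto simp: shift_def)

lemma shift_markov: "w \<in> markov_space A \<Longrightarrow> shift w \<in> markov_space A"
  by (auto simp: markov_space_def shift_def)

lemma funpow_shift_markov: "w \<in> markov_space A \<Longrightarrow> (shift ^^ n) w \<in> markov_space A"
  by (induction n) (auto simp: shift_markov)

lemma reduced_markov: "w \<in> markov_space A \<Longrightarrow> reduced A (map w [i..<j])"
  by (auto simp: reduced_def markov_space_def successively_conv_nth)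

context ping_pong
begin

abbreviation disp :: "'g \<Rightarrow> real" where
  "disp \<gamma> \<equiv> hdist 0 (act \<gamma> 0)"

lemma disp_bounds:
  "\<gamma> \<in> carrier G \<Longrightarrow> ln (sz \<gamma>) \<le> disp \<gamma>" "\<gamma> \<in> carrier G \<Longrightarrow> disp \<gamma> \<le> ln (sz \<gamma>) + ln 4"
  by (simp_all add: hdist_0_psl_act)

lemma prefix_prod_val: "w \<in> markov_space A \<Longrightarrow> prefix_prod G w k = val (map w [0..<k])"
proof (induction k)
  case (Suc k)
  have r: "reduced A (map w [0..<k])" "reduced A [w k]"
    using reduced_markov[OF Suc.prems, of 0 k] reduced_markov[OF Suc.prems, of k "Suc k"] by auto
  have "fst (w k) [^] snd (w k) \<in> carrier G"
    using Suc.prems by (intro letter_pow_closed[OF letters(1)]) (auto simp: markov_space_def)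
  then show ?case using Suc val_append[OF r] by simp
qed simp

lemma prefix_prod_closed: "w \<in> markov_space A \<Longrightarrow> prefix_prod G w k \<in> carrier G"
  by (simp add: prefix_prod_val reduced_markov)

lemma prefix_prod_add:
  assumes w: "w \<in> markov_space A"
  shows "prefix_prod G w (k + n) = prefix_prod G w n \<otimes> prefix_prod G ((shift ^^ n) w) k"
proof -
  have "map w [0..<k + n] = map w [0..<n] @ map ((shift ^^ n) w) [0..<k]"
    by (rule nth_equalityI) (auto simp: nth_append funpow_shift)
  then show ?thesis
    using w by (simp add: prefix_prod_val funpow_shift_markov val_append reduced_markov)
qed

lemma sz_prefix_prod_at_top:
  assumes w: "w \<in> markov_space A"
  shows "filterlim (\<lambda>k. sz (prefix_prod G w k)) at_top sequentially"
proof -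
  obtain c C where c: "c > 0" and lin: "\<And>l. reduced A l \<Longrightarrow> c * real (length l) - C \<le> ln (sz (val l))"
    using ln_sz_linear_growth by blast
  have ge: "c * real k - C \<le> sz (prefix_prod G w k)" for k
  proof -
    have "c * real k - C \<le> ln (sz (prefix_prod G w k))"
      using lin[of "map w [0..<k]"] w by (simp add: prefix_prod_val reduced_markov)
    also have "\<dots> \<le> sz (prefix_prod G w k)"
      using sz_ge_1[OF prefix_prod_closed[OF w, of k]] ln_le_minus_one[of "sz (prefix_prod G w k)"] by simp
    finally show ?thesis .
  qed
  show ?thesis
    unfolding filterlim_at_top
  proof
    fix Z :: real
    show "\<forall>\<^sub>F k in sequentially. Z \<le> sz (prefix_prod G w k)"
    proof (rule eventually_sequentiallyI)
      fix k assume "nat \<lceil>(Z + C) / c\<rceil> \<le> k"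
      then have "(Z + C) / c \<le> real k" by linarith
      then have "Z + C \<le> c * real k" using c by (simp add: divide_le_eq mult.commute)
      then show "Z \<le> sz (prefix_prod G w k)" using ge[of k] by simp
    qed
  qed
qed

text \<open>A later orbit point and the \<open>k\<close>-th one are images of some \<open>v\<close>
  and of 0 under the same prefix, and \<open>v\<close> is separated from the pole of that prefix by
  \<open>act_0_separated\<close>. Their distance is therefore at most the reciprocal of the prefix
  size up to a constant, uniformly in the later index.\<close>

lemma coded_point_limit:
  assumes w: "w \<in> markov_space A"
  shows "(\<lambda>k. act (prefix_prod G w k) 0) \<longlonglongrightarrow> coded_point G \<rho> w"
    and "coded_point G \<rho> w \<in> sphere 0 1"
proof -
  let ?P = "prefix_prod G w"
  define x where "x = (\<lambda>k. act (?P k) 0)"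
  obtain \<epsilon> where e: "\<epsilon> > 0" "\<And>l l'. reduced A (l @ l') \<Longrightarrow>
    \<epsilon> \<le> cmod (1 - cnj (act (inv (val l)) 0) * act (val l') 0)" using act_0_separated by blast
  have top: "filterlim (\<lambda>k. sz (?P k)) at_top sequentially" by (rule sz_prefix_prod_at_top[OF w])
  have dist_le: "dist (x (j + k)) (x k) \<le> 1 / (sz (?P k) * \<epsilon>)" for j k
  proof -
    let ?w = "(shift ^^ k) w"
    have w': "?w \<in> markov_space A" by (rule funpow_shift_markov[OF w])
    define v where "v = act (prefix_prod G ?w j) 0"
    have v: "v \<in> ball 0 1" unfolding v_def by (rule act_0) (rule prefix_prod_closed[OF w'])
    have P: "?P k \<in> carrier G" by (rule prefix_prod_closed[OF w])
    have xv: "x (j + k) = act (?P k) v"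
      unfolding x_def v_def prefix_prod_add[OF w] using P prefix_prod_closed[OF w'] by (simp add: act_mult)
    have "map w [0..<j + k] = map w [0..<k] @ map ?w [0..<j]"
      by (rule nth_equalityI) (auto simp: nth_append funpow_shift)
    then have "reduced A (map w [0..<k] @ map ?w [0..<j])" using reduced_markov[OF w, of 0 "j + k"] by simp
    from e(2)[OF this] have sep: "\<epsilon> \<le> cmod (1 - cnj (psl_act (inv\<^bsub>PSL2R\<^esub> (\<rho> (?P k))) 0) * v)"
      unfolding v_def rho_inv[OF P, symmetric] by (simp add: prefix_prod_val w w')
    have "dist (x (j + k)) (x k) = cmod (act (?P k) 0 - act (?P k) v)"
      unfolding xv by (simp add: x_def dist_norm norm_minus_commute)
    also have "\<dots> = cmod v / (sz (?P k) * cmod (1 - cnj (psl_act (inv\<^bsub>PSL2R\<^esub> (\<rho> (?P k))) 0) * v))"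
      using cmod_psl_act_diff[OF rho_closed[OF P], of 0 v] v by simp
    also have "\<dots> \<le> 1 / (sz (?P k) * \<epsilon>)"
      using v sep e(1) sz_ge_1[OF P] by (intro frac_le mult_left_mono mult_pos_pos) auto
    finally show ?thesis .
  qed
  have "Cauchy x"
    unfolding Cauchy_altdef2
  proof (intro allI impI)
    fix d :: real assume d: "d > 0"
    have "\<forall>\<^sub>F k in sequentially. 1 / (d * \<epsilon>) < sz (?P k)"
      using top by (simp add: filterlim_at_top_dense)
    then obtain k where k: "1 / (d * \<epsilon>) < sz (?P k)" by (auto simp: eventually_sequentially)
    then have "1 / (sz (?P k) * \<epsilon>) < d"
      using d e(1) sz_ge_1[OF prefix_prod_closed[OF w, of k]] by (simp add: field_simps)
    then have "dist (x n) (x k) < d" if "n \<ge> k" for n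
      using dist_le[of "n - k" k] that by simp
    then show "\<exists>N. \<forall>n\<ge>N. dist (x n) (x N) < d" by blast
  qed
  then have "convergent x" by (rule Cauchy_convergent)
  then show lim: "(\<lambda>k. act (?P k) 0) \<longlonglongrightarrow> coded_point G \<rho> w"
    unfolding coded_point_def x_def by (simp add: convergent_LIMSEQ_iff)
  have "(\<lambda>k. 1 / sz (?P k)) \<longlonglongrightarrow> 0"
    using tendsto_inverse_0_at_top[OF top] by (simp add: inverse_eq_divide)
  then have "(\<lambda>k. 1 - 1 / sz (?P k)) \<longlonglongrightarrow> 1 - 0" by (intro tendsto_intros)
  moreover have "1 - 1 / sz (?P k) = (cmod (act (?P k) 0))\<^sup>2" for k by (simp add: psl_size_def)
  ultimately have "(\<lambda>k. (cmod (act (?P k) 0))\<^sup>2) \<longlonglongrightarrow> 1" by simp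
  moreover have "(\<lambda>k. (cmod (act (?P k) 0))\<^sup>2) \<longlonglongrightarrow> (cmod (coded_point G \<rho> w))\<^sup>2"
    by (intro tendsto_intros lim)
  ultimately have "(cmod (coded_point G \<rho> w))\<^sup>2 = 1" using LIMSEQ_unique by blast
  then show "coded_point G \<rho> w \<in> sphere 0 1" by (simp add: power2_eq_1_iff) (smt (verit) norm_ge_zero)
qed

text \<open>The Busemann function is evaluated along the orbit points converging to the coded point.
  Cancelling the first symbol by invariance turns the second distance into a displacement of the
  shifted sequence, whose prefix is one symbol shorter.\<close>

lemma geometric_potential_limit:
  assumes w: "w \<in> markov_space A"
  shows "(\<lambda>k. disp (prefix_prod G w (Suc k)) - disp (prefix_prod G (shift w) k))
    \<longlonglongrightarrow> geometric_potential G \<rho> w"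
proof -
  let ?P = "prefix_prod G w" and ?\<xi> = "coded_point G \<rho> w"
  define g where "g = fst (w 0) [^] snd (w 0)"
  have g: "g \<in> carrier G"
    unfolding g_def using w by (intro letter_pow_closed[OF letters(1)]) (auto simp: markov_space_def)
  have sw: "shift w \<in> markov_space A" by (rule shift_markov[OF w])
  have ball: "act (?P k) 0 \<in> ball 0 1" for k by (rule act_0[OF prefix_prod_closed[OF w]])
  have "act (?P k) 0 \<noteq> ?\<xi>" for k using ball[of k] coded_point_limit(2)[OF w] by auto
  then have "filterlim (\<lambda>k. act (?P k) 0) (at ?\<xi> within ball 0 1) sequentially"
    unfolding filterlim_at using coded_point_limit(1)[OF w] ball by (simp del: mem_ball)
  from filterlim_compose[OF busemann_tendsto[OF coded_point_limit(2)[OF w] _ act_0[OF g]] this]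
  have "(\<lambda>k. disp (?P k) - hdist (act g 0) (act (?P k) 0)) \<longlonglongrightarrow> geometric_potential G \<rho> w"
    by (simp add: geometric_potential_def g_def)
  then have "(\<lambda>k. disp (?P (Suc k)) - hdist (act g 0) (act (?P (Suc k)) 0)) \<longlonglongrightarrow> geometric_potential G \<rho> w"
    by (rule LIMSEQ_Suc)
  moreover have "hdist (act g 0) (act (?P (Suc k)) 0) = disp (prefix_prod G (shift w) k)" for k
  proof -
    have "?P (Suc k) = g \<otimes> prefix_prod G (shift w) k"
      using prefix_prod_add[OF w, of k 1] g by (simp add: g_def)
    then have "act (?P (Suc k)) 0 = act g (act (prefix_prod G (shift w) k) 0)"
      using g prefix_prod_closed[OF sw] by (simp add: act_mult)
    then show ?thesis
      using hdist_psl_act[OF rho_closed[OF g], of 0] act_0[OF prefix_prod_closed[OF sw]]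
      by (simp del: prefix_prod.simps)
  qed
  ultimately show ?thesis by simp
qed

text \<open>The differences in \<open>geometric_potential_limit\<close> telescope along the orbit of
  the shift.\<close>

lemma birkhoff_sum_limit:
  assumes w: "w \<in> markov_space A"
  shows "(\<lambda>k. disp (prefix_prod G w (k + n)) - disp (prefix_prod G ((shift ^^ n) w) k))
    \<longlonglongrightarrow> birkhoff_sum (geometric_potential G \<rho>) n w"
proof (induction n)
  case 0
  then show ?case by (simp add: birkhoff_sum_def)
next
  case (Suc n)
  have "(\<lambda>k. (disp (prefix_prod G w (Suc k + n)) - disp (prefix_prod G ((shift ^^ n) w) (Suc k)))
      + (disp (prefix_prod G ((shift ^^ n) w) (Suc k)) - disp (prefix_prod G (shift ((shift ^^ n) w)) k)))
    \<longlonglongrightarrow> birkhoff_sum (geometric_potential G \<rho>) n w + geometric_potential G \<rho> ((shift ^^ n) w)"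
    by (intro tendsto_add LIMSEQ_Suc[OF Suc] geometric_potential_limit funpow_shift_markov w)
  then show ?case by (simp add: birkhoff_sum_def del: prefix_prod.simps)
qed

text \<open>A prefix of length \<open>k + n\<close> is the word of the first \<open>n\<close>
  symbols followed by a prefix of the shifted sequence. By quasi-additivity the difference in
  \<open>birkhoff_sum_limit\<close> is the size of that word up to an error independent of
  \<open>k\<close>; ln 4 accounts for replacing displacements by logarithmic sizes.\<close>

lemma birkhoff_sum_approx:
  obtains C where "\<And>w n. w \<in> markov_space A \<Longrightarrow>
    \<bar>birkhoff_sum (geometric_potential G \<rho>) n w - ln (sz (val (map w [0..<n])))\<bar> \<le> C"
proof -
  obtain E where E: "\<And>l l'. reduced A (l @ l') \<Longrightarrow>
      \<bar>ln (sz (val (l @ l'))) - (ln (sz (val l)) + ln (sz (val l')))\<bar> \<le> E"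
    using ln_sz_append by blast
  have "\<bar>birkhoff_sum (geometric_potential G \<rho>) n w - ln (sz (val (map w [0..<n])))\<bar>
      \<le> E + ln 4" if w: "w \<in> markov_space A" for w n
  proof -
    let ?D = "\<lambda>k. disp (prefix_prod G w (k + n)) - disp (prefix_prod G ((shift ^^ n) w) k)"
    let ?L = "ln (sz (val (map w [0..<n])))" and ?C = "E + ln 4 :: real"
    have w': "(shift ^^ n) w \<in> markov_space A" by (rule funpow_shift_markov[OF w])
    have "?L - ?C \<le> ?D k \<and> ?D k \<le> ?L + ?C" for k
    proof -
      define l' where "l' = map ((shift ^^ n) w) [0..<k]"
      have split: "map w [0..<k + n] = map w [0..<n] @ l'"
        unfolding l'_def by (rule nth_equalityI) (auto simp: nth_append funpow_shift)
      have r: "reduced A (map w [0..<n] @ l')" "reduced A l'"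
        using reduced_markov[OF w, of 0 "k + n"] reduced_markov[OF w', of 0 k] split
        by (simp_all add: l'_def)
      show ?thesis
        using E[OF r(1)] disp_bounds[OF val_closed[OF r(1)]] disp_bounds[OF val_closed[OF r(2)]]
        unfolding prefix_prod_val[OF w] prefix_prod_val[OF w'] split l'_def[symmetric] by linarith
    qed
    then have "?L - ?C \<le> birkhoff_sum (geometric_potential G \<rho>) n w"
      "birkhoff_sum (geometric_potential G \<rho>) n w \<le> ?L + ?C"
      using birkhoff_sum_limit[OF w] by (blast intro: LIMSEQ_le_const LIMSEQ_le_const2)+
    then show ?thesis by linarith
  qed
  then show thesis by (rule that)
qed

end

section \<open>Word growth at zero pressure\<close>

lemma finite_summable_ge:
  fixes f :: "'x \<Rightarrow> real"
  assumes f: "f summable_on S" "\<And>x. x \<in> S \<Longrightarrow> f x \<ge> 0" and d: "d > 0"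
  shows "finite {x \<in> S. d \<le> f x}"
proof (rule ccontr)
  assume inf: "infinite {x \<in> S. d \<le> f x}"
  obtain n where n: "infsum f S < real n * d" using d reals_Archimedean3 by blast
  obtain F where F: "F \<subseteq> {x \<in> S. d \<le> f x}" "card F = n" "finite F"
    using infinite_arbitrarily_large[OF inf] by blast
  have "real n * d \<le> sum f F" using sum_bounded_below[of F d f] F by auto
  also have "\<dots> \<le> infsum f S" using F f by (intro finite_sum_le_infsum) auto
  finally show False using n by simp
qed

text \<open>Renewal argument: the recursion \<open>N(R) \<ge> (\<Sum>x\<in>F. N(R - d x))\<close> propagates an exponential lower bound.\<close>

lemma free_monoid_growth:
  fixes d :: "'x \<Rightarrow> real"
  assumes F: "finite F" and d: "\<And>x. x \<in> F \<Longrightarrow> d x \<ge> 1" and \<sigma>: "\<sigma> \<ge> 0"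
    and large: "(\<Sum>x\<in>F. exp (- \<sigma> * d x)) \<ge> 1"
  defines "T \<equiv> \<lambda>R. {xs. set xs \<subseteq> F \<and> sum_list (map d xs) \<le> R}"
  obtains b where "\<And>R. R \<ge> 0 \<Longrightarrow> exp (\<sigma> * R - b) \<le> real (card (T R))" and "\<And>R. finite (T R)"
proof -
  \<comment> \<open>The largest step. As long as \<open>R\<close> is at least \<open>dm\<close>,
    every \<open>R - d x\<close> is nonnegative and the recursion applies; below \<open>dm\<close>
    the empty list suffices.\<close>
  define dm where "dm = Max (insert 1 (d ` F))"
  have dm: "1 \<le> dm" "\<And>x. x \<in> F \<Longrightarrow> d x \<le> dm" using F by (simp_all add: dm_def)
  have len: "real (length xs) \<le> sum_list (map d xs)" if "set xs \<subseteq> F" for xs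
    using that d by (induction xs) (auto simp: add_mono)
  have fin: "finite (T R)" for R
  proof (rule finite_subset)
    show "T R \<subseteq> {xs. set xs \<subseteq> F \<and> length xs \<le> nat \<lfloor>R\<rfloor>}"
      using len by (fastforce simp: T_def le_nat_floor)
    show "finite {xs. set xs \<subseteq> F \<and> length xs \<le> nat \<lfloor>R\<rfloor>}" by (rule finite_lists_length_le[OF F])
  qed
  \<comment> \<open>Induction on an integer bound for the real \<open>R\<close>: steps of size at
    least 1 lower this bound.\<close>
  have main: "0 \<le> R \<Longrightarrow> R < real k \<Longrightarrow> exp (\<sigma> * R - \<sigma> * dm) \<le> real (card (T R))" for k R
  proof (induction k arbitrary: R)
    case (Suc k)
    show ?case
    proof (cases "R < dm")
      case True
      have "[] \<in> T R" using Suc.prems by (simp add: T_def)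
      then have "1 \<le> card (T R)" using fin[of R] by (metis One_nat_def Suc_leI card_gt_0_iff empty_iff)
      moreover have "exp (\<sigma> * R - \<sigma> * dm) \<le> 1" using True \<sigma> by (simp add: mult_left_mono)
      ultimately show ?thesis by linarith
    next
      case False
      have le: "exp (\<sigma> * (R - d x) - \<sigma> * dm) \<le> real (card (T (R - d x)))" if "x \<in> F" for x
        using Suc.IH[of "R - d x"] Suc.prems d[OF that] dm(2)[OF that] False by simp
      have sub: "(\<Union>x\<in>F. (#) x ` T (R - d x)) \<subseteq> T R" by (auto simp: T_def)
      have "exp (\<sigma> * R - \<sigma> * dm) * 1 \<le> exp (\<sigma> * R - \<sigma> * dm) * (\<Sum>x\<in>F. exp (- \<sigma> * d x))"
        using large by (intro mult_left_mono) auto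
      also have "\<dots> = (\<Sum>x\<in>F. exp (\<sigma> * (R - d x) - \<sigma> * dm))"
        by (simp add: sum_distrib_left exp_add[symmetric] algebra_simps)
      also have "\<dots> \<le> (\<Sum>x\<in>F. real (card (T (R - d x))))" by (rule sum_mono) (rule le)
      also have "\<dots> = (\<Sum>x\<in>F. real (card ((#) x ` T (R - d x))))" by (simp add: card_image)
      also have "\<dots> = real (card (\<Union>x\<in>F. (#) x ` T (R - d x)))"
        using F fin by (subst card_UN_disjoint) auto
      also have "\<dots> \<le> real (card (T R))" using card_mono[OF fin sub] by simp
      finally show ?thesis by simp
    qed
  qed simp
  have "exp (\<sigma> * R - \<sigma> * dm) \<le> real (card (T R))" if "R \<ge> 0" for R
    using main[OF that] reals_Archimedean2[of R] by blast
  then show thesis using fin that by blast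
qed

text \<open>\<open>D\<close> will be the weighted sum of the two logarithmic sizes. The words in
  \<open>upper\<close> and \<open>lower\<close> are those whose periodic repetition is admissible
  and begins with \<open>s\<close>. Quantifying over finite sets \<open>F\<close> allows real sums
  without presupposing convergence over the infinite alphabet, and \<open>K\<close> absorbs the
  bounded difference between Birkhoff sums and \<open>D\<close>.\<close>

locale zero_pressure =
  fixes A :: "'g set" and D :: "('g \<times> int) list \<Rightarrow> real" and c C E K t :: real and s :: "'g \<times> int"
  assumes A: "finite A" "card A \<ge> 3" and s: "s \<in> alphabet A"
    and c: "c > 0" and growth: "\<And>l. reduced A l \<Longrightarrow> c * real (length l) - C \<le> D l"
    and quasi_add: "\<And>l l'. reduced A (l @ l') \<Longrightarrow> \<bar>D (l @ l') - (D l + D l')\<bar> \<le> E"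
    and K: "K > 0"
    and upper: "\<And>\<epsilon>. \<epsilon> > 0 \<Longrightarrow> \<forall>\<^sub>F n in sequentially. \<forall>F. finite F \<and>
      F \<subseteq> {l. reduced A l \<and> length l = n \<and> hd l = s \<and> fst (last l) \<noteq> fst s} \<longrightarrow>
      (\<Sum>l\<in>F. exp (- t * D l)) \<le> K * exp (\<epsilon> * real n)"
    and lower: "\<And>\<epsilon>. \<epsilon> > 0 \<Longrightarrow> \<forall>\<^sub>F n in sequentially. \<exists>F. finite F \<and>
      F \<subseteq> {l. reduced A l \<and> length l = n \<and> hd l = s \<and> fst (last l) \<noteq> fst s} \<and>
      exp (- \<epsilon> * real n) \<le> K * (\<Sum>l\<in>F. exp (- t * D l))"
begin

definition X :: "nat \<Rightarrow> ('g \<times> int) list set" where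
  "X n = {l. reduced A l \<and> length l = n \<and> hd l = s \<and> fst (last l) \<noteq> fst s}"

definition Words :: "nat \<Rightarrow> ('g \<times> int) list set" where
  "Words n = {l. reduced A l \<and> length l = n}"

lemma E_nonneg: "E \<ge> 0"
  using quasi_add[of "[]" "[]"] by (simp add: order_trans[OF abs_ge_zero])

lemma third_letter: "\<exists>u\<in>A. u \<noteq> x \<and> u \<noteq> y"
proof (rule ccontr)
  assume "\<not> ?thesis"
  then have "A \<subseteq> {x, y}" by blast
  then have "card A \<le> card {x, y}" by (intro card_mono) auto
  also have "\<dots> \<le> 2" by (simp add: card_insert_if)
  finally show False using A by simp
qed

text \<open>Makes any reduced word start with \<open>s\<close> and close up cyclically. The letter
  \<open>u\<close> separates \<open>s\<close> from \<open>l\<close>, and \<open>v\<close> must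
  differ both from its predecessor and from \<open>s\<close>, which is where three letters are
  required. The fixed exponent 1 leaves only finitely many added symbols, so that the change of
  \<open>D\<close> is bounded.\<close>

definition pad :: "('g \<times> int) list \<Rightarrow> ('g \<times> int) list" where
  "pad l = (let u = SOME u. u \<in> A \<and> u \<noteq> fst s \<and> (l \<noteq> [] \<longrightarrow> u \<noteq> fst (hd l));
                v = SOME v. v \<in> A \<and> v \<noteq> fst s \<and> v \<noteq> fst (last ((u, 1) # l))
            in s # (u, 1) # l @ [(v, 1)])"

lemma pad_eq:
  obtains u v where "u \<in> A" "u \<noteq> fst s" "l \<noteq> [] \<longrightarrow> u \<noteq> fst (hd l)"
    "v \<in> A" "v \<noteq> fst s" "v \<noteq> fst (last ((u, 1) # l))" "pad l = s # (u, 1) # l @ [(v, 1)]"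
proof -
  define u where "u = (SOME u. u \<in> A \<and> u \<noteq> fst s \<and> (l \<noteq> [] \<longrightarrow> u \<noteq> fst (hd l)))"
  define v where "v = (SOME v. v \<in> A \<and> v \<noteq> fst s \<and> v \<noteq> fst (last ((u, 1::int) # l)))"
  have "\<exists>u. u \<in> A \<and> u \<noteq> fst s \<and> (l \<noteq> [] \<longrightarrow> u \<noteq> fst (hd l))"
    using third_letter[of "fst s" "fst (hd l)"] by blast
  note u = someI_ex[OF this, folded u_def]
  have "\<exists>v. v \<in> A \<and> v \<noteq> fst s \<and> v \<noteq> fst (last ((u, 1::int) # l))"
    using third_letter[of "fst s" "fst (last ((u, 1::int) # l))"] by blast
  note v = someI_ex[OF this, folded v_def]
  have "pad l = s # (u, 1) # l @ [(v, 1)]" unfolding pad_def Let_def u_def v_def by (rule refl)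
  with u v show thesis by (intro that) auto
qed

lemma pad_in_X: assumes "l \<in> Words n" shows "pad l \<in> X (n + 3)"
proof -
  obtain u v where uv: "u \<in> A" "u \<noteq> fst s" "l \<noteq> [] \<longrightarrow> u \<noteq> fst (hd l)"
    "v \<in> A" "v \<noteq> fst s" "v \<noteq> fst (last ((u, 1) # l))" "pad l = s # (u, 1) # l @ [(v, 1)]"
    using pad_eq .
  then show ?thesis
    using assms s by (auto simp: Words_def X_def reduced_Cons reduced_append alphabet_def split: if_splits)
qed

lemma pad_inj: "inj pad"
proof (rule injI)
  fix l l' assume "pad l = pad l'"
  moreover obtain u v where "pad l = s # (u, 1) # l @ [(v, 1)]" using pad_eq[of l] by metis
  moreover obtain u' v' where "pad l' = s # (u', 1) # l' @ [(v', 1)]" using pad_eq[of l'] by metis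
  ultimately show "l = l'" by simp
qed

lemma D_pad: obtains m where "m \<ge> 0" "\<And>l. reduced A l \<Longrightarrow> \<bar>D (pad l) - D l\<bar> \<le> m"
proof -
  define M where "M = (\<Sum>u\<in>A. \<bar>D [(u, 1)]\<bar>)"
  have M: "\<bar>D [(u, 1)]\<bar> \<le> M" if "u \<in> A" for u
    unfolding M_def using A(1) that by (intro member_le_sum) auto
  have M0: "M \<ge> 0" unfolding M_def by (rule sum_nonneg) simp
  have "\<bar>D (pad l) - D l\<bar> \<le> \<bar>D [s]\<bar> + 2 * M + 3 * E" if l: "reduced A l" for l
  proof -
    obtain u v where uv: "u \<in> A" "v \<in> A" "pad l = s # (u, 1) # l @ [(v, 1)]"
      using pad_eq[of l] by metis
    have "reduced A (pad l)" using pad_in_X[of l "length l"] l by (simp add: Words_def X_def)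
    then have r: "reduced A ([s] @ ((u, 1) # l @ [(v, 1)]))" "reduced A ([(u, 1)] @ (l @ [(v, 1)]))"
      "reduced A (l @ [(v, 1)])"
      unfolding uv by (auto simp: reduced_Cons)
    from quasi_add[OF r(1)] quasi_add[OF r(2)] quasi_add[OF r(3)] M[OF uv(1)] M[OF uv(2)]
    show ?thesis unfolding uv(3) by (simp add: abs_le_iff) linarith
  qed
  then show thesis using M0 E_nonneg by (intro that[of "\<bar>D [s]\<bar> + 2 * M + 3 * E"]) auto
qed

text \<open>Padding is injective and changes \<open>D\<close> by at most \<open>m\<close>. The sign
  of \<open>t\<close> is not yet known at this stage, hence |t| in the constant.\<close>

lemma sum_Words_le_sum_X:
  obtains k where "k > 0" "\<And>n F. finite F \<Longrightarrow> F \<subseteq> Words n \<Longrightarrow>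
    \<exists>F'. finite F' \<and> F' \<subseteq> X (n + 3) \<and> (\<Sum>l\<in>F. exp (- t * D l)) \<le> k * (\<Sum>l\<in>F'. exp (- t * D l))"
proof -
  obtain m where m: "m \<ge> 0" "\<And>l. reduced A l \<Longrightarrow> \<bar>D (pad l) - D l\<bar> \<le> m" using D_pad by blast
  have "\<exists>F'. finite F' \<and> F' \<subseteq> X (n + 3) \<and>
      (\<Sum>l\<in>F. exp (- t * D l)) \<le> exp (\<bar>t\<bar> * m) * (\<Sum>l\<in>F'. exp (- t * D l))"
    if F: "finite F" "F \<subseteq> Words n" for n F
  proof (intro exI[of _ "pad ` F"] conjI)
    have "exp (- t * D l) \<le> exp (\<bar>t\<bar> * m) * exp (- t * D (pad l))" if "l \<in> F" for l
    proof -
      have "\<bar>D (pad l) - D l\<bar> \<le> m" using m(2) that F by (auto simp: Words_def)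
      then have "\<bar>t * (D (pad l) - D l)\<bar> \<le> \<bar>t\<bar> * m" by (simp add: abs_mult mult_left_mono)
      then show ?thesis by (simp add: exp_add[symmetric] algebra_simps abs_le_iff)
    qed
    then have "(\<Sum>l\<in>F. exp (- t * D l)) \<le> (\<Sum>l\<in>F. exp (\<bar>t\<bar> * m) * exp (- t * D (pad l)))"
      by (rule sum_mono)
    also have "\<dots> = exp (\<bar>t\<bar> * m) * (\<Sum>l\<in>pad ` F. exp (- t * D l))"
      using pad_inj by (subst sum.reindex) (auto simp: sum_distrib_left intro: inj_on_subset)
    finally show "(\<Sum>l\<in>F. exp (- t * D l)) \<le> exp (\<bar>t\<bar> * m) * (\<Sum>l\<in>pad ` F. exp (- t * D l))" .
  qed (use F pad_in_X in auto)
  then show thesis by (intro that[of "exp (\<bar>t\<bar> * m)"]) auto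
qed

text \<open>The pressure bound holds for large lengths only. The last claim bounds every single
  length, which the convergence proof needs for the finitely many short ones.\<close>

lemma sum_Words_bounded:
  obtains k where "k > 0"
    "\<And>\<epsilon>. \<epsilon> > 0 \<Longrightarrow> \<forall>\<^sub>F n in sequentially. \<forall>F. finite F \<and> F \<subseteq> Words n \<longrightarrow> (\<Sum>l\<in>F. exp (- t * D l)) \<le> k * exp (\<epsilon> * real n)"
    "\<And>n. \<exists>b. \<forall>F. finite F \<and> F \<subseteq> Words n \<longrightarrow> (\<Sum>l\<in>F. exp (- t * D l)) \<le> b"
proof -
  obtain k where k: "k > 0" "\<And>n F. finite F \<Longrightarrow> F \<subseteq> Words n \<Longrightarrow>
    \<exists>F'. finite F' \<and> F' \<subseteq> X (n + 3) \<and> (\<Sum>l\<in>F. exp (- t * D l)) \<le> k * (\<Sum>l\<in>F'. exp (- t * D l))"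
    using sum_Words_le_sum_X by blast
  have ev: "\<forall>\<^sub>F n in sequentially. \<forall>F. finite F \<and> F \<subseteq> Words n \<longrightarrow>
      (\<Sum>l\<in>F. exp (- t * D l)) \<le> k * K * exp (\<epsilon> * 3) * exp (\<epsilon> * real n)" if "\<epsilon> > 0" for \<epsilon>
  proof -
    have "\<forall>\<^sub>F n in sequentially. \<forall>F. finite F \<and> F \<subseteq> X (n + 3) \<longrightarrow>
        (\<Sum>l\<in>F. exp (- t * D l)) \<le> K * exp (\<epsilon> * real (n + 3))"
      using sequentially_offset[OF upper[OF that], of 3] unfolding X_def .
    then show ?thesis
    proof eventually_elim
      case (elim n)
      show ?case
      proof (intro allI impI)
        fix F assume F: "finite F \<and> F \<subseteq> Words n"
        obtain F' where F': "finite F'" "F' \<subseteq> X (n + 3)"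
          "(\<Sum>l\<in>F. exp (- t * D l)) \<le> k * (\<Sum>l\<in>F'. exp (- t * D l))"
          using k(2)[OF conjunct1[OF F] conjunct2[OF F]] by (elim exE conjE)
        have "k * (\<Sum>l\<in>F'. exp (- t * D l)) \<le> k * (K * exp (\<epsilon> * real (n + 3)))"
          using elim F' k(1) by (intro mult_left_mono) auto
        also have "\<dots> = k * K * exp (\<epsilon> * 3) * exp (\<epsilon> * real n)"
          by (simp add: exp_add[symmetric] algebra_simps)
        finally show "(\<Sum>l\<in>F. exp (- t * D l)) \<le> k * K * exp (\<epsilon> * 3) * exp (\<epsilon> * real n)"
          using F' by linarith
      qed
    qed
  qed
  have bdd: "\<exists>b. \<forall>F. finite F \<and> F \<subseteq> Words n \<longrightarrow> (\<Sum>l\<in>F. exp (- t * D l)) \<le> b" for n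
  proof -
    obtain N where N: "\<And>n. n \<ge> N \<Longrightarrow> \<forall>F. finite F \<and> F \<subseteq> Words n \<longrightarrow>
      (\<Sum>l\<in>F. exp (- t * D l)) \<le> k * K * exp (1 * 3) * exp (1 * real n)"
      using ev[of 1] unfolding eventually_sequentially by auto
    show ?thesis
    \<comment> \<open>Padding sends \<open>Words n\<close> into \<open>Words (n + 3)\<close>, so a
      bound at a large length descends in steps of three.\<close>
    proof (induction "N - n" arbitrary: n rule: less_induct)
      case less
      show ?case
      proof (cases "n \<ge> N")
        case True
        then show ?thesis using N by blast
      next
        case False
        then have "N - (n + 3) < N - n" by simp
        from less[OF this] obtain b where
          b: "\<forall>F. finite F \<and> F \<subseteq> Words (n + 3) \<longrightarrow> (\<Sum>l\<in>F. exp (- t * D l)) \<le> b"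
          by blast
        have "(\<Sum>l\<in>F. exp (- t * D l)) \<le> k * b" if F: "finite F" "F \<subseteq> Words n" for F
        proof -
          obtain F' where F': "finite F'" "F' \<subseteq> X (n + 3)"
            "(\<Sum>l\<in>F. exp (- t * D l)) \<le> k * (\<Sum>l\<in>F'. exp (- t * D l))" using k(2)[OF F] by blast
          have "F' \<subseteq> Words (n + 3)" using F' by (auto simp: X_def Words_def)
          then have "k * (\<Sum>l\<in>F'. exp (- t * D l)) \<le> k * b" using b F' k(1) by (intro mult_left_mono) auto
          then show ?thesis using F' by linarith
        qed
        then show ?thesis by blast
      qed
    qed
  qed
  have kK: "k * K > 0" using k(1) K by simp
  \<comment> \<open>Applying \<open>ev\<close> with half the rate absorbs the factor caused by three
    extra symbols once \<open>n\<close> is at least 3, so the constant does not depend on the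
    rate.\<close>
  have ev': "\<forall>\<^sub>F n in sequentially. \<forall>F. finite F \<and> F \<subseteq> Words n \<longrightarrow>
      (\<Sum>l\<in>F. exp (- t * D l)) \<le> k * K * exp (\<epsilon> * real n)" if e: "\<epsilon> > 0" for \<epsilon>
  proof -
    have "\<epsilon> / 2 > 0" using e by simp
    from ev[OF this] eventually_ge_at_top[of 3] show ?thesis
    proof eventually_elim
      case (elim n)
      have "\<epsilon> / 2 * 3 \<le> \<epsilon> / 2 * real n" using elim(2) e by (intro mult_left_mono) auto
      then have "\<epsilon> / 2 * 3 + \<epsilon> / 2 * real n \<le> \<epsilon> * real n" by simp
      then have "k * K * exp (\<epsilon> / 2 * 3 + \<epsilon> / 2 * real n) \<le> k * K * exp (\<epsilon> * real n)"
        using kK by (intro mult_left_mono) auto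
      then have le: "k * K * exp (\<epsilon> / 2 * 3) * exp (\<epsilon> / 2 * real n) \<le> k * K * exp (\<epsilon> * real n)"
        by (simp only: exp_add mult.assoc)
      show ?case using elim(1) order_trans[OF _ le] by blast
    qed
  qed
  show thesis by (rule that[OF kK ev' bdd])
qed

lemma summable_words:
  assumes st: "\<sigma> > t"
  shows "(\<lambda>l. exp (- \<sigma> * D l)) summable_on {l. reduced A l}"
proof -
  obtain k where k: "k > 0"
    "\<And>\<epsilon>. \<epsilon> > 0 \<Longrightarrow> \<forall>\<^sub>F n in sequentially. \<forall>F. finite F \<and> F \<subseteq> Words n \<longrightarrow> (\<Sum>l\<in>F. exp (- t * D l)) \<le> k * exp (\<epsilon> * real n)"
    "\<And>n. \<exists>b. \<forall>F. finite F \<and> F \<subseteq> Words n \<longrightarrow> (\<Sum>l\<in>F. exp (- t * D l)) \<le> b"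
    using sum_Words_bounded by blast
  obtain b where b: "\<And>n F. finite F \<Longrightarrow> F \<subseteq> Words n \<Longrightarrow> (\<Sum>l\<in>F. exp (- t * D l)) \<le> b n"
    using k(3) by metis
  \<comment> \<open>Linear growth of \<open>D\<close> yields decay of rate
    \<open>(\<sigma> - t) * c\<close> in the length. Half of it beats the subexponential growth, and
    the other half remains as a geometric series.\<close>
  define \<epsilon> where "\<epsilon> = (\<sigma> - t) * c / 2"
  have e: "\<epsilon> > 0" using st c by (simp add: \<epsilon>_def)
  obtain N where N: "\<And>n F. n \<ge> N \<Longrightarrow> finite F \<Longrightarrow> F \<subseteq> Words n \<Longrightarrow>
      (\<Sum>l\<in>F. exp (- t * D l)) \<le> k * exp (\<epsilon> * real n)"
    using k(2)[OF e] unfolding eventually_sequentially by blast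
  define b' where "b' = (\<lambda>n. if n \<ge> N then k * exp (\<epsilon> * real n) else b n)"
  have b': "(\<Sum>l\<in>F. exp (- t * D l)) \<le> b' n" if "finite F" "F \<subseteq> Words n" for n F
    using N b that by (simp add: b'_def)
  have b'0: "b' n \<ge> 0" for n using b'[of "{}" n] by simp
  define g where "g = (\<lambda>n. exp (- (\<sigma> - t) * (c * real n - C)) * b' n)"
  have "summable (\<lambda>n. k * exp ((\<sigma> - t) * C) * exp (- \<epsilon>) ^ n)"
    using e by (intro summable_mult summable_geometric) simp
  moreover have "\<forall>\<^sub>F n in sequentially. k * exp ((\<sigma> - t) * C) * exp (- \<epsilon>) ^ n = g n"
    by (rule eventually_sequentiallyI[of N])
      (simp add: g_def b'_def \<epsilon>_def exp_of_nat_mult[symmetric] exp_add[symmetric] field_simps)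
  ultimately have sg: "summable g" by (rule summable_cong[THEN iffD1, rotated])
  have g: "(\<Sum>l\<in>F. exp (- \<sigma> * D l)) \<le> g n" if F: "finite F" "F \<subseteq> Words n" for n F
  proof -
    have "exp (- \<sigma> * D l) \<le> exp (- (\<sigma> - t) * (c * real n - C)) * exp (- t * D l)" if "l \<in> F" for l
    proof -
      have "c * real n - C \<le> D l" using growth[of l] that F by (auto simp: Words_def)
      then have "(\<sigma> - t) * (c * real n - C) \<le> (\<sigma> - t) * D l" using st by (intro mult_left_mono) auto
      then show ?thesis by (simp add: exp_add[symmetric] algebra_simps)
    qed
    then have "(\<Sum>l\<in>F. exp (- \<sigma> * D l)) \<le> (\<Sum>l\<in>F. exp (- (\<sigma> - t) * (c * real n - C)) * exp (- t * D l))"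
      by (rule sum_mono)
    also have "\<dots> = exp (- (\<sigma> - t) * (c * real n - C)) * (\<Sum>l\<in>F. exp (- t * D l))"
      by (simp add: sum_distrib_left)
    also have "\<dots> \<le> g n" unfolding g_def using b'[OF F] by (intro mult_left_mono) auto
    finally show ?thesis .
  qed
  have g0: "g n \<ge> 0" for n using b'0 by (simp add: g_def)
  have "sum (\<lambda>l. exp (- \<sigma> * D l)) F \<le> suminf g" if F: "F \<subseteq> {l. reduced A l}" "finite F" for F
  proof -
    have "sum (\<lambda>l. exp (- \<sigma> * D l)) F = (\<Sum>n\<in>length ` F. \<Sum>l\<in>{l \<in> F. length l = n}. exp (- \<sigma> * D l))"
      using F by (intro sum.group[symmetric]) auto
    also have "\<dots> \<le> (\<Sum>n\<in>length ` F. g n)"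
      using F by (intro sum_mono g) (auto simp: Words_def)
    also have "\<dots> \<le> suminf g" using F sg g0 by (intro sum_le_suminf) auto
    finally show ?thesis .
  qed
  then show ?thesis
    by (intro nonneg_bdd_above_summable_on) (auto simp: bdd_above_def)
qed

text \<open>Lowering the exponent from \<open>t\<close> to \<open>\<sigma>\<close> multiplies each
  term by an exponential in the length, which overcomes the subexponential decay in
  \<open>lower\<close>. Common length and \<open>D l \<ge> 1\<close> prepare for counting in a free
  semigroup.\<close>

lemma large_sums:
  assumes st: "\<sigma> < t"
  obtains n F where "finite F" "F \<subseteq> X n" "n > 0" "\<And>l. l \<in> F \<Longrightarrow> D l \<ge> 1" "M \<le> (\<Sum>l\<in>F. exp (- \<sigma> * D l))"
proof -
  define \<epsilon> where "\<epsilon> = (t - \<sigma>) * c / 2"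
  have e: "\<epsilon> > 0" using st c by (simp add: \<epsilon>_def)
  \<comment> \<open>Once \<open>\<epsilon> * real n\<close> reaches \<open>B\<close>, the exponent
    \<open>\<epsilon> * real n - (t - \<sigma>) * C\<close> is at least
    \<open>\<bar>M\<bar> * K\<close>, and so is its exponential.\<close>
  define B where "B = \<bar>M\<bar> * K + (t - \<sigma>) * \<bar>C\<bar>"
  have "\<forall>\<^sub>F n in sequentially. (\<exists>F. finite F \<and> F \<subseteq> X n \<and> exp (- \<epsilon> * real n) \<le> K * (\<Sum>l\<in>F. exp (- t * D l)))
      \<and> nat \<lceil>(C + 1) / c\<rceil> \<le> n \<and> nat \<lceil>B / \<epsilon>\<rceil> \<le> n \<and> 1 \<le> n"
    using lower[OF e] unfolding X_def by (intro eventually_conj eventually_ge_at_top)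
  then obtain n F where n: "nat \<lceil>(C + 1) / c\<rceil> \<le> n" "nat \<lceil>B / \<epsilon>\<rceil> \<le> n" "1 \<le> n"
    and F: "finite F" "F \<subseteq> X n" "exp (- \<epsilon> * real n) \<le> K * (\<Sum>l\<in>F. exp (- t * D l))"
    by (auto simp: eventually_sequentially)
  have "(C + 1) / c \<le> real n" "B / \<epsilon> \<le> real n" using n by linarith+
  then have n': "C + 1 \<le> c * real n" "B \<le> \<epsilon> * real n"
    using c e by (simp_all add: divide_le_eq mult.commute)
  have DF: "c * real n - C \<le> D l" if "l \<in> F" for l using growth[of l] that F by (auto simp: X_def)
  have le: "exp ((t - \<sigma>) * (c * real n - C)) * exp (- t * D l) \<le> exp (- \<sigma> * D l)" if "l \<in> F" for l
  proof -
    have "(t - \<sigma>) * (c * real n - C) \<le> (t - \<sigma>) * D l" using DF[OF that] st by (intro mult_left_mono) auto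
    then show ?thesis by (simp add: exp_add[symmetric] algebra_simps)
  qed
  have "\<bar>M\<bar> * K \<le> \<epsilon> * real n - (t - \<sigma>) * \<bar>C\<bar>" using n'(2) by (simp add: B_def)
  also have "\<dots> \<le> \<epsilon> * real n - (t - \<sigma>) * C" using st by (simp add: mult_left_mono)
  also have "\<dots> \<le> exp (\<epsilon> * real n - (t - \<sigma>) * C)"
    using exp_ge_add_one_self[of "\<epsilon> * real n - (t - \<sigma>) * C"] by linarith
  also have "\<dots> = exp ((t - \<sigma>) * (c * real n - C)) * exp (- \<epsilon> * real n)"
    by (simp add: \<epsilon>_def exp_add[symmetric] field_simps)
  also have "\<dots> \<le> exp ((t - \<sigma>) * (c * real n - C)) * (K * (\<Sum>l\<in>F. exp (- t * D l)))"
    using F(3) by (intro mult_left_mono) auto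
  also have "\<dots> = (\<Sum>l\<in>F. exp ((t - \<sigma>) * (c * real n - C)) * exp (- t * D l)) * K"
    by (simp add: sum_distrib_left sum_distrib_right mult_ac)
  also have "\<dots> \<le> (\<Sum>l\<in>F. exp (- \<sigma> * D l)) * K" using K by (intro mult_right_mono sum_mono le) auto
  finally have "\<bar>M\<bar> \<le> (\<Sum>l\<in>F. exp (- \<sigma> * D l))" using K by simp
  then have "M \<le> (\<Sum>l\<in>F. exp (- \<sigma> * D l))" by linarith
  moreover have "D l \<ge> 1" if "l \<in> F" for l using DF[OF that] n'(1) by linarith
  ultimately show thesis using F n that by simp
qed

lemma not_summable_words:
  assumes "\<sigma> < t"
  shows "\<not> (\<lambda>l. exp (- \<sigma> * D l)) summable_on {l. reduced A l}"
proof
  assume sum: "(\<lambda>l. exp (- \<sigma> * D l)) summable_on {l. reduced A l}"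
  obtain n F where F: "finite F" "F \<subseteq> X n"
    "infsum (\<lambda>l. exp (- \<sigma> * D l)) {l. reduced A l} + 1 \<le> (\<Sum>l\<in>F. exp (- \<sigma> * D l))"
    using large_sums[OF assms] by metis
  have "(\<Sum>l\<in>F. exp (- \<sigma> * D l)) \<le> infsum (\<lambda>l. exp (- \<sigma> * D l)) {l. reduced A l}"
    using F sum by (intro finite_sum_le_infsum) (auto simp: X_def)
  with F show False by linarith
qed

section \<open>Counting words\<close>

lemma finite_words_le: "finite {l. reduced A l \<and> D l \<le> R}"
proof -
  \<comment> \<open>An exponent that is both positive and above \<open>t\<close>, so that each
    counted word adds a fixed amount to a convergent series.\<close>
  define \<sigma> where "\<sigma> = \<bar>t\<bar> + 1"
  have "(\<lambda>l. exp (- \<sigma> * D l)) summable_on {l. reduced A l}" by (rule summable_words) (simp add: \<sigma>_def)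
  from finite_summable_ge[OF this, of "exp (- \<sigma> * R)"]
  have "finite {l \<in> {l. reduced A l}. exp (- \<sigma> * R) \<le> exp (- \<sigma> * D l)}" by simp
  then show ?thesis by (rule rev_finite_subset) (auto simp: \<sigma>_def intro!: mult_left_mono_neg)
qed

text \<open>Words of \<open>X n\<close> begin with \<open>s\<close> and end in a letter other than
  that of \<open>s\<close>, so they can be concatenated without restriction. Each concatenation
  costs one error \<open>E\<close>, charged to its block.\<close>

lemma reduced_concat:
  assumes "set ls \<subseteq> X n" "n > 0"
  shows "reduced A (concat ls) \<and> (ls \<noteq> [] \<longrightarrow> concat ls \<noteq> [] \<and> hd (concat ls) = s)
    \<and> D (concat ls) \<le> D [] + sum_list (map (\<lambda>l. D l + E) ls)"
  using assms
proof (induction ls)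
  case (Cons l ls)
  have l: "reduced A l" "l \<noteq> []" "hd l = s" "fst (last l) \<noteq> fst s" using Cons.prems by (auto simp: X_def)
  have IH: "reduced A (concat ls)" "ls \<noteq> [] \<longrightarrow> concat ls \<noteq> [] \<and> hd (concat ls) = s"
    "D (concat ls) \<le> D [] + sum_list (map (\<lambda>l. D l + E) ls)" using Cons by auto
  have "reduced A (l @ concat ls)" using l IH by (cases "ls = []") (auto simp: reduced_append)
  then show ?case using quasi_add[of l "concat ls"] l IH by (simp add: abs_le_iff)
qed simp

text \<open>\<open>free_monoid_growth\<close> is applied with step lengths \<open>D l + E\<close>,
  since each block also pays for its concatenation. This is why the sum in \<open>large_sums\<close>
  is asked to reach \<open>exp (\<sigma> * E)\<close> rather than 1.\<close>

lemma count_words_ge: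
  assumes st: "\<sigma> < t" "\<sigma> \<ge> 0"
  obtains b where "\<And>R. R \<ge> b \<Longrightarrow> exp (\<sigma> * R - b) \<le> real (card {l. reduced A l \<and> D l \<le> R})"
proof -
  obtain n F where F: "finite F" "F \<subseteq> X n" "n > 0" "\<And>l. l \<in> F \<Longrightarrow> D l \<ge> 1"
    "exp (\<sigma> * E) \<le> (\<Sum>l\<in>F. exp (- \<sigma> * D l))"
    using large_sums[OF st(1)] by metis
  define d where "d = (\<lambda>l. D l + E)"
  define T where "T = (\<lambda>R. {ls. set ls \<subseteq> F \<and> sum_list (map d ls) \<le> R})"
  have "1 = exp (- \<sigma> * E) * exp (\<sigma> * E)" by (simp add: exp_add[symmetric])
  also have "\<dots> \<le> exp (- \<sigma> * E) * (\<Sum>l\<in>F. exp (- \<sigma> * D l))" using F(5) by (intro mult_left_mono) auto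
  also have "\<dots> = (\<Sum>l\<in>F. exp (- \<sigma> * d l))"
    by (simp add: d_def sum_distrib_left exp_add[symmetric] algebra_simps)
  finally have one: "1 \<le> (\<Sum>l\<in>F. exp (- \<sigma> * d l))" .
  have d1: "\<And>l. l \<in> F \<Longrightarrow> d l \<ge> 1" using F(4) E_nonneg by (fastforce simp: d_def)
  obtain b where b: "\<And>R. R \<ge> 0 \<Longrightarrow> exp (\<sigma> * R - b) \<le> real (card (T R))" "\<And>R. finite (T R)"
    using free_monoid_growth[OF F(1) d1 st(2) one] unfolding T_def by blast
  \<comment> \<open>All blocks have the same positive length, so a concatenation determines its
    blocks.\<close>
  have inj: "inj_on concat {ls. set ls \<subseteq> F}"
  proof (rule inj_onI)
    fix ls ls' assume ls: "ls \<in> {ls. set ls \<subseteq> F}" "ls' \<in> {ls. set ls \<subseteq> F}" and eq: "concat ls = concat ls'"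
    have len: "length l = n" if "l \<in> F" for l using that F by (auto simp: X_def)
    have cl: "length (concat ks) = n * length ks" if "set ks \<subseteq> F" for ks
      using that len by (induction ks) auto
    have "n * length ls = n * length ls'" using cl[of ls] cl[of ls'] ls eq by (metis mem_Collect_eq)
    then have "length ls = length ls'" by (metis F(3) less_irrefl mult_cancel1)
    moreover have "\<forall>(x, y)\<in>set (zip ls ls'). length x = length y"
    proof (rule ballI, rule case_prodI2)
      fix z x y assume "z \<in> set (zip ls ls')" "z = (x, y)"
      then have "x \<in> F" "y \<in> F" using set_zip_leftD[of x y ls ls'] set_zip_rightD[of x y ls ls'] ls by auto
      then show "length x = length y" by (simp add: len)
    qed
    ultimately show "ls = ls'" using eq concat_injective by blast
  qed
  have "exp (\<sigma> * R - (\<bar>D []\<bar> + \<bar>b\<bar> + \<sigma> * \<bar>D []\<bar>)) \<le> real (card {l. reduced A l \<and> D l \<le> R})"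
    if R: "R \<ge> \<bar>D []\<bar> + \<bar>b\<bar> + \<sigma> * \<bar>D []\<bar>" for R
  proof -
    have "0 \<le> \<sigma> * \<bar>D []\<bar>" using st by simp
    then have R0: "R - D [] \<ge> 0" using R by linarith
    have "\<sigma> * D [] \<le> \<sigma> * \<bar>D []\<bar>" using st by (intro mult_left_mono) auto
    then have "exp (\<sigma> * R - (\<bar>D []\<bar> + \<bar>b\<bar> + \<sigma> * \<bar>D []\<bar>)) \<le> exp (\<sigma> * (R - D []) - b)"
      by (simp add: algebra_simps)
    also have "\<dots> \<le> real (card (T (R - D [])))" by (rule b(1)[OF R0])
    also have "card (T (R - D [])) = card (concat ` T (R - D []))"
      by (rule card_image[symmetric], rule inj_on_subset[OF inj]) (auto simp: T_def)
    also have "\<dots> \<le> card {l. reduced A l \<and> D l \<le> R}"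
    proof (rule card_mono[OF finite_words_le], rule image_subsetI)
      fix ls assume "ls \<in> T (R - D [])"
      then have "set ls \<subseteq> X n" "sum_list (map (\<lambda>l. D l + E) ls) \<le> R - D []"
        using F by (auto simp: T_def d_def)
      then show "concat ls \<in> {l. reduced A l \<and> D l \<le> R}" using reduced_concat[OF _ F(3), of ls] by auto
    qed
    finally show ?thesis by simp
  qed
  then show thesis by (rule that)
qed

text \<open>For negative \<open>t\<close> the exponent 0 would be summable, leaving only finitely
  many reduced words; but padding produces arbitrarily long ones.\<close>

lemma t_nonneg: "t \<ge> 0"
proof (rule ccontr)
  assume "\<not> t \<ge> 0"
  then have t: "t < 0" by simp
  have "(\<lambda>l. exp (- 0 * D l)) summable_on {l. reduced A l}" by (rule summable_words) (use t in simp)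
  then have "finite {l \<in> {l. reduced A l}. 1 \<le> exp (- 0 * D l)}" by (rule finite_summable_ge) auto
  then have fin: "finite {l. reduced A l}" by simp
  then have "finite (length ` {l. reduced A l})" by simp
  moreover have "\<exists>l. reduced A l \<and> k \<le> length l" for k
  proof (induction k)
    case (Suc k)
    then obtain l where l: "reduced A l" "k \<le> length l" by blast
    have "pad l \<in> X (length l + 3)" using l by (intro pad_in_X) (simp add: Words_def)
    then show ?case using l by (intro exI[of _ "pad l"]) (auto simp: X_def)
  qed (use reduced_Nil in blast)
  ultimately show False
    by (metis (mono_tags, lifting) finite_nat_set_iff_bounded image_eqI linorder_not_le mem_Collect_eq)
qed

end

section \<open>Functions at bounded distance from the word size\<close>

context zero_pressure
begin

text \<open>\<open>W\<close> will be the weighted distance from \<open>x\<close> to the translates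
  of \<open>y\<close>. A bounded perturbation of \<open>D\<close> affects neither summability nor
  the exponential growth rate, which gives independence of the base points.\<close>

context
  fixes W :: "('g \<times> int) list \<Rightarrow> real" and C' :: real
  assumes W: "\<And>l. reduced A l \<Longrightarrow> \<bar>W l - D l\<bar> \<le> C'"
begin

lemma summable_words_iff:
  "(\<lambda>l. exp (- \<sigma> * W l)) summable_on {l. reduced A l} \<longleftrightarrow> (\<lambda>l. exp (- \<sigma> * D l)) summable_on {l. reduced A l}"
proof -
  have imp: "(\<lambda>l. exp (- \<sigma> * V l)) summable_on {l. reduced A l}"
    if V: "\<And>l. reduced A l \<Longrightarrow> \<bar>V l - V' l\<bar> \<le> C'" and sum: "(\<lambda>l. exp (- \<sigma> * V' l)) summable_on {l. reduced A l}"
    for V V' :: "('g \<times> int) list \<Rightarrow> real"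
  proof (rule summable_on_comparison_test)
    show "(\<lambda>l. exp (\<bar>\<sigma>\<bar> * C') * exp (- \<sigma> * V' l)) summable_on {l. reduced A l}"
      by (rule summable_on_cmult_right[OF sum])
    fix l assume "l \<in> {l. reduced A l}"
    then have "\<bar>\<sigma> * (V l - V' l)\<bar> \<le> \<bar>\<sigma>\<bar> * C'" using V by (simp add: abs_mult mult_left_mono)
    then show "exp (- \<sigma> * V l) \<le> exp (\<bar>\<sigma>\<bar> * C') * exp (- \<sigma> * V' l)"
      by (simp add: exp_add[symmetric] algebra_simps abs_le_iff)
  qed simp
  have W': "\<bar>D l - W l\<bar> \<le> C'" if "reduced A l" for l using W[OF that] by linarith
  show ?thesis using imp[of W D, OF W] imp[of D W, OF W'] by blast
qed

lemma critical_exponent_words: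
  "(INF \<sigma>\<in>{\<sigma>. (\<lambda>l. exp (- \<sigma> * W l)) summable_on {l. reduced A l}}. ereal \<sigma>) = ereal t"
proof (rule antisym)
  show "ereal t \<le> (INF \<sigma>\<in>{\<sigma>. (\<lambda>l. exp (- \<sigma> * W l)) summable_on {l. reduced A l}}. ereal \<sigma>)"
  proof (rule INF_greatest)
    fix \<sigma> assume "\<sigma> \<in> {\<sigma>. (\<lambda>l. exp (- \<sigma> * W l)) summable_on {l. reduced A l}}"
    then have "(\<lambda>l. exp (- \<sigma> * D l)) summable_on {l. reduced A l}"
      using summable_words_iff by blast
    then have "\<not> \<sigma> < t" using not_summable_words by blast
    then show "ereal t \<le> ereal \<sigma>" by simp
  qed
  show "(INF \<sigma>\<in>{\<sigma>. (\<lambda>l. exp (- \<sigma> * W l)) summable_on {l. reduced A l}}. ereal \<sigma>) \<le> ereal t"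
  proof (rule ereal_le_epsilon2)
    fix e :: real assume "0 < e"
    then have "(\<lambda>l. exp (- (t + e) * W l)) summable_on {l. reduced A l}"
      unfolding summable_words_iff by (intro summable_words) simp
    then have "(INF \<sigma>\<in>{\<sigma>. (\<lambda>l. exp (- \<sigma> * W l)) summable_on {l. reduced A l}}. ereal \<sigma>) \<le> ereal (t + e)"
      by (intro INF_lower CollectI)
    then show "(INF \<sigma>\<in>{\<sigma>. (\<lambda>l. exp (- \<sigma> * W l)) summable_on {l. reduced A l}}. ereal \<sigma>) \<le> ereal t + ereal e"
      by simp
  qed
qed

lemma finite_words_W_le: "finite {l. reduced A l \<and> W l \<le> R}"
  by (rule finite_subset[OF _ finite_words_le[of "R + C'"]]) (use W in fastforce)

lemma ln_count_words_tendsto: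
  "((\<lambda>R. ln (real (card {l. reduced A l \<and> W l \<le> R})) / R) \<longlongrightarrow> t) at_top"
proof -
  define N where "N = (\<lambda>R. card {l. reduced A l \<and> W l \<le> R})"
  have "((\<lambda>R. ln (real (N R)) / R) \<longlongrightarrow> t) at_top"
  proof (rule order_tendstoI)
    fix x assume x: "x < t"
    show "\<forall>\<^sub>F R in at_top. x < ln (real (N R)) / R"
    \<comment> \<open>\<open>count_words_ge\<close> asks for a nonnegative exponent. For negative
      \<open>x\<close> it is enough that the logarithm of a count is nonnegative, which includes
      count 0 because \<open>ln 0 = 0\<close>.\<close>
    proof (cases "x < 0")
      case True
      have "x < ln (real (N R)) / R" if "R > 0" for R :: real
      proof -
        have "0 \<le> ln (real (N R))" by (cases "N R = 0") auto
        then have "0 \<le> ln (real (N R)) / R" using that by simp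
        then show ?thesis using True by linarith
      qed
      then show ?thesis using eventually_gt_at_top[of 0] by (rule eventually_mono[rotated])
    next
      case False
      define \<sigma> where "\<sigma> = (x + t) / 2"
      have \<sigma>: "\<sigma> < t" "\<sigma> \<ge> 0" "x < \<sigma>" using x False by (auto simp: \<sigma>_def)
      obtain b where b: "\<And>R. R \<ge> b \<Longrightarrow> exp (\<sigma> * R - b) \<le> real (card {l. reduced A l \<and> D l \<le> R})"
        using count_words_ge[OF \<sigma>(1,2)] by blast
      \<comment> \<open>Solves \<open>\<sigma> * (R - C') - b = x * R\<close> for \<open>R\<close>;
        beyond it the lower bound with exponent \<open>\<sigma>\<close> exceeds
        \<open>x * R\<close>.\<close>
      define R0 where "R0 = (\<sigma> * C' + b) / (\<sigma> - x)"
      have "x < ln (real (N R)) / R" if R: "R > 0" "R \<ge> b + C'" "R > R0" for R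
      proof -
        have "exp (\<sigma> * (R - C') - b) \<le> real (card {l. reduced A l \<and> D l \<le> R - C'})" using b R by simp
        also have "card {l. reduced A l \<and> D l \<le> R - C'} \<le> N R"
          unfolding N_def by (rule card_mono[OF finite_words_W_le]) (use W in fastforce)
        finally have "exp (\<sigma> * (R - C') - b) \<le> real (N R)" by simp
        moreover from this have "real (N R) > 0" by (rule less_le_trans[OF exp_gt_zero])
        ultimately have "\<sigma> * (R - C') - b \<le> ln (real (N R))" by (simp add: ln_ge_iff)
        moreover have "\<sigma> * C' + b < R * (\<sigma> - x)"
          using R(3) \<sigma> by (simp add: R0_def divide_less_eq)
        ultimately have "x * R < ln (real (N R))" by (simp add: algebra_simps)
        then show ?thesis using R(1) by (simp add: less_divide_eq)
      qed
      then show ?thesis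
        using eventually_conj[OF eventually_gt_at_top[of 0] eventually_conj[OF eventually_ge_at_top[of "b + C'"]
          eventually_gt_at_top[of R0]]] by (rule eventually_mono[rotated]) auto
    qed
  next
    fix x assume x: "t < x"
    define \<sigma> where "\<sigma> = (x + t) / 2"
    have \<sigma>: "\<sigma> > t" "\<sigma> > 0" "\<sigma> < x" using x t_nonneg by (auto simp: \<sigma>_def)
    have sum: "(\<lambda>l. exp (- \<sigma> * W l)) summable_on {l. reduced A l}"
      unfolding summable_words_iff by (rule summable_words[OF \<sigma>(1)])
    define Z where "Z = infsum (\<lambda>l. exp (- \<sigma> * W l)) {l. reduced A l} + 1"
    have Z: "Z > 0"
      using infsum_nonneg[of "{l. reduced A l}" "\<lambda>l. exp (- \<sigma> * W l)"] by (simp add: Z_def)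
    define R0 where "R0 = ln Z / (x - \<sigma>)"
    have "ln (real (N R)) / R < x" if R: "R > 0" "R > R0" for R
    proof (cases "N R = 0")
      case True
      then show ?thesis using \<sigma> by simp
    next
      case False
      \<comment> \<open>A Chebyshev estimate: \<open>\<sigma>\<close> is positive, thanks to
        \<open>t_nonneg\<close>, so each counted word contributes at least
        \<open>exp (- \<sigma> * R)\<close> to the convergent series.\<close>
      have "real (N R) * exp (- \<sigma> * R) \<le> (\<Sum>l\<in>{l. reduced A l \<and> W l \<le> R}. exp (- \<sigma> * W l))"
        unfolding N_def using \<sigma> by (intro sum_bounded_below) auto
      also have "\<dots> \<le> infsum (\<lambda>l. exp (- \<sigma> * W l)) {l. reduced A l}"
        by (intro finite_sum_le_infsum sum finite_words_W_le) auto
      also have "\<dots> \<le> Z" by (simp add: Z_def)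
      finally have "real (N R) \<le> Z * exp (\<sigma> * R)" by (simp add: exp_minus field_simps)
      then have "ln (real (N R)) \<le> ln (Z * exp (\<sigma> * R))" using False by (intro ln_mono) auto
      also have "\<dots> = ln Z + \<sigma> * R" using Z by (simp add: ln_mult_pos)
      also have "\<dots> < x * R" using R \<sigma> by (simp add: R0_def divide_less_eq algebra_simps)
      finally show ?thesis using R(1) by (simp add: divide_less_eq)
    qed
    then show "\<forall>\<^sub>F R in at_top. ln (real (N R)) / R < x"
      using eventually_conj[OF eventually_gt_at_top[of 0] eventually_gt_at_top[of R0]]
      by (rule eventually_mono[rotated]) auto
  qed
  then show ?thesis by (simp add: N_def)
qed

end

end

section \<open>Periodic sequences and pressure\<close>

text \<open>The condition on the last letter is admissibility of the transition from position n - 1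
  to position n, where the sequence starts over with \<open>s\<close>.\<close>

lemma periodic_words_bij:
  assumes n: "n > 0"
  shows "bij_betw (\<lambda>w. map w [0..<n]) {w \<in> markov_space A. (shift ^^ n) w = w \<and> w 0 = s}
    {l. reduced A l \<and> length l = n \<and> hd l = s \<and> fst (last l) \<noteq> fst s}"
    (is "bij_betw ?\<phi> ?P ?X")
proof (rule bij_betw_byWitness[where f' = "\<lambda>l i. l ! (i mod n)"])
  show "\<forall>w\<in>?P. (\<lambda>i. ?\<phi> w ! (i mod n)) = w"
  proof
    fix w assume "w \<in> ?P"
    then have "(shift ^^ n) w = w" by simp
    then have "(\<lambda>i. w (i + n)) = w" by (simp only: funpow_shift)
    from fun_cong[OF this] have per: "w (i + n) = w i" for i .
    have "w (i mod n + k * n) = w (i mod n)" for i k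
      by (induction k) (auto simp: per add.assoc[symmetric] add.commute[of n])
    then have "w (i mod n) = w i" for i by (metis mod_div_mult_eq)
    then show "(\<lambda>i. ?\<phi> w ! (i mod n)) = w" using n by auto
  qed
  show "\<forall>l\<in>?X. ?\<phi> (\<lambda>i. l ! (i mod n)) = l"
    by (auto intro!: nth_equalityI)
  show "?\<phi> ` ?P \<subseteq> ?X"
  proof (rule image_subsetI)
    fix w assume w: "w \<in> ?P"
    have "(\<lambda>i. w (i + n)) = w" using w by (simp only: funpow_shift mem_Collect_eq)
    from fun_cong[OF this, of 0] have wn: "w n = w 0" by simp
    have "fst (w (n - 1)) \<noteq> fst (w (Suc (n - 1)))" using w by (auto simp: markov_space_def)
    then have "fst (w (n - 1)) \<noteq> fst s" using n w wn by simp
    then show "?\<phi> w \<in> ?X" using w n by (simp add: reduced_markov hd_map last_map)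
  qed
  show "(\<lambda>l i. l ! (i mod n)) ` ?X \<subseteq> ?P"
  proof (rule image_subsetI)
    fix l assume l: "l \<in> ?X"
    then have ne: "l \<noteq> []" using n by auto
    have "l ! (i mod n) \<in> alphabet A" for i
      using l n nth_mem[of "i mod n" l] by (auto simp: reduced_def)
    moreover have "fst (l ! (i mod n)) \<noteq> fst (l ! (Suc i mod n))" for i
    proof (cases "Suc (i mod n) = n")
      case True
      then have "Suc i mod n = 0" "i mod n = n - 1" by (auto simp: mod_Suc)
      then show ?thesis using l ne by (auto simp: hd_conv_nth last_conv_nth)
    next
      case False
      then have "Suc i mod n = Suc (i mod n)" by (simp add: mod_Suc)
      moreover have "Suc (i mod n) < n" using False mod_less_divisor[OF n, of i] by linarith
      ultimately show ?thesis using l by (auto simp: reduced_def successively_conv_nth)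
    qed
    ultimately show "(\<lambda>i. l ! (i mod n)) \<in> ?P"
      using l ne by (auto simp: markov_space_def funpow_shift hd_conv_nth)
  qed
qed

lemma ennreal_ln_less:
  assumes "ennreal_ln x / ereal (real n) < ereal \<epsilon>" "n > 0"
  shows "x \<le> ennreal (exp (\<epsilon> * real n))"
proof (cases x)
  case (real r)
  show ?thesis
  proof (cases "r = 0")
    case False
    then have "ln r / real n < \<epsilon>" using assms real by (simp add: ennreal_ln_def)
    then have "ln r < \<epsilon> * real n" using assms(2) by (simp add: divide_less_eq)
    then have "r \<le> exp (\<epsilon> * real n)" using real False by (metis exp_le_cancel_iff exp_ln less_eq_real_def)
    then show ?thesis using real by (simp add: ennreal_leI)
  qed (use real in simp)
next
  case top
  then show ?thesis using assms by (simp add: ennreal_ln_def)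
qed

lemma less_ennreal_ln:
  assumes "ereal \<epsilon> < ennreal_ln x / ereal (real n)" "n > 0"
  shows "ennreal (exp (\<epsilon> * real n)) < x"
proof (cases x)
  case (real r)
  have r0: "r \<noteq> 0"
  proof
    assume "r = 0"
    then have "ennreal_ln x / ereal (real n) = - \<infinity>" using real assms(2) by (simp add: ennreal_ln_def)
    then show False using assms by simp
  qed
  then have "\<epsilon> < ln r / real n" using assms real by (simp add: ennreal_ln_def)
  then have "\<epsilon> * real n < ln r" using assms(2) by (simp add: less_divide_eq)
  then have "exp (\<epsilon> * real n) < r" using real r0 by (metis exp_less_cancel_iff exp_ln less_eq_real_def)
  then show ?thesis using real by (simp add: ennreal_less_iff)
qed simp

text \<open>Zero pressure sandwiches the periodic sums between exp (- \<epsilon> n) and exp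
  (\<epsilon> n) for large n. Replacing Birkhoff sums by \<open>D\<close> costs the factor
  \<open>exp (\<bar>t\<bar> * C')\<close>, which becomes the constant \<open>K\<close> of the
  locale.\<close>

lemma zero_pressureI:
  fixes A :: "'g set" and \<Phi> :: "(nat \<Rightarrow> 'g \<times> int) \<Rightarrow> real"
  assumes A: "finite A" "card A \<ge> 3"
    and growth: "c > 0" "\<And>l. reduced A l \<Longrightarrow> c * real (length l) - C \<le> D l"
    and quasi_add: "\<And>l l'. reduced A (l @ l') \<Longrightarrow> \<bar>D (l @ l') - (D l + D l')\<bar> \<le> E"
    and approx: "\<And>w n. w \<in> markov_space A \<Longrightarrow> \<bar>birkhoff_sum \<Phi> n w - D (map w [0..<n])\<bar> \<le> C'"
    and pressure: "has_gurevich_pressure A (\<lambda>w. - t * \<Phi> w) 0"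
    and s: "s \<in> alphabet A"
  shows "zero_pressure A D c C E (exp (\<bar>t\<bar> * C')) t s"
proof -
  let ?p = "periodic_sum A (\<lambda>w. - t * \<Phi> w) s"
  let ?P = "\<lambda>n. {w \<in> markov_space A. (shift ^^ n) w = w \<and> w 0 = s}"
  let ?X = "\<lambda>n. {l. reduced A l \<and> length l = n \<and> hd l = s \<and> fst (last l) \<noteq> fst s}"
  let ?e = "\<lambda>n w. exp (birkhoff_sum (\<lambda>w. - t * \<Phi> w) n w)"
  have lim: "(\<lambda>n. ennreal_ln (?p n) / ereal (real n)) \<longlonglongrightarrow> 0"
    using pressure s by (simp add: has_gurevich_pressure_def)
  have b: "\<bar>t * D (map w [0..<n]) + birkhoff_sum (\<lambda>w. - t * \<Phi> w) n w\<bar> \<le> \<bar>t\<bar> * C'"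
    if "w \<in> ?P n" for w n
  proof -
    have "birkhoff_sum (\<lambda>w. - t * \<Phi> w) n w = - t * birkhoff_sum \<Phi> n w"
      by (simp add: birkhoff_sum_def sum_distrib_left)
    then have "\<bar>t * D (map w [0..<n]) + birkhoff_sum (\<lambda>w. - t * \<Phi> w) n w\<bar>
        = \<bar>t\<bar> * \<bar>birkhoff_sum \<Phi> n w - D (map w [0..<n])\<bar>"
      by (simp add: abs_mult[symmetric] algebra_simps abs_minus_commute)
    also have "\<dots> \<le> \<bar>t\<bar> * C'" using approx[of w n] that by (intro mult_left_mono) auto
    finally show ?thesis .
  qed
  have e1: "exp (- t * D (map w [0..<n])) \<le> exp (\<bar>t\<bar> * C') * ?e n w"
    and e2: "?e n w \<le> exp (\<bar>t\<bar> * C') * exp (- t * D (map w [0..<n]))" if "w \<in> ?P n" for w n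
    using b[OF that] by (simp_all add: exp_add[symmetric] abs_le_iff)
  \<comment> \<open>A possibly infinite sum of nonnegative terms is the supremum of its finite
    partial sums; this is the source of the finite sets in the locale.\<close>
  have p_eq: "?p n = (SUP F\<in>{F. finite F \<and> F \<subseteq> ?P n}. ennreal (sum (?e n) F))" for n
    unfolding periodic_sum_def
    by (subst nonneg_infsum_complete) (simp_all add: sum_ennreal)
  show ?thesis
  proof
    fix \<epsilon> :: real assume "\<epsilon> > 0"
    then have e: "\<epsilon> > 0" "0 < ereal \<epsilon>" "ereal (- \<epsilon>) < 0" by simp_all
    show "\<forall>\<^sub>F n in sequentially. \<forall>F. finite F \<and> F \<subseteq> ?X n \<longrightarrow>
        (\<Sum>l\<in>F. exp (- t * D l)) \<le> exp (\<bar>t\<bar> * C') * exp (\<epsilon> * real n)"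
      using order_tendstoD(2)[OF lim e(2)] eventually_gt_at_top[of 0]
    proof eventually_elim
      case (elim n)
      show ?case
      proof (intro allI impI)
        fix F assume F: "finite F \<and> F \<subseteq> ?X n"
        note bij = periodic_words_bij[OF elim(2), of A s]
        obtain F' where F': "F' \<subseteq> ?P n" "F = (\<lambda>w. map w [0..<n]) ` F'" "inj_on (\<lambda>w. map w [0..<n]) F'"
          using F bij by (metis (no_types, lifting) bij_betw_def inj_on_subset subset_imageE)
        have fin: "finite F'" using F F' by (metis finite_imageD)
        have "ennreal (sum (?e n) F') \<le> ?p n" unfolding p_eq using F' fin by (intro SUP_upper) auto
        also have "\<dots> \<le> ennreal (exp (\<epsilon> * real n))" by (rule ennreal_ln_less) (use elim e in auto)
        finally have le: "sum (?e n) F' \<le> exp (\<epsilon> * real n)" by simp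
        have "(\<Sum>l\<in>F. exp (- t * D l)) = (\<Sum>w\<in>F'. exp (- t * D (map w [0..<n])))"
          unfolding F'(2) by (simp add: sum.reindex[OF F'(3)])
        also have "\<dots> \<le> (\<Sum>w\<in>F'. exp (\<bar>t\<bar> * C') * ?e n w)" using F' by (intro sum_mono e1) auto
        also have "\<dots> = exp (\<bar>t\<bar> * C') * sum (?e n) F'" by (simp add: sum_distrib_left)
        also have "\<dots> \<le> exp (\<bar>t\<bar> * C') * exp (\<epsilon> * real n)" using le by (intro mult_left_mono) auto
        finally show "(\<Sum>l\<in>F. exp (- t * D l)) \<le> exp (\<bar>t\<bar> * C') * exp (\<epsilon> * real n)" .
      qed
    qed
    show "\<forall>\<^sub>F n in sequentially. \<exists>F. finite F \<and> F \<subseteq> ?X n \<and>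
        exp (- \<epsilon> * real n) \<le> exp (\<bar>t\<bar> * C') * (\<Sum>l\<in>F. exp (- t * D l))"
      using order_tendstoD(1)[OF lim e(3)] eventually_gt_at_top[of 0]
    proof eventually_elim
      case (elim n)
      note bij = periodic_words_bij[OF elim(2), of A s]
      have "ennreal (exp (- \<epsilon> * real n)) < ?p n" by (rule less_ennreal_ln) (use elim in auto)
      then obtain F' where F': "finite F'" "F' \<subseteq> ?P n" "ennreal (exp (- \<epsilon> * real n)) < ennreal (sum (?e n) F')"
        unfolding p_eq less_SUP_iff by auto
      have inj: "inj_on (\<lambda>w. map w [0..<n]) F'"
        using bij F'(2) by (metis (no_types, lifting) bij_betw_def inj_on_subset)
      have "exp (- \<epsilon> * real n) \<le> sum (?e n) F'" using F'(3) by (simp add: ennreal_less_iff)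
      also have "\<dots> \<le> (\<Sum>w\<in>F'. exp (\<bar>t\<bar> * C') * exp (- t * D (map w [0..<n])))"
        using F' by (intro sum_mono e2) auto
      also have "\<dots> = exp (\<bar>t\<bar> * C') * (\<Sum>l\<in>(\<lambda>w. map w [0..<n]) ` F'. exp (- t * D l))"
        by (simp add: sum.reindex[OF inj] sum_distrib_left)
      finally show ?case
        using F' bij_betw_imp_surj_on[OF bij]
        by (intro exI[of _ "(\<lambda>w. map w [0..<n]) ` F'"]) (auto simp del: mem_Collect_eq)
    qed
  qed (use assms in auto)
qed

section \<open>The weighted Manhattan metric\<close>

text \<open>For a parabolic generator the condition on all powers is given. For a hyperbolic one it
  is given for the generator itself: complements yield it for the inverse with the two
  neighbourhoods exchanged, and iteration works because these are disjoint.\<close>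

lemma ping_pong_extended_schottky:
  fixes G :: "('g, 'm) monoid_scheme"
  assumes G: "group G" and \<rho>: "\<rho> \<in> mon G PSL2R"
    and letters: "Hs \<subseteq> carrier G" "Ps \<subseteq> carrier G"
    and es: "extended_schottky (\<rho> ` carrier G) (\<rho> ` Hs) (\<rho> ` Ps)"
  shows "\<exists>K. ping_pong G \<rho> (Hs \<union> Ps) K" and "finite (Hs \<union> Ps)" and "card (Hs \<union> Ps) \<ge> 3"
proof -
  interpret group G by (rule G)
  let ?A = "Hs \<union> Ps"
  have hom: "\<rho> \<in> hom G PSL2R" and inj: "inj_on \<rho> (carrier G)" using \<rho> by (auto simp: mon_def)
  have injA: "inj_on \<rho> Hs" "inj_on \<rho> Ps" using letters inj by (auto intro: inj_on_subset)
  have fin: "finite Hs" "finite Ps"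
    using es injA by (auto simp: extended_schottky_def dest: finite_imageD)
  then show finA: "finite ?A" by simp
  have hyp: "hyperbolic (\<rho> h)" if "h \<in> Hs" for h using es that by (auto simp: extended_schottky_def)
  have par: "parabolic (\<rho> p)" if "p \<in> Ps" for p using es that by (auto simp: extended_schottky_def)
  have excl: "\<not> hyperbolic g" if "parabolic g" for g using that by (auto simp: hyperbolic_def parabolic_def)
  have "Hs \<inter> Ps = {}" using hyp par excl by blast
  moreover have "card Hs + card Ps \<ge> 3"
    using es card_image[OF injA(1)] card_image[OF injA(2)] by (auto simp: extended_schottky_def)
  ultimately show cardA: "card ?A \<ge> 3" using fin by (simp add: card_Un_disjoint)
  obtain C C' E where
    CC: "\<forall>h\<in>\<rho> ` Hs. compact_boundary_nbhd (attracting_point h) (C h) \<and>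
          compact_boundary_nbhd (repelling_point h) (C' h) \<and> psl_act h ` (hyp_boundary - C' h) \<subseteq> C h"
    and E: "\<forall>p\<in>\<rho> ` Ps. compact_boundary_nbhd (parabolic_point p) (E p) \<and>
          (\<forall>n::int. n \<noteq> 0 \<longrightarrow> psl_act (p [^]\<^bsub>PSL2R\<^esub> n) ` (hyp_boundary - E p) \<subseteq> E p)"
    and disj: "disjoint_family_on (case_sum C (case_sum C' E)) (Sum_Type.Plus (\<rho> ` Hs) (Sum_Type.Plus (\<rho> ` Hs) (\<rho> ` Ps)))"
    using es unfolding extended_schottky_def by (elim exE conjE)
  have nbhd: "compact S \<and> S \<subseteq> sphere 0 1 \<and> S \<noteq> {}" if "compact_boundary_nbhd \<xi> S" for \<xi> S
    using that interior_of_subset[of "top_of_set hyp_boundary" S] unfolding compact_boundary_nbhd_def by blast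
  \<comment> \<open>The case distinction is consistent, because no element is both hyperbolic and
    parabolic.\<close>
  define K where "K = (\<lambda>a. if \<rho> a \<in> \<rho> ` Hs then C (\<rho> a) \<union> C' (\<rho> a) else E (\<rho> a))"
  have KH: "K a = C (\<rho> a) \<union> C' (\<rho> a)" if "a \<in> Hs" for a using that by (auto simp: K_def)
  have KP: "K a = E (\<rho> a)" if "a \<in> Ps" for a
  proof -
    have "\<not> hyperbolic (\<rho> a)" by (rule excl[OF par[OF that]])
    then have "\<rho> a \<notin> \<rho> ` Hs" using hyp by auto
    then show ?thesis by (simp add: K_def)
  qed
  have K: "compact (K a) \<and> K a \<subseteq> sphere 0 1 \<and> K a \<noteq> {}" if "a \<in> ?A" for a
  proof (cases "a \<in> Hs")
    case True
    then have "compact_boundary_nbhd (attracting_point (\<rho> a)) (C (\<rho> a))"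
      "compact_boundary_nbhd (repelling_point (\<rho> a)) (C' (\<rho> a))" using CC by blast+
    from nbhd[OF this(1)] nbhd[OF this(2)] show ?thesis using KH[OF True] by auto
  next
    case False
    then have a: "a \<in> Ps" using that by simp
    then have "compact_boundary_nbhd (parabolic_point (\<rho> a)) (E (\<rho> a))" using E by blast
    from nbhd[OF this] show ?thesis using KP[OF a] by simp
  qed
  have dj: "case_sum C (case_sum C' E) i \<inter> case_sum C (case_sum C' E) j = {}"
    if "i \<in> Sum_Type.Plus (\<rho> ` Hs) (Sum_Type.Plus (\<rho> ` Hs) (\<rho> ` Ps))" "j \<in> Sum_Type.Plus (\<rho> ` Hs) (Sum_Type.Plus (\<rho> ` Hs) (\<rho> ` Ps))" "i \<noteq> j" for i j
    using disj that by (rule disjoint_family_onD)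
  have dCC: "C g \<inter> C h = {}" if "g \<in> \<rho> ` Hs" "h \<in> \<rho> ` Hs" "g \<noteq> h" for g h
    using dj[of "Inl g" "Inl h"] that by auto
  have dCC': "C g \<inter> C' h = {}" if "g \<in> \<rho> ` Hs" "h \<in> \<rho> ` Hs" for g h
    using dj[of "Inl g" "Inr (Inl h)"] that by auto
  have dC'C': "C' g \<inter> C' h = {}" if "g \<in> \<rho> ` Hs" "h \<in> \<rho> ` Hs" "g \<noteq> h" for g h
    using dj[of "Inr (Inl g)" "Inr (Inl h)"] that by auto
  have dCE: "C g \<inter> E p = {}" if "g \<in> \<rho> ` Hs" "p \<in> \<rho> ` Ps" for g p
    using dj[of "Inl g" "Inr (Inr p)"] that by auto
  have dC'E: "C' g \<inter> E p = {}" if "g \<in> \<rho> ` Hs" "p \<in> \<rho> ` Ps" for g p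
    using dj[of "Inr (Inl g)" "Inr (Inr p)"] that by auto
  have dEE: "E p \<inter> E q = {}" if "p \<in> \<rho> ` Ps" "q \<in> \<rho> ` Ps" "p \<noteq> q" for p q
    using dj[of "Inr (Inr p)" "Inr (Inr q)"] that by auto
  have Kdisj: "K a \<inter> K b = {}" if "a \<in> ?A" "b \<in> ?A" "a \<noteq> b" for a b
  proof -
    have ne: "\<rho> a \<noteq> \<rho> b" using that letters inj by (auto dest: inj_onD)
    have HH: ?thesis if "a \<in> Hs" "b \<in> Hs"
      using that ne dCC[of "\<rho> a" "\<rho> b"] dCC'[of "\<rho> a" "\<rho> b"] dCC'[of "\<rho> b" "\<rho> a"] dC'C'[of "\<rho> a" "\<rho> b"]
      by (auto simp: KH)
    have HP: "K x \<inter> K y = {}" if "x \<in> Hs" "y \<in> Ps" for x y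
      using that dCE[of "\<rho> x" "\<rho> y"] dC'E[of "\<rho> x" "\<rho> y"] by (auto simp: KH KP)
    have PP: ?thesis if "a \<in> Ps" "b \<in> Ps" using that ne dEE[of "\<rho> a" "\<rho> b"] by (auto simp: KP)
    show ?thesis using that HH HP PP by blast
  qed
  have hom_pow: "\<rho> (a [^]\<^bsub>G\<^esub> (n::int)) = \<rho> a [^]\<^bsub>PSL2R\<^esub> n" if "a \<in> carrier G" for a n
    by (rule hom_int_pow[OF hom that G group_PSL2R])
  have play: "psl_act (\<rho> (a [^]\<^bsub>G\<^esub> n)) ` (sphere 0 1 - K a) \<subseteq> K a" if a: "a \<in> ?A" and n: "n \<noteq> 0" for a and n :: int
  proof (cases "a \<in> Ps")
    case True
    then have "a \<in> carrier G" using letters by blast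
    moreover have "psl_act (\<rho> a [^]\<^bsub>PSL2R\<^esub> n) ` (sphere 0 1 - E (\<rho> a)) \<subseteq> E (\<rho> a)"
      using E True n by blast
    ultimately show ?thesis unfolding KP[OF True] by (simp only: hom_pow)
  next
    case False
    then have aH: "a \<in> Hs" "a \<in> carrier G" using a letters by auto
    define h where "h = \<rho> a"
    have h: "h \<in> carrier PSL2R" using hyp aH by (auto simp: h_def hyperbolic_def)
    interpret P: group PSL2R by (rule group_PSL2R)
    have act: "psl_act h ` (sphere 0 1 - C' h) \<subseteq> C h" using CC aH(1) unfolding h_def by blast
    have CS: "C h \<subseteq> sphere 0 1" "C' h \<subseteq> sphere 0 1" using K[OF a] aH by (auto simp: KH h_def)
    have CC': "C h \<inter> C' h = {}" using dCC'[of h h] aH by (auto simp: h_def)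
    have act': "psl_act (inv\<^bsub>PSL2R\<^esub> h) ` (sphere 0 1 - C h) \<subseteq> C' h"
    proof (rule image_subsetI, rule ccontr)
      fix x assume x: "x \<in> sphere 0 1 - C h" and notin: "psl_act (inv\<^bsub>PSL2R\<^esub> h) x \<notin> C' h"
      then have "psl_act (inv\<^bsub>PSL2R\<^esub> h) x \<in> sphere 0 1 - C' h" using psl_act_sphere[of "inv\<^bsub>PSL2R\<^esub> h" x] h by auto
      then have "psl_act h (psl_act (inv\<^bsub>PSL2R\<^esub> h) x) \<in> C h" using act by blast
      then show False using psl_act_inv(1)[OF h, of x] x by auto
    qed
    \<comment> \<open>Stated for arbitrary \<open>g\<close>, \<open>B\<close> and \<open>B'\<close>,
      so that it serves both the generator and its inverse.\<close>
    have pos: "psl_act (g [^]\<^bsub>PSL2R\<^esub> Suc k) ` (sphere 0 1 - B') \<subseteq> B"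
      if g: "g \<in> carrier PSL2R" and B: "psl_act g ` (sphere 0 1 - B') \<subseteq> B" "B \<subseteq> sphere 0 1" "B \<inter> B' = {}"
      for g B B' and k :: nat
    proof (induction k)
      case 0
      then show ?case using g B by simp
    next
      case (Suc k)
      have "psl_act (g [^]\<^bsub>PSL2R\<^esub> Suc (Suc k)) x \<in> B" if x: "x \<in> sphere 0 1 - B'" for x
      proof -
        have gx: "psl_act g x \<in> sphere 0 1 - B'" using x B by blast
        have "psl_act (g [^]\<^bsub>PSL2R\<^esub> Suc (Suc k)) x = psl_act (g [^]\<^bsub>PSL2R\<^esub> Suc k) (psl_act g x)"
          unfolding P.nat_pow_Suc[of g "Suc k"] by (rule psl_act_mult) (use g x in auto)
        then show ?thesis using Suc gx by auto
      qed
      then show ?case by blast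
    qed
    show ?thesis
    proof (cases "n > 0")
      case True
      then obtain k where k: "n = int (Suc k)" by (metis zero_less_imp_eq_int Suc_pred')
      have "\<rho> (a [^]\<^bsub>G\<^esub> n) = h [^]\<^bsub>PSL2R\<^esub> Suc k" unfolding hom_pow[OF aH(2)] k h_def by (rule int_pow_int)
      then show ?thesis using pos[OF h act CS(1) CC', of k] KH[OF aH(1)] by (auto simp: h_def)
    next
      case False
      then obtain k where k: "n = - int (Suc k)" using n by (metis linorder_neqE_linordered_idom zero_less_imp_eq_int Suc_pred' neg_0_less_iff_less minus_minus)
      have "\<rho> (a [^]\<^bsub>G\<^esub> n) = inv\<^bsub>PSL2R\<^esub> (h [^]\<^bsub>PSL2R\<^esub> Suc k)"
        unfolding hom_pow[OF aH(2)] k h_def using h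
        by (metis P.int_pow_neg_int h_def)
      also have "\<dots> = (inv\<^bsub>PSL2R\<^esub> h) [^]\<^bsub>PSL2R\<^esub> Suc k" using h by (metis P.nat_pow_inv)
      finally show ?thesis
        using pos[OF P.inv_closed[OF h] act' CS(2), of k] CC' KH[OF aH(1)] by (auto simp: h_def)
    qed
  qed
  have lettersA: "?A \<subseteq> carrier G" using letters by simp
  \<comment> \<open>Generation is known only for the image in \<open>PSL2R\<close>; words are built
    there by induction and pulled back to the group through injectivity of
    \<open>\<rho>\<close>.\<close>
  have gen: "\<exists>l. reduced ?A l \<and> \<rho> (word_val G l) = g" if "g \<in> generate PSL2R (\<rho> ` Hs \<union> \<rho> ` Ps)" for g
    using that
  proof (induction rule: generate.induct)
    case one
    have "\<rho> \<one>\<^bsub>G\<^esub> = \<one>\<^bsub>PSL2R\<^esub>" by (rule hom_one[OF hom G group_PSL2R])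
    then show ?case by (intro exI[of _ "[]"]) simp
  next
    case (incl g)
    then obtain a where a: "a \<in> ?A" "g = \<rho> a" by blast
    then show ?case using lettersA
      by (intro exI[of _ "[(a, 1)]"]) (auto simp: reduced_Cons alphabet_def)
  next
    case (inv g)
    then obtain a where a: "a \<in> ?A" "g = \<rho> a" by blast
    have ac: "a \<in> carrier G" using a lettersA by blast
    have "word_val G [(a, - 1)] = inv\<^bsub>G\<^esub> a" using ac int_pow_neg[OF ac, of 1] by simp
    moreover have "\<rho> (inv\<^bsub>G\<^esub> a) = inv\<^bsub>PSL2R\<^esub> g"
      unfolding a(2) using ac hom G group_PSL2R
      by (intro group_hom.hom_inv) (auto simp: group_hom_def group_hom_axioms_def)
    ultimately show ?case using a
      by (intro exI[of _ "[(a, - 1)]"]) (auto simp: reduced_Cons alphabet_def)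
  next
    case (eng g h)
    then obtain l l' where l: "reduced ?A l" "\<rho> (word_val G l) = g" "reduced ?A l'" "\<rho> (word_val G l') = h" by blast
    obtain k where "reduced ?A k" "word_val G k = word_val G l \<otimes>\<^bsub>G\<^esub> word_val G l'"
      using word_mult_word[OF lettersA l(3,1)] by blast
    then show ?case using l hom word_val_closed[OF lettersA] by (intro exI[of _ k]) (auto simp: hom_def)
  qed
  have "ping_pong G \<rho> ?A K"
  proof
    fix \<gamma> assume g: "\<gamma> \<in> carrier G"
    have "generate PSL2R (\<rho> ` Hs \<union> \<rho> ` Ps) = \<rho> ` carrier G" using es by (simp add: extended_schottky_def)
    then have "\<rho> \<gamma> \<in> generate PSL2R (\<rho> ` Hs \<union> \<rho> ` Ps)" using g by simp
    from gen[OF this] obtain l where l: "reduced ?A l" "\<rho> (word_val G l) = \<rho> \<gamma>" by blast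
    then have "word_val G l = \<gamma>" using inj g word_val_closed[OF lettersA] by (auto dest: inj_onD)
    then show "\<exists>l. reduced ?A l \<and> word_val G l = \<gamma>" using l by blast
  qed (use hom lettersA finA cardA K Kdisj play in auto)
  then show "\<exists>K. ping_pong G \<rho> ?A K" by blast
qed

lemma weighted_dist_orbit_approx:
  assumes \<rho>: "\<rho>1 \<in> carrier G \<rightarrow> carrier PSL2R" "\<rho>2 \<in> carrier G \<rightarrow> carrier PSL2R" and ab: "a \<ge> 0" "b \<ge> 0"
    and x: "x \<in> hyp_plane \<times> hyp_plane" and y: "y \<in> hyp_plane \<times> hyp_plane"
  obtains C where "\<And>\<gamma>. \<gamma> \<in> carrier G \<Longrightarrow>
    \<bar>weighted_dist a b x (diag_act \<rho>1 \<rho>2 \<gamma> y) - (a * ln (psl_size (\<rho>1 \<gamma>)) + b * ln (psl_size (\<rho>2 \<gamma>)))\<bar> \<le> C"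
proof -
  obtain C1 where C1: "\<And>g. g \<in> carrier PSL2R \<Longrightarrow> \<bar>hdist (fst x) (psl_act g (fst y)) - ln (psl_size g)\<bar> \<le> C1"
    using hdist_psl_act_approx[of "fst x" "fst y"] x y by (metis mem_Times_iff)
  obtain C2 where C2: "\<And>g. g \<in> carrier PSL2R \<Longrightarrow> \<bar>hdist (snd x) (psl_act g (snd y)) - ln (psl_size g)\<bar> \<le> C2"
    using hdist_psl_act_approx[of "snd x" "snd y"] x y by (metis mem_Times_iff)
  have "\<bar>weighted_dist a b x (diag_act \<rho>1 \<rho>2 \<gamma> y) - (a * ln (psl_size (\<rho>1 \<gamma>)) + b * ln (psl_size (\<rho>2 \<gamma>)))\<bar>
      \<le> a * C1 + b * C2" if "\<gamma> \<in> carrier G" for \<gamma>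
  proof -
    let ?u = "hdist (fst x) (psl_act (\<rho>1 \<gamma>) (fst y)) - ln (psl_size (\<rho>1 \<gamma>))"
    let ?v = "hdist (snd x) (psl_act (\<rho>2 \<gamma>) (snd y)) - ln (psl_size (\<rho>2 \<gamma>))"
    have "\<bar>a * ?u + b * ?v\<bar> \<le> \<bar>a * ?u\<bar> + \<bar>b * ?v\<bar>" by (rule abs_triangle_ineq)
    also have "\<dots> = a * \<bar>?u\<bar> + b * \<bar>?v\<bar>" using ab by (simp add: abs_mult)
    also have "\<dots> \<le> a * C1 + b * C2"
      using \<rho> that ab by (intro add_mono mult_left_mono C1 C2) auto
    finally show ?thesis by (simp add: weighted_dist_def diag_act_def algebra_simps)
  qed
  then show thesis by (rule that)
qed

theorem theorem10:
  fixes S :: "'a::topological_space set" and p :: 'a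
    and G :: "(real \<Rightarrow> 'a) set monoid"
    and \<rho>1 \<rho>2 :: "(real \<Rightarrow> 'a) set \<Rightarrow> (real^2^2) set"
    and Hs Ps :: "(real \<Rightarrow> 'a) set set"
    and a b t :: real
  assumes "surface S" and "euler_characteristic (top_of_set S) < 0"
    and "p \<in> S" and "G = fundamental_group S p"
    and "fuchsian G \<rho>1" and "fuchsian G \<rho>2"
    and "Hs \<subseteq> carrier G" and "Ps \<subseteq> carrier G"
    and "extended_schottky (\<rho>1 ` carrier G) (\<rho>1 ` Hs) (\<rho>1 ` Ps)"
    and "extended_schottky (\<rho>2 ` carrier G) (\<rho>2 ` Hs) (\<rho>2 ` Ps)"
    and "boundary_preserving_iso (\<rho>1 ` carrier G) (\<rho>2 ` carrier G)
           (\<rho>2 \<circ> inv_into (carrier G) \<rho>1)"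
    and "(a, b) \<in> {0..} \<times> {0..} - {(0, 0)}"
    and "has_gurevich_pressure (Hs \<union> Ps)
           (\<lambda>w. - t * (a * geometric_potential G \<rho>1 w + b * geometric_potential G \<rho>2 w)) 0"
  shows "(\<forall>q \<in> hyp_plane \<times> hyp_plane. ereal t = critical_exponent G \<rho>1 \<rho>2 a b q) \<and>
    (\<forall>x \<in> hyp_plane \<times> hyp_plane. \<forall>y \<in> hyp_plane \<times> hyp_plane.
       (\<forall>s. finite {\<gamma> \<in> carrier G. weighted_dist a b x (diag_act \<rho>1 \<rho>2 \<gamma> y) \<le> s}) \<and>
       filterlim (\<lambda>s. ln (real (orbit_count G \<rho>1 \<rho>2 a b x y s)) / s) (nhds t) at_top)"
proof -
  define A where "A = Hs \<union> Ps"
  have G: "group G" using assms(3,4) group_fundamental_group by simp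
  have mon: "\<rho>1 \<in> mon G PSL2R" "\<rho>2 \<in> mon G PSL2R" using assms(5,6) by (simp_all add: fuchsian_def)
  then have maps: "\<rho>1 \<in> carrier G \<rightarrow> carrier PSL2R" "\<rho>2 \<in> carrier G \<rightarrow> carrier PSL2R"
    by (auto simp: mon_def hom_def)
  note es1 = ping_pong_extended_schottky[OF G mon(1) assms(7,8,9), folded A_def]
  note es2 = ping_pong_extended_schottky[OF G mon(2) assms(7,8,10), folded A_def]
  obtain K1 where "ping_pong G \<rho>1 A K1" using es1(1) by blast
  then interpret P1: ping_pong G \<rho>1 A K1 .
  obtain K2 where "ping_pong G \<rho>2 A K2" using es2(1) by blast
  then interpret P2: ping_pong G \<rho>2 A K2 .
  have ab: "a \<ge> 0" "b \<ge> 0" "a > 0 \<or> b > 0" using assms(12) by auto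
  define L where "L = (\<lambda>\<gamma>. a * ln (psl_size (\<rho>1 \<gamma>)) + b * ln (psl_size (\<rho>2 \<gamma>)))"
  define D where "D = (\<lambda>l. L (word_val G l))"
  have combine: "\<bar>(a * u + b * v) - (a * u' + b * v')\<bar> \<le> a * e1 + b * e2"
    if "\<bar>u - u'\<bar> \<le> e1" "\<bar>v - v'\<bar> \<le> e2" for u v u' v' e1 e2
  proof -
    have "a * u \<le> a * (u' + e1)" "a * u' \<le> a * (u + e1)" "b * v \<le> b * (v' + e2)" "b * v' \<le> b * (v + e2)"
      using that ab by (auto intro!: mult_left_mono)
    then show ?thesis by (simp add: abs_le_iff distrib_left)
  qed

  obtain c1 C1 where c1: "c1 > 0" "\<And>l. reduced A l \<Longrightarrow> c1 * real (length l) - C1 \<le> ln (psl_size (\<rho>1 (word_val G l)))"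
    using P1.ln_sz_linear_growth by blast
  obtain c2 C2 where c2: "c2 > 0" "\<And>l. reduced A l \<Longrightarrow> c2 * real (length l) - C2 \<le> ln (psl_size (\<rho>2 (word_val G l)))"
    using P2.ln_sz_linear_growth by blast
  \<comment> \<open>One positive weight is enough, as both sizes grow linearly. This is how
    \<open>(a, b) \<noteq> (0, 0)\<close> enters.\<close>
  have c: "a * c1 + b * c2 > 0"
    using ab c1(1) c2(1) by (auto intro: add_pos_nonneg add_nonneg_pos)
  have growth: "(a * c1 + b * c2) * real (length l) - (a * C1 + b * C2) \<le> D l" if "reduced A l" for l
  proof -
    have "a * (c1 * real (length l) - C1) + b * (c2 * real (length l) - C2) \<le> D l"
      unfolding D_def L_def using ab that by (intro add_mono mult_left_mono c1 c2) auto
    then show ?thesis by (simp add: algebra_simps)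
  qed

  obtain E1 where E1: "\<And>l l'. reduced A (l @ l') \<Longrightarrow> \<bar>ln (psl_size (\<rho>1 (word_val G (l @ l')))) -
      (ln (psl_size (\<rho>1 (word_val G l))) + ln (psl_size (\<rho>1 (word_val G l'))))\<bar> \<le> E1"
    using P1.ln_sz_append by blast
  obtain E2 where E2: "\<And>l l'. reduced A (l @ l') \<Longrightarrow> \<bar>ln (psl_size (\<rho>2 (word_val G (l @ l')))) -
      (ln (psl_size (\<rho>2 (word_val G l))) + ln (psl_size (\<rho>2 (word_val G l'))))\<bar> \<le> E2"
    using P2.ln_sz_append by blast
  have quasi_add: "\<bar>D (l @ l') - (D l + D l')\<bar> \<le> a * E1 + b * E2" if "reduced A (l @ l')" for l l'
    using combine[OF E1[OF that] E2[OF that]] by (simp add: D_def L_def algebra_simps)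

  let ?\<tau> = "geometric_potential G \<rho>1" and ?\<kappa> = "geometric_potential G \<rho>2"
  obtain B1 where B1: "\<And>w n. w \<in> markov_space A \<Longrightarrow>
      \<bar>birkhoff_sum ?\<tau> n w - ln (psl_size (\<rho>1 (word_val G (map w [0..<n]))))\<bar> \<le> B1"
    using P1.birkhoff_sum_approx by blast
  obtain B2 where B2: "\<And>w n. w \<in> markov_space A \<Longrightarrow>
      \<bar>birkhoff_sum ?\<kappa> n w - ln (psl_size (\<rho>2 (word_val G (map w [0..<n]))))\<bar> \<le> B2"
    using P2.birkhoff_sum_approx by blast
  have approx: "\<bar>birkhoff_sum (\<lambda>w. a * ?\<tau> w + b * ?\<kappa> w) n w - D (map w [0..<n])\<bar> \<le> a * B1 + b * B2"
    if "w \<in> markov_space A" for w n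
  proof -
    have "birkhoff_sum (\<lambda>w. a * ?\<tau> w + b * ?\<kappa> w) n w = a * birkhoff_sum ?\<tau> n w + b * birkhoff_sum ?\<kappa> n w"
      by (simp add: birkhoff_sum_def sum.distrib sum_distrib_left)
    then show ?thesis using combine[OF B1[OF that] B2[OF that]] by (simp add: D_def L_def)
  qed

  obtain s where s: "s \<in> alphabet A"
  proof -
    obtain x where "x \<in> A" using es1(3) by fastforce
    then show thesis using that[of "(x, 1)"] by (simp add: alphabet_def)
  qed
  interpret Z: zero_pressure A D "a * c1 + b * c2" "a * C1 + b * C2" "a * E1 + b * E2"
    "exp (\<bar>t\<bar> * (a * B1 + b * B2))" t s
    by (rule zero_pressureI[OF es1(2,3) c growth quasi_add approx assms(13)[folded A_def] s])

  \<comment> \<open>Sums and counts over the group become sums and counts over reduced words, where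
    the results of \<open>zero_pressure\<close> apply.\<close>
  have bij: "bij_betw (word_val G) {l. reduced A l} (carrier G)"
    using P1.val_inj P1.generated by (auto simp: bij_betw_def)
  have orbit: "\<exists>C. \<forall>l. reduced A l \<longrightarrow> \<bar>weighted_dist a b x (diag_act \<rho>1 \<rho>2 (word_val G l) y) - D l\<bar> \<le> C"
    if "x \<in> hyp_plane \<times> hyp_plane" "y \<in> hyp_plane \<times> hyp_plane" for x y
    using weighted_dist_orbit_approx[OF maps ab(1,2) that] unfolding D_def L_def by (metis P1.val_closed)
  show ?thesis
  proof (intro conjI ballI allI)
    fix q :: "complex \<times> complex" assume q: "q \<in> hyp_plane \<times> hyp_plane"
    obtain C where C: "\<And>l. reduced A l \<Longrightarrow> \<bar>weighted_dist a b q (diag_act \<rho>1 \<rho>2 (word_val G l) q) - D l\<bar> \<le> C"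
      using orbit[OF q q] by blast
    show "ereal t = critical_exponent G \<rho>1 \<rho>2 a b q"
      unfolding critical_exponent_def summable_on_reindex_bij_betw[OF bij, symmetric]
      by (rule Z.critical_exponent_words[OF C, symmetric])
  next
    fix x y :: "complex \<times> complex" and R :: real
    assume xy: "x \<in> hyp_plane \<times> hyp_plane" "y \<in> hyp_plane \<times> hyp_plane"
    obtain C where C: "\<And>l. reduced A l \<Longrightarrow> \<bar>weighted_dist a b x (diag_act \<rho>1 \<rho>2 (word_val G l) y) - D l\<bar> \<le> C"
      using orbit[OF xy] by blast
    have eq: "{\<gamma> \<in> carrier G. weighted_dist a b x (diag_act \<rho>1 \<rho>2 \<gamma> y) \<le> R}
        = word_val G ` {l. reduced A l \<and> weighted_dist a b x (diag_act \<rho>1 \<rho>2 (word_val G l) y) \<le> R}" for R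
      unfolding bij_betw_imp_surj_on[OF bij, symmetric] by blast
    show "finite {\<gamma> \<in> carrier G. weighted_dist a b x (diag_act \<rho>1 \<rho>2 \<gamma> y) \<le> R}"
      unfolding eq by (rule finite_imageI[OF Z.finite_words_W_le[OF C]])
    have "orbit_count G \<rho>1 \<rho>2 a b x y R
        = card {l. reduced A l \<and> weighted_dist a b x (diag_act \<rho>1 \<rho>2 (word_val G l) y) \<le> R}" for R
      unfolding orbit_count_def eq by (rule card_image, rule inj_on_subset[OF P1.val_inj]) auto
    then show "((\<lambda>s. ln (real (orbit_count G \<rho>1 \<rho>2 a b x y s)) / s) \<longlongrightarrow> t) at_top"
      using Z.ln_count_words_tendsto[OF C] by simp
  qed
qed

end
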